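(* For integers $\tilde p\ge q\ge1$, consider the projection $$P_{\tilde p,q}:\Pi_{\tilde p}^I\to\Pi_q^I,\quad r=\begin{pmatrix}y&*\\ *&*\end{pmatrix}\longmapsto y$$ which maps $r$ to its upper left $q\times q$-block $y$. Then for all real parameters $\mu,\nu>d(\tilde p-1)/2$, the measure $\beta_{q;\mu,\nu}$ is the push-forward of the measure $\beta_{\tilde p;\mu,\nu}$ under $P_{\tilde p,q}$: $$P_{\tilde p,q}(\beta_{\tilde p;\mu,\nu})=\beta_{q;\mu,\nu}.$$
   Context: Let $\mathbb F\in\{\mathbb R,\mathbb C,\mathbb H\}$ and $d=\dim_{\mathbb R}\mathbb F\in\{1,2,4\}$. For an integer $r\ge1$, $H_r$ is the real vector space of Hermitian $r\times r$-matrices over $\mathbb F$, of dimension $n(r)=r+\frac d2r(r-1)$, with Lebesgue measure $dy$; $\Pi_r\subset H_r$ is the set of positive semidefinite matrices, $x\le y$ means $y-x\in\Pi_r$, and $\Pi_r^I=\{y\in\Pi_r: y\le I_r\}$. $\Delta$ denotes the determinant on $H_r$ (the product of the eigenvalues). For real $\mu,\nu>d(r-1)/2$, the beta distribution $\beta_{r;\mu,\nu}$ is the probability measure on $\Pi_r^I$ given by $$d\beta_{r;\mu,\nu}(y)=\frac1{B(\mu,\nu)}\Delta(y)^{\mu-n(r)/r}\Delta(I_r-y)^{\nu-n(r)/r}\,dy,\qquad B(\mu,\nu)=\int_{\Pi_r^I}\Delta(y)^{\mu-n(r)/r}\Delta(I_r-y)^{\nu-n(r)/r}\,dy .$$ 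*)

theory Defs
  imports "HOL-Analysis.Analysis" "Jordan_Normal_Form.Matrix"
begin

section \<open>Quaternions\<close>

datatype quat = Quat (qRe: real) (qI: real) (qJ: real) (qK: real)

lemma quat_eq_iff: "x = y \<longleftrightarrow> qRe x = qRe y \<and> qI x = qI y \<and> qJ x = qJ y \<and> qK x = qK y"
  by (auto intro: quat.expand)

instantiation quat :: ring_1
begin

definition zero_quat :: quat where "0 = Quat 0 0 0 0"
definition one_quat :: quat where "1 = Quat 1 0 0 0"
definition plus_quat :: "quat \<Rightarrow> quat \<Rightarrow> quat" where
  "x + y = Quat (qRe x + qRe y) (qI x + qI y) (qJ x + qJ y) (qK x + qK y)"
definition uminus_quat :: "quat \<Rightarrow> quat" where
  "- x = Quat (- qRe x) (- qI x) (- qJ x) (- qK x)"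
definition minus_quat :: "quat \<Rightarrow> quat \<Rightarrow> quat" where
  "x - y = Quat (qRe x - qRe y) (qI x - qI y) (qJ x - qJ y) (qK x - qK y)"
definition times_quat :: "quat \<Rightarrow> quat \<Rightarrow> quat" where
  "x * y = Quat
     (qRe x * qRe y - qI x * qI y - qJ x * qJ y - qK x * qK y)
     (qRe x * qI y + qI x * qRe y + qJ x * qK y - qK x * qJ y)
     (qRe x * qJ y - qI x * qK y + qJ x * qRe y + qK x * qI y)
     (qRe x * qK y + qI x * qJ y - qJ x * qI y + qK x * qRe y)"

lemmas quat_ring_defs = zero_quat_def one_quat_def plus_quat_def uminus_quat_def
  minus_quat_def times_quat_def

instance
  by standard (simp_all add: quat_eq_iff quat_ring_defs algebra_simps)

end

instantiation quat :: real_algebra_1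
begin

definition scaleR_quat :: "real \<Rightarrow> quat \<Rightarrow> quat" where
  "c *\<^sub>R x = Quat (c * qRe x) (c * qI x) (c * qJ x) (c * qK x)"

instance
proof
  fix a b :: real and x y :: quat
  show "a *\<^sub>R (x + y) = a *\<^sub>R x + a *\<^sub>R y"
    by (simp add: scaleR_quat_def plus_quat_def algebra_simps)
  show "(a + b) *\<^sub>R x = a *\<^sub>R x + b *\<^sub>R x"
    by (simp add: scaleR_quat_def plus_quat_def algebra_simps)
  show "a *\<^sub>R b *\<^sub>R x = (a * b) *\<^sub>R x"
    by (simp add: scaleR_quat_def)
  show "1 *\<^sub>R x = x"
    by (simp add: scaleR_quat_def)
  show "a *\<^sub>R x * y = a *\<^sub>R (x * y)"
    by (simp add: scaleR_quat_def times_quat_def algebra_simps)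
  show "x * a *\<^sub>R y = a *\<^sub>R (x * y)"
    by (simp add: scaleR_quat_def times_quat_def algebra_simps)
qed

end

instantiation quat :: real_inner
begin

definition inner_quat :: "quat \<Rightarrow> quat \<Rightarrow> real" where
  "inner_quat x y = qRe x * qRe y + qI x * qI y + qJ x * qJ y + qK x * qK y"
definition norm_quat :: "quat \<Rightarrow> real" where
  "norm_quat x = sqrt (inner x x)"
definition sgn_quat :: "quat \<Rightarrow> quat" where
  "sgn_quat x = x /\<^sub>R norm x"
definition dist_quat :: "quat \<Rightarrow> quat \<Rightarrow> real" where
  "dist_quat x y = norm (x - y)"
definition uniformity_quat :: "(quat \<times> quat) filter" where
  "uniformity_quat = (INF e\<in>{0 <..}. principal {(x, y). dist x y < e})"
definition open_quat :: "quat set \<Rightarrow> bool" where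
  "open_quat U \<longleftrightarrow> (\<forall>x\<in>U. eventually (\<lambda>(x', y). x' = x \<longrightarrow> y \<in> U) uniformity)"

instance
proof
  fix x y z :: quat and r :: real
  show "inner x y = inner y x"
    by (simp add: inner_quat_def algebra_simps)
  show "inner (x + y) z = inner x z + inner y z"
    by (simp add: inner_quat_def plus_quat_def algebra_simps)
  show "inner (r *\<^sub>R x) y = r * inner x y"
    by (simp add: inner_quat_def scaleR_quat_def algebra_simps)
  show "0 \<le> inner x x"
    by (simp add: inner_quat_def)
  show "inner x x = 0 \<longleftrightarrow> x = 0"
    by (simp add: inner_quat_def quat_eq_iff zero_quat_def add_nonneg_eq_0_iff)
qed (simp_all add: norm_quat_def sgn_quat_def dist_quat_def uniformity_quat_def open_quat_def)

end

instantiation quat :: euclidean_space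
begin

definition Basis_quat :: "quat set" where
  "Basis_quat = {Quat 1 0 0 0, Quat 0 1 0 0, Quat 0 0 1 0, Quat 0 0 0 1}"

instance
proof
  fix u v x :: quat
  show "(Basis :: quat set) \<noteq> {}" "finite (Basis :: quat set)"
    by (simp_all add: Basis_quat_def)
  show "inner u v = (if u = v then 1 else 0)" if "u \<in> Basis" "v \<in> Basis"
    using that unfolding Basis_quat_def
    by (elim insertE emptyE; hypsubst) (simp_all add: inner_quat_def)
  show "(\<forall>u\<in>Basis. inner x u = 0) \<longleftrightarrow> x = 0"
    by (cases x) (simp add: Basis_quat_def inner_quat_def zero_quat_def)
qed

end

lemma DIM_quat [simp]: "DIM(quat) = 4"
  by (simp add: Basis_quat_def)

instantiation quat :: conjugate
begin

definition conjugate_quat :: "quat \<Rightarrow> quat" where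
  "conjugate x = Quat (qRe x) (- qI x) (- qJ x) (- qK x)"

instance
  by standard (auto simp: conjugate_quat_def quat_eq_iff)

end

instantiation quat :: real_normed_div_algebra
begin

definition inverse_quat :: "quat \<Rightarrow> quat" where
  "inverse (x :: quat) = conjugate x /\<^sub>R inner x x"
definition divide_quat :: "quat \<Rightarrow> quat \<Rightarrow> quat" where
  "x div y = x * inverse (y :: quat)"

lemma mult_conjugate_quat:
  fixes x :: quat
  shows "x * conjugate x = inner x x *\<^sub>R 1" "conjugate x * x = inner x x *\<^sub>R 1"
  by (simp_all add: quat_eq_iff conjugate_quat_def inner_quat_def quat_ring_defs
      scaleR_quat_def algebra_simps)

instance
proof
  fix x y :: quat
  show "x \<noteq> 0 \<Longrightarrow> inverse x * x = 1"
    by (simp add: inverse_quat_def mult_conjugate_quat)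
  show "x \<noteq> 0 \<Longrightarrow> x * inverse x = 1"
    by (simp add: inverse_quat_def mult_conjugate_quat)
  show "x div y = x * inverse y"
    by (simp add: divide_quat_def)
  show "inverse (0 :: quat) = 0"
    by (simp add: inverse_quat_def)
  have "inner (x * y) (x * y) = inner x x * inner y y"
    by (simp add: inner_quat_def times_quat_def algebra_simps power2_eq_square)
  then show "norm (x * y) = norm x * norm y"
    by (simp add: norm_quat_def real_sqrt_mult)
qed

end


section \<open>Scalars\<close>

text \<open>
  By Frobenius' theorem the only algebras satisfying these axioms are, up to isomorphism,
  the reals, the complex numbers and the quaternions. The axioms serve to develop
  Hermitian matrices uniformly in the scalars; \<open>d\<close> is \<open>DIM('f)\<close>.
\<close>

class herm_scalar = real_normed_div_algebra + euclidean_space + conjugate +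
  assumes conjugate_plus: "conjugate (x + y) = conjugate x + conjugate y"
    and conjugate_times: "conjugate (x * y) = conjugate y * conjugate x"
    and conjugate_real: "conjugate (c *\<^sub>R 1) = c *\<^sub>R 1"
    and times_conjugate: "x * conjugate x = (norm x)\<^sup>2 *\<^sub>R 1"

instance real :: herm_scalar
  by standard (simp_all add: power2_eq_square)

instance complex :: herm_scalar
  by standard (simp_all add: complex_norm_square [symmetric] scaleR_conv_of_real)

instance quat :: herm_scalar
proof
  fix x y :: quat and c :: real
  show "conjugate (x + y) = conjugate x + conjugate y"
    by (simp add: conjugate_quat_def plus_quat_def)
  show "conjugate (x * y) = conjugate y * conjugate x"
    by (simp add: conjugate_quat_def times_quat_def algebra_simps)
  show "conjugate (c *\<^sub>R 1 :: quat) = c *\<^sub>R 1"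
    by (simp add: conjugate_quat_def scaleR_quat_def one_quat_def)
  show "x * conjugate x = (norm x)\<^sup>2 *\<^sub>R 1"
    by (simp add: mult_conjugate_quat power2_norm_eq_inner)
qed


section \<open>Hermitian matrices\<close>

definition conj_transpose :: "'f::herm_scalar mat \<Rightarrow> 'f mat" where
  "conj_transpose A = mat (dim_col A) (dim_row A) (\<lambda>(i, j). conjugate (A $$ (j, i)))"

definition herm_mats :: "nat \<Rightarrow> 'f::herm_scalar mat set" where
  "herm_mats r = {A \<in> carrier_mat r r. conj_transpose A = A}"

text \<open>For Hermitian \<open>A\<close> the scalar \<open>v\<^sup>* A v\<close> is automatically real.\<close>

definition psd_mats :: "nat \<Rightarrow> 'f::herm_scalar mat set" where
  "psd_mats r = {A \<in> herm_mats r.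
     \<forall>v\<in>carrier_vec r. \<exists>c\<ge>0. scalar_prod (conjugate v) (A *\<^sub>v v) = of_real c}"

definition herm_le :: "nat \<Rightarrow> 'f::herm_scalar mat \<Rightarrow> 'f mat \<Rightarrow> bool" where
  "herm_le r x y \<longleftrightarrow> y - x \<in> psd_mats r"

definition psd_interval :: "nat \<Rightarrow> 'f::herm_scalar mat set" where
  "psd_interval r = {y \<in> psd_mats r. herm_le r y (1\<^sub>m r)}"

text \<open>
  \<open>l 0, \<dots>, l (r - 1)\<close> lists the eigenvalues with multiplicity: the columns of \<open>U\<close> are an
  orthonormal basis of eigenvectors. Eigenvalues of Hermitian matrices are real (over the
  quaternions this refers to right eigenvalues), and real scalars are central, so that
  left multiplication by \<open>l i\<close> is harmless.
\<close>

definition eigenvalue_list :: "'f::herm_scalar mat \<Rightarrow> (nat \<Rightarrow> real) \<Rightarrow> bool" where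
  "eigenvalue_list A l \<longleftrightarrow> (\<exists>U \<in> carrier_mat (dim_row A) (dim_row A).
     conj_transpose U * U = 1\<^sub>m (dim_row A) \<and>
     (\<forall>i<dim_row A. A *\<^sub>v col U i = of_real (l i) \<cdot>\<^sub>v col U i))"

text \<open>
  The product of the eigenvalues; by the spectral theorem it exists and is unique for
  every Hermitian \<open>A\<close>.
\<close>

definition herm_det :: "'f::herm_scalar mat \<Rightarrow> real" where
  "herm_det A = (THE c. \<exists>l. eigenvalue_list A l \<and> c = (\<Prod>i<dim_row A. l i))"


section \<open>Lebesgue measure and beta distributions\<close>

definition herm_dim :: "'f::herm_scalar itself \<Rightarrow> nat \<Rightarrow> real" where
  "herm_dim _ r = real r + real DIM('f) / 2 * real r * (real r - 1)"

text \<open>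
  The real diagonal entries and the scalars above the diagonal are linear coordinates
  on the space of Hermitian matrices.
\<close>

definition herm_of_coords ::
  "nat \<Rightarrow> (nat \<Rightarrow> real) \<times> (nat \<times> nat \<Rightarrow> 'f) \<Rightarrow> 'f::herm_scalar mat" where
  "herm_of_coords r = (\<lambda>(a, z). mat r r (\<lambda>(i, j).
     if i = j then of_real (a i) else if i < j then z (i, j) else conjugate (z (j, i))))"

text \<open>
  Lebesgue measure on the Borel sets of \<open>herm_mats r\<close>, transported from these coordinates.
  Another normalization (e.g. from the trace inner product) changes it by a constant
  factor, which cancels in the beta distributions.
\<close>

definition herm_lborel :: "nat \<Rightarrow> 'f::herm_scalar mat measure" where
  "herm_lborel r = embed_measure
     ((\<Pi>\<^sub>M i\<in>{..<r}. lborel) \<Otimes>\<^sub>M (\<Pi>\<^sub>M ij\<in>{(i, j). i < j \<and> j < r}. lborel))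
     (herm_of_coords r)"

text \<open>
  The value of \<open>0 powr a\<close> in the next definition is immaterial: singular matrices form
  a null set.
\<close>

definition beta_weight :: "nat \<Rightarrow> real \<Rightarrow> real \<Rightarrow> 'f::herm_scalar mat \<Rightarrow> real" where
  "beta_weight r \<mu> \<nu> y =
     herm_det y powr (\<mu> - herm_dim TYPE('f) r / real r) *
     herm_det (1\<^sub>m r - y) powr (\<nu> - herm_dim TYPE('f) r / real r)"

definition beta_const :: "'f::herm_scalar itself \<Rightarrow> nat \<Rightarrow> real \<Rightarrow> real \<Rightarrow> real" where
  "beta_const _ r \<mu> \<nu> =
     (LINT y : psd_interval r | (herm_lborel r :: 'f mat measure). beta_weight r \<mu> \<nu> y)"

definition matrix_beta :: "nat \<Rightarrow> real \<Rightarrow> real \<Rightarrow> 'f::herm_scalar mat measure" where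
  "matrix_beta r \<mu> \<nu> =
     density (restrict_space (herm_lborel r) (psd_interval r))
       (\<lambda>y. ennreal (1 / beta_const TYPE('f) r \<mu> \<nu> * beta_weight r \<mu> \<nu> y))"

definition upper_left_block :: "nat \<Rightarrow> 'f mat \<Rightarrow> 'f mat" where
  "upper_left_block q A = mat q q (\<lambda>(i, j). A $$ (i, j))"

end

theory Submission
  imports Defs
begin

text \<open>
  It suffices to compare the sizes \<open>q + 1\<close> and \<open>q\<close>. A Hermitian matrix of size \<open>q + 1\<close> is a block
  \<open>Y\<close> of size \<open>q\<close>, bordered by a column \<open>z\<close> and a real corner \<open>t\<close>. If \<open>Y\<close> is positive definite, the
  bordered matrix is positive definite if and only if its Schur complement \<open>t - \<kappa>\<close> with
  \<open>\<kappa> = z\<^sup>* Y\<^sup>-\<^sup>1 z\<close> is positive, and its determinant is \<open>det Y * (t - \<kappa>)\<close>. Its complement to the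
  identity is bordered in the same way, with block \<open>1 - Y\<close>, column \<open>- z\<close> and corner \<open>1 - t\<close>, so that with
  \<open>\<kappa>' = z\<^sup>* (1 - Y)\<^sup>-\<^sup>1 z\<close> the density at size \<open>q + 1\<close> is
  \<open>det Y\<^sup>a det (1 - Y)\<^sup>b (t - \<kappa>)\<^sup>a (1 - t - \<kappa>')\<^sup>b\<close> where the last
  two factors are positive, and 0 elsewhere.
  The integral over \<open>t\<close> is a beta integral times \<open>(1 - \<kappa> - \<kappa>')\<close> to the power \<open>a + b + 1\<close>. Here
  \<open>\<kappa> + \<kappa>' = z\<^sup>* (Y (1 - Y))\<^sup>-\<^sup>1 z\<close>, a positive definite form in \<open>z\<close>, and the integral over \<open>z\<close> is
  therefore a constant times \<open>(det Y det (1 - Y))\<close> to the power \<open>d / 2\<close>. Raising the exponents by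
  \<open>d / 2\<close> is exactly the passage from size \<open>q + 1\<close> to size \<open>q\<close>
  (\<open>nn_integral_pd_weight_bordered\<close>, \<open>nn_integral_projection_step\<close>). The constant is positive and
  finite. Hence the total masses are positive and finite, by descent to size 0, and they are
  compatible with the projections.

  The scalars need not commute, and determinants are only given as products of eigenvalues. All
  their properties are drawn from one formula: if \<open>A\<close> is positive definite of size \<open>r\<close>, then the
  integral of \<open>g (x\<^sup>* A x)\<close> over all tuples \<open>x\<close> of \<open>r\<close> scalars, multiplied by \<open>det A\<close> to the power
  \<open>d / 2\<close>, is the integral of \<open>g (|x|\<^sup>2)\<close> (\<open>nn_integral_qform\<close>). It follows from the spectral theorem
  and from the invariance of Lebesgue measure under unitary maps (\<open>nn_integral_unitary\<close>). Its
  integrals do not refer to eigenvalues; therefore the product of the eigenvalues is well-defined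
  (\<open>prod_eigenvalues_unique\<close>) and the determinant is measurable. After completing the square it yields the
  determinant of a bordered matrix (\<open>herm_det_bordered\<close>), and the integral over \<open>z\<close> is computed in
  the same way.
\<close>

section \<open>Scalars\<close>

lemma conjugate_of_real [simp]: "conjugate (of_real c :: 'f::herm_scalar) = of_real c"
  by (simp add: of_real_def conjugate_real)

lemma conjugate_0 [simp]: "conjugate (0 :: 'f::herm_scalar) = 0"
  using conjugate_of_real[of 0] by simp

lemma conjugate_1 [simp]: "conjugate (1 :: 'f::herm_scalar) = 1"
  using conjugate_of_real[of 1] by simp

lemma conjugate_scaleR: "conjugate (c *\<^sub>R x :: 'f::herm_scalar) = c *\<^sub>R conjugate x"
  using conjugate_times[of "c *\<^sub>R 1" x] by (simp add: conjugate_real)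

lemma conjugate_minus [simp]: "conjugate (- x :: 'f::herm_scalar) = - conjugate x"
  using conjugate_scaleR[of "-1" x] by simp

lemma conjugate_diff: "conjugate (x - y :: 'f::herm_scalar) = conjugate x - conjugate y"
  using conjugate_plus[of x "- y"] by simp

lemma conjugate_sum: "conjugate (sum f S :: 'f::herm_scalar) = (\<Sum>i\<in>S. conjugate (f i))"
  by (induction S rule: infinite_finite_induct) (auto simp: conjugate_plus)

lemma continuous_on_conjugate [continuous_intros]:
  fixes f :: "'a::topological_space \<Rightarrow> 'f::herm_scalar"
  assumes "continuous_on S f"
  shows "continuous_on S (\<lambda>x. conjugate (f x))"
proof -
  have "linear (conjugate :: 'f \<Rightarrow> 'f)"
    by (intro linearI) (auto simp: conjugate_plus conjugate_scaleR)
  then have "bounded_linear (conjugate :: 'f \<Rightarrow> 'f)"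
    by (simp add: linear_conv_bounded_linear)
  then show ?thesis
    using assms by (rule bounded_linear.continuous_on)
qed

lemma borel_measurable_conjugate [measurable]: "(conjugate :: 'f::herm_scalar \<Rightarrow> 'f) \<in> borel_measurable borel"
  by (intro borel_measurable_continuous_onI continuous_intros)

text \<open>
  Polarizing \<open>x * conjugate x = |x|\<^sup>2\<close> recovers the Euclidean inner product from the algebra.
\<close>

lemma conjugate_polarization:
  "x * conjugate y + y * conjugate x = of_real (2 * inner x y :: real)" for x :: "'f::herm_scalar"
proof -
  have "x * conjugate y + y * conjugate x
      = (x + y) * conjugate (x + y) - x * conjugate x - y * conjugate y"
    by (simp add: conjugate_plus algebra_simps)
  also have "\<dots> = of_real ((norm (x + y))\<^sup>2 - (norm x)\<^sup>2 - (norm y)\<^sup>2)"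
    by (simp add: times_conjugate scaleR_conv_of_real)
  also have "(norm (x + y))\<^sup>2 - (norm x)\<^sup>2 - (norm y)\<^sup>2 = 2 * inner x y"
    by (simp add: power2_norm_eq_inner inner_add inner_commute)
  finally show ?thesis .
qed

lemma norm_conjugate [simp]: "norm (conjugate x) = norm (x :: 'f::herm_scalar)"
proof (cases "x = 0")
  case False
  have "norm x * norm (conjugate x) = (norm x)\<^sup>2"
    using arg_cong[OF times_conjugate[of x], of norm] by (simp add: norm_mult)
  with False show ?thesis
    by (simp add: power2_eq_square)
qed simp

lemma conjugate_times_self: "conjugate x * x = of_real ((norm x)\<^sup>2)" for x :: "'f::herm_scalar"
  using times_conjugate[of "conjugate x"] by (simp add: scaleR_conv_of_real)

lemma inner_conjugate_conjugate: "inner (conjugate x) (conjugate y) = inner x (y :: 'f::herm_scalar)"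
proof -
  have "(norm (conjugate x + conjugate y))\<^sup>2 = (norm (x + y))\<^sup>2"
    by (simp flip: conjugate_plus)
  then show ?thesis
    unfolding dot_norm by simp
qed

lemma inner_conjugate_1: "inner (conjugate x) 1 = inner (x :: 'f::herm_scalar) 1"
  using inner_conjugate_conjugate[of x 1] by simp

lemma inner_eq_inner_1: "inner x y = inner (x * conjugate y) (1 :: 'f::herm_scalar)"
proof -
  have "inner (x * conjugate y + y * conjugate x) 1 = 2 * inner x y"
    by (subst conjugate_polarization) (simp add: Real_Vector_Spaces.of_real_def del: scaleR_scaleR, simp flip: norm_eq_sqrt_inner add: dot_square_norm)
  moreover have "inner (y * conjugate x) 1 = inner (x * conjugate y) 1"
    using inner_conjugate_1[of "x * conjugate y"] by (simp add: conjugate_times)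
  ultimately show ?thesis
    by (simp add: inner_add_left)
qed

lemma inner_mult_right_adjoint: "inner (x * a) y = inner x (y * conjugate (a :: 'f::herm_scalar))"
  unfolding inner_eq_inner_1[of "x * a"] inner_eq_inner_1[of x]
  by (simp add: conjugate_times mult.assoc)

lemma inner_mult_left_adjoint: "inner (a * x) y = inner x (conjugate (a :: 'f::herm_scalar) * y)"
proof -
  have "inner (a * x) y = inner (conjugate x * conjugate a) (conjugate y)"
    using inner_conjugate_conjugate[of "a * x" y] by (simp only: conjugate_times)
  also have "\<dots> = inner (conjugate x) (conjugate (conjugate a * y))"
    by (simp only: inner_mult_right_adjoint conjugate_times conjugate_id)
  also have "\<dots> = inner x (conjugate a * y)"
    by (rule inner_conjugate_conjugate)
  finally show ?thesis .
qed

text \<open>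
  Consequently the real part of the trace of a product of matrices is independent of the order of the
  factors, even over non-commuting scalars.
\<close>

lemma inner_1_commute: "inner (a * b) 1 = inner (b * a) (1 :: 'f::herm_scalar)"
  using inner_mult_left_adjoint[of a b 1] inner_eq_inner_1[of b "conjugate a"] by simp

lemma inner_of_real_mult [simp]:
  "inner (of_real c * x) y = c * inner x (y :: 'f::herm_scalar)"
  "inner y (of_real c * x) = c * inner y (x :: 'f::herm_scalar)"
  by (simp_all flip: scaleR_conv_of_real)

lemma inner_mult_same_right:
  "inner (x * s) (y * s) = (norm s)\<^sup>2 * inner x (y :: 'f::herm_scalar)"
proof -
  have "inner (x * s) (y * s) = inner x (y * (s * conjugate s))"
    by (simp add: inner_mult_right_adjoint mult.assoc)
  then show ?thesis
    by (simp add: times_conjugate)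
qed

text \<open>A self-conjugate scalar satisfies \<open>x\<^sup>2 = |x|\<^sup>2\<close> and is therefore real.\<close>

lemma conjugate_eq_self_real:
  assumes "conjugate x = (x :: 'f::herm_scalar)"
  shows "x = of_real (inner x 1)"
proof -
  have "2 *\<^sub>R x = 2 *\<^sub>R of_real (inner x 1)"
    using conjugate_polarization[of x 1] assms by (simp add: scaleR_2 Real_Vector_Spaces.of_real_def)
  then show ?thesis
    by simp
qed

lemma of_real_mult_commute: "of_real c * x = x * (of_real c :: 'f::herm_scalar)"
  by (simp add: Real_Vector_Spaces.of_real_def)

section \<open>Vectors and matrices indexed by natural numbers\<close>

definition vinner :: "nat \<Rightarrow> (nat \<Rightarrow> 'f::herm_scalar) \<Rightarrow> (nat \<Rightarrow> 'f) \<Rightarrow> real" where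
  "vinner r x y = (\<Sum>i<r. inner (x i) (y i))"

text \<open>
  The result is undefined at indices from \<open>r\<close> on, so that it lies in the space of the product measure.
\<close>

definition mat_apply :: "nat \<Rightarrow> (nat \<Rightarrow> nat \<Rightarrow> 'f::herm_scalar) \<Rightarrow> (nat \<Rightarrow> 'f) \<Rightarrow> nat \<Rightarrow> 'f" where
  "mat_apply r A x = (\<lambda>i\<in>{..<r}. \<Sum>j<r. A i j * x j)"

definition adjoint_mat :: "(nat \<Rightarrow> nat \<Rightarrow> 'f::herm_scalar) \<Rightarrow> nat \<Rightarrow> nat \<Rightarrow> 'f" where
  "adjoint_mat A i j = conjugate (A j i)"

definition qform :: "nat \<Rightarrow> (nat \<Rightarrow> nat \<Rightarrow> 'f::herm_scalar) \<Rightarrow> (nat \<Rightarrow> 'f) \<Rightarrow> real" where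
  "qform r A x = vinner r x (mat_apply r A x)"

definition hermitian :: "nat \<Rightarrow> (nat \<Rightarrow> nat \<Rightarrow> 'f::herm_scalar) \<Rightarrow> bool" where
  "hermitian r A \<longleftrightarrow> (\<forall>i<r. \<forall>j<r. A j i = conjugate (A i j))"

text \<open>
  Families of \<open>k \<le> r\<close> columns are the intermediate stages in the construction of an eigenbasis.
\<close>

definition orthonormal_cols :: "nat \<Rightarrow> nat \<Rightarrow> (nat \<Rightarrow> nat \<Rightarrow> 'f::herm_scalar) \<Rightarrow> bool" where
  "orthonormal_cols r k U \<longleftrightarrow>
     (\<forall>i<k. \<forall>j<k. (\<Sum>m<r. conjugate (U m i) * U m j) = (if i = j then 1 else 0))"

definition eigenpairs ::
  "nat \<Rightarrow> nat \<Rightarrow> (nat \<Rightarrow> nat \<Rightarrow> 'f::herm_scalar) \<Rightarrow> (nat \<Rightarrow> nat \<Rightarrow> 'f) \<Rightarrow> (nat \<Rightarrow> real) \<Rightarrow> bool" where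
  "eigenpairs r k A U l \<longleftrightarrow>
     (\<forall>i<k. \<forall>m<r. (\<Sum>j<r. A m j * U j i) = of_real (l i) * U m i)"

lemma qform_eq: "qform r A x = (\<Sum>i<r. \<Sum>j<r. inner (x i) (A i j * x j))"
  by (simp add: qform_def vinner_def mat_apply_def inner_sum_right)

lemma vinner_self: "vinner r x x = (\<Sum>i<r. (norm (x i))\<^sup>2)"
  by (simp add: vinner_def power2_norm_eq_inner)

lemma vinner_commute: "vinner r x y = vinner r y x"
  by (simp add: vinner_def inner_commute)

lemma vinner_cong: "(\<And>i. i < r \<Longrightarrow> x i = x' i) \<Longrightarrow> (\<And>i. i < r \<Longrightarrow> y i = y' i) \<Longrightarrow> vinner r x y = vinner r x' y'"
  by (simp add: vinner_def)

lemma mat_apply_cong: "(\<And>i. i < r \<Longrightarrow> x i = x' i) \<Longrightarrow> mat_apply r A x = mat_apply r A x'"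
  by (auto simp: mat_apply_def fun_eq_iff)

lemma mat_apply_nth: "i < r \<Longrightarrow> mat_apply r A x i = (\<Sum>j<r. A i j * x j)"
  by (simp add: mat_apply_def)

lemma vinner_mat_apply_left: "vinner r (mat_apply r A x) y = vinner r x (mat_apply r (adjoint_mat A) y)"
proof -
  have "vinner r (mat_apply r A x) y = (\<Sum>i<r. \<Sum>j<r. inner (x j) (conjugate (A i j) * y i))"
    by (simp add: vinner_def mat_apply_def inner_sum_left inner_mult_left_adjoint)
  also have "\<dots> = (\<Sum>j<r. \<Sum>i<r. inner (x j) (conjugate (A i j) * y i))"
    by (rule sum.swap)
  also have "\<dots> = vinner r x (mat_apply r (adjoint_mat A) y)"
    by (simp add: vinner_def mat_apply_def inner_sum_right adjoint_mat_def)
  finally show ?thesis .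
qed

lemma hermitian_vinner:
  assumes "hermitian r A"
  shows "vinner r (mat_apply r A x) y = vinner r x (mat_apply r A y)"
proof -
  have "adjoint_mat A i j = A i j" if "i < r" "j < r" for i j
    using assms that unfolding adjoint_mat_def hermitian_def by metis
  then have "mat_apply r (adjoint_mat A) y = mat_apply r A y"
    by (simp add: mat_apply_def restrict_def fun_eq_iff)
  then show ?thesis
    by (simp add: vinner_mat_apply_left)
qed

lemma mat_apply_mat_apply_id:
  assumes "\<And>i j. i < r \<Longrightarrow> j < r \<Longrightarrow> (\<Sum>m<r. A i m * B m j) = (if i = j then 1 else 0)" and "i < r"
  shows "mat_apply r A (mat_apply r B x) i = x i"
proof -
  have "mat_apply r A (mat_apply r B x) i = (\<Sum>m<r. \<Sum>j<r. A i m * B m j * x j)"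
    using assms(2) by (simp add: mat_apply_def sum_distrib_left mult.assoc)
  also have "\<dots> = (\<Sum>j<r. (\<Sum>m<r. A i m * B m j) * x j)"
    unfolding sum_distrib_right by (rule sum.swap)
  also have "\<dots> = (\<Sum>j<r. if i = j then x j else 0)"
    using assms by (intro sum.cong) auto
  also have "\<dots> = x i"
    using assms(2) by simp
  finally show ?thesis .
qed

text \<open>
  The matrix \<open>P = 1 - U U\<^sup>*\<close> is an orthogonal projection, so that the sum of \<open>|P i j|\<^sup>2\<close>
  is its trace \<open>r - k\<close>. This replaces dimension counting: for \<open>k < r\<close> some column of \<open>P\<close> is a nonzero
  vector orthogonal to the columns of \<open>U\<close>, and for \<open>k = r\<close> it follows that \<open>U U\<^sup>* = 1\<close>.
\<close>

lemma projection_norm_sum: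
  fixes U :: "nat \<Rightarrow> nat \<Rightarrow> 'f::herm_scalar"
  assumes U: "orthonormal_cols r k U"
  defines "P \<equiv> \<lambda>i j. (if i = j then 1 else 0) - (\<Sum>m<k. U i m * conjugate (U j m))"
  shows "(\<Sum>i<r. \<Sum>j<r. (norm (P i j))\<^sup>2) = real r - real k"
    and "\<And>m j. m < k \<Longrightarrow> j < r \<Longrightarrow> (\<Sum>i<r. conjugate (U i m) * P i j) = 0"
proof -
  define D :: "nat \<Rightarrow> nat \<Rightarrow> 'f" where "D i j = (if i = j then 1 else 0)" for i j
  have P: "P i j = D i j - (\<Sum>m<k. U i m * conjugate (U j m))" for i j
    by (simp add: P_def D_def)
  have D_right: "(\<Sum>i<r. c i * D i j) = c j" and D_left: "(\<Sum>i<r. D j i * c i) = c j"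
    if "j < r" for c j
    using that by (simp_all add: D_def if_distrib[where f="\<lambda>x. _ * x"] if_distrib[where f="\<lambda>x. x * _"] cong: if_cong)
  show orth: "(\<Sum>i<r. conjugate (U i m) * P i j) = 0" if "m < k" "j < r" for m j
  proof -
    have "(\<Sum>i<r. conjugate (U i m) * P i j) =
        (\<Sum>i<r. conjugate (U i m) * D i j) - (\<Sum>i<r. \<Sum>n<k. conjugate (U i m) * U i n * conjugate (U j n))"
      by (simp add: P right_diff_distrib sum_subtractf sum_distrib_left mult.assoc)
    also have "(\<Sum>i<r. \<Sum>n<k. conjugate (U i m) * U i n * conjugate (U j n))
        = (\<Sum>n<k. (\<Sum>i<r. conjugate (U i m) * U i n) * conjugate (U j n))"
      unfolding sum_distrib_right by (rule sum.swap)
    also have "\<dots> = (\<Sum>n<k. if m = n then conjugate (U j n) else 0)"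
      using U that by (intro sum.cong) (auto simp: orthonormal_cols_def)
    finally show ?thesis
      using that by (simp add: D_right)
  qed
  have herm: "conjugate (P i j) = P j i" for i j
    unfolding P_def by (auto simp: conjugate_diff conjugate_sum conjugate_times)
  have idem: "(\<Sum>i<r. conjugate (P i j) * P i j) = P j j" if "j < r" for j
  proof -
    have "(\<Sum>i<r. conjugate (P i j) * P i j) = (\<Sum>i<r. P j i * P i j)"
      by (simp add: herm)
    also have "\<dots> = (\<Sum>i<r. D j i * P i j) - (\<Sum>i<r. \<Sum>m<k. U j m * conjugate (U i m) * P i j)"
      by (subst P) (simp add: left_diff_distrib sum_subtractf sum_distrib_right)
    also have "(\<Sum>i<r. \<Sum>m<k. U j m * conjugate (U i m) * P i j) = (\<Sum>m<k. U j m * (\<Sum>i<r. conjugate (U i m) * P i j))"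
      unfolding sum_distrib_left mult.assoc by (rule sum.swap)
    also have "\<dots> = 0"
      using orth that by simp
    finally show ?thesis
      using that by (simp add: D_left)
  qed
  have "(\<Sum>i<r. \<Sum>j<r. (norm (P i j))\<^sup>2) = (\<Sum>j<r. \<Sum>i<r. (norm (P i j))\<^sup>2)"
    by (rule sum.swap)
  also have "\<dots> = (\<Sum>j<r. inner (\<Sum>i<r. conjugate (P i j) * P i j) 1)"
    by (simp add: conjugate_times_self inner_sum_left Real_Vector_Spaces.of_real_def)
       (simp flip: norm_eq_sqrt_inner add: dot_square_norm)
  also have "\<dots> = (\<Sum>j<r. inner (P j j) 1)"
    using idem by simp
  also have "\<dots> = real r - (\<Sum>j<r. \<Sum>m<k. inner (U j m * conjugate (U j m)) 1)"
    by (simp add: P_def inner_diff_left sum_subtractf inner_sum_left dot_square_norm)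
  also have "(\<Sum>j<r. \<Sum>m<k. inner (U j m * conjugate (U j m)) 1) = (\<Sum>m<k. inner (\<Sum>j<r. conjugate (U j m) * U j m) 1)"
    by (subst sum.swap) (simp add: inner_sum_left inner_1_commute[of "U _ _"])
  also have "\<dots> = real k"
    using U by (simp add: orthonormal_cols_def dot_square_norm)
  finally show "(\<Sum>i<r. \<Sum>j<r. (norm (P i j))\<^sup>2) = real r - real k" .
qed

lemma orthonormal_rows:
  assumes "orthonormal_cols r r U" "i < r" "j < r"
  shows "(\<Sum>m<r. U i m * conjugate (U j m)) = (if i = j then 1 else 0)"
proof -
  have "(norm ((if i = j then 1 else 0) - (\<Sum>m<r. U i m * conjugate (U j m))))\<^sup>2 = 0"
    using projection_norm_sum(1)[OF assms(1)] assms(2,3)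
    by (simp add: sum_nonneg_eq_0_iff sum_nonneg)
  then show ?thesis
    by (simp split: if_splits)
qed

lemma mat_apply_unitary:
  assumes "orthonormal_cols r r U" "i < r"
  shows "mat_apply r U (mat_apply r (adjoint_mat U) x) i = x i"
    and "mat_apply r (adjoint_mat U) (mat_apply r U x) i = x i"
  using assms orthonormal_rows[OF assms(1)]
  by (auto intro!: mat_apply_mat_apply_id simp: adjoint_mat_def orthonormal_cols_def)

lemma vinner_unitary:
  assumes "orthonormal_cols r r U"
  shows "vinner r (mat_apply r U x) (mat_apply r U y) = vinner r x y"
  unfolding vinner_mat_apply_left
  by (intro vinner_cong) (simp_all add: mat_apply_unitary[OF assms])

text \<open>In the coordinates given by an eigenbasis the matrix acts diagonally.\<close>

lemma mat_apply_eigenbasis: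
  assumes "eigenpairs r r A U l"
  shows "mat_apply r A (mat_apply r U x) = mat_apply r U (\<lambda>i. of_real (l i) * x i)"
proof -
  have "(\<Sum>j<r. A m j * (\<Sum>i<r. U j i * x i)) = (\<Sum>i<r. U m i * (of_real (l i) * x i))" if "m < r" for m
  proof -
    have "(\<Sum>j<r. A m j * (\<Sum>i<r. U j i * x i)) = (\<Sum>i<r. (\<Sum>j<r. A m j * U j i) * x i)"
      unfolding sum_distrib_left sum_distrib_right mult.assoc by (rule sum.swap)
    also have "\<dots> = (\<Sum>i<r. U m i * (of_real (l i) * x i))"
      using assms that by (auto simp: eigenpairs_def of_real_mult_commute mult.assoc intro!: sum.cong)
    finally show ?thesis .
  qed
  then show ?thesis
    by (auto simp: mat_apply_def fun_eq_iff)
qed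

lemma qform_eigenbasis:
  assumes "orthonormal_cols r r U" "eigenpairs r r A U l"
  shows "qform r A (mat_apply r U x) = (\<Sum>i<r. l i * (norm (x i))\<^sup>2)"
  unfolding qform_def mat_apply_eigenbasis[OF assms(2)] vinner_unitary[OF assms(1)]
  by (simp add: vinner_def power2_norm_eq_inner)


section \<open>The spectral theorem\<close>

text \<open>
  Vectors are extended by zero here: the remaining factors of the product are then singletons, and
  Tychonoff's theorem applies.
\<close>

lemma compact_bounded_support:
  "compact {x :: nat \<Rightarrow> 'f::herm_scalar. \<forall>i. x i \<in> (if i < r then cball 0 1 else {0})}"
proof -
  have "compactin (product_topology (\<lambda>_. euclidean) UNIV)
      (PiE UNIV (\<lambda>i. if i < r then cball 0 1 else {0 :: 'f}))"
    by (subst compactin_PiE) auto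
  also have "PiE UNIV (\<lambda>i. if i < r then cball 0 1 else {0 :: 'f})
      = {x. \<forall>i. x i \<in> (if i < r then cball 0 1 else {0})}"
    by (auto simp: PiE_iff split: if_splits)
  finally show ?thesis
    by (simp add: euclidean_product_topology)
qed

lemma qform_scale: "qform r A (\<lambda>i. c *\<^sub>R x i) = c\<^sup>2 * qform r A x"
  by (simp add: qform_eq sum_distrib_left power2_eq_square mult.assoc)

lemma qform_cong: "(\<And>i. i < r \<Longrightarrow> x i = y i) \<Longrightarrow> qform r A x = qform r A y"
  by (simp add: qform_eq)

lemma qform_cong_mat: "(\<And>i j. i < r \<Longrightarrow> j < r \<Longrightarrow> A i j = B i j) \<Longrightarrow> qform r A x = qform r B x"
  by (simp add: qform_eq)

lemma hermitian_qform_add: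
  assumes "hermitian r A"
  shows "qform r A (\<lambda>i. x i + t *\<^sub>R h i) = qform r A x + 2 * t * vinner r (mat_apply r A x) h + t\<^sup>2 * qform r A h"
proof -
  have "mat_apply r A (\<lambda>i. x i + t *\<^sub>R h i) = (\<lambda>i\<in>{..<r}. mat_apply r A x i + t *\<^sub>R mat_apply r A h i)"
    by (auto simp: mat_apply_def fun_eq_iff algebra_simps sum.distrib scaleR_sum_right)
  then have "qform r A (\<lambda>i. x i + t *\<^sub>R h i) = qform r A x + t * vinner r x (mat_apply r A h)
      + t * vinner r h (mat_apply r A x) + t\<^sup>2 * qform r A h"
    by (simp add: qform_def vinner_def inner_add sum.distrib sum_distrib_left algebra_simps power2_eq_square)
  then show ?thesis
    by (simp add: hermitian_vinner[OF assms] vinner_commute[of r h])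
qed

text \<open>
  A maximizer \<open>u\<close> of the quadratic form on the unit sphere of an invariant subspace \<open>W\<close> is an
  eigenvector: with \<open>c\<close> the maximum, the defect \<open>w = c u - A u\<close> again lies in \<open>W\<close>, and moving \<open>u\<close>
  slightly in the direction \<open>- w\<close> would raise the form above \<open>c |x|\<^sup>2\<close> if \<open>w\<close> were not zero.
\<close>

lemma eigenpairs_extend:
  fixes U :: "nat \<Rightarrow> nat \<Rightarrow> 'f::herm_scalar"
  assumes A: "hermitian r A" and U: "orthonormal_cols r k U" and l: "eigenpairs r k A U l" and k: "k < r"
  obtains V l' where "orthonormal_cols r (Suc k) V" "eigenpairs r (Suc k) A V l'"
proof -
  define W where "W = {x. \<forall>m<k. (\<Sum>i<r. conjugate (U i m) * x i) = 0}"
  define S where "S = {x. (\<forall>i\<ge>r. x i = 0) \<and> x \<in> W \<and> vinner r x x = 1}"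
  have W_scale: "(\<lambda>i. c *\<^sub>R x i) \<in> W" if "x \<in> W" for x c
    using that by (simp add: W_def flip: scaleR_sum_right)
  have W_add: "(\<lambda>i. x i + y i) \<in> W" if "x \<in> W" "y \<in> W" for x y
    using that by (simp add: W_def distrib_left sum.distrib)
  have W_cong: "y \<in> W" if "x \<in> W" "\<And>i. i < r \<Longrightarrow> y i = x i" for x y
    using that by (simp add: W_def)
  have normalized: "(\<lambda>i. if i < r then x i /\<^sub>R sqrt (vinner r x x) else 0) \<in> S"
    if x: "x \<in> W" "vinner r x x \<noteq> 0" for x
  proof -
    have "vinner r x x > 0"
      using x(2) by (simp add: vinner_self sum_nonneg order_less_le)
    then have "vinner r (\<lambda>i. if i < r then x i /\<^sub>R sqrt (vinner r x x) else 0)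
        (\<lambda>i. if i < r then x i /\<^sub>R sqrt (vinner r x x) else 0) = 1"
      by (simp add: vinner_def divide_simps flip: sum_divide_distrib)
    moreover have "(\<lambda>i. if i < r then x i /\<^sub>R sqrt (vinner r x x) else 0) \<in> W"
      by (rule W_cong[OF W_scale[OF x(1), of "inverse (sqrt (vinner r x x))"]]) simp
    ultimately show ?thesis
      by (simp add: S_def)
  qed
  have "S \<noteq> {}"
  proof -
    define P where "P i j = (if i = j then 1 else 0) - (\<Sum>m<k. U i m * conjugate (U j m))" for i j
    have "(\<Sum>j<r. \<Sum>i<r. (norm (P i j))\<^sup>2) \<noteq> 0"
      using projection_norm_sum(1)[OF U] k unfolding P_def by (subst sum.swap) simp
    then obtain j where j: "j < r" "(\<Sum>i<r. (norm (P i j))\<^sup>2) \<noteq> 0"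
      by (metis (no_types, lifting) lessThan_iff sum.neutral)
    have "(\<lambda>i. P i j) \<in> W"
      using projection_norm_sum(2)[OF U _ j(1)] unfolding W_def P_def by blast
    with j(2) show ?thesis
      using normalized[of "\<lambda>i. P i j"] unfolding vinner_self by blast
  qed
  moreover have "compact S"
  proof -
    have "closed (\<Inter>m<k. {x :: nat \<Rightarrow> 'f. (\<Sum>i<r. conjugate (U i m) * x i) = 0})"
      by (intro closed_INT ballI closed_Collect_eq continuous_intros continuous_on_product_coordinates)
    moreover have "closed {x :: nat \<Rightarrow> 'f. vinner r x x = 1}"
      unfolding vinner_self
      by (intro closed_Collect_eq continuous_intros continuous_on_product_coordinates)
    moreover have "S = {x. \<forall>i. x i \<in> (if i < r then cball 0 1 else {0})} \<inter>
        ((\<Inter>m<k. {x. (\<Sum>i<r. conjugate (U i m) * x i) = 0}) \<inter> {x. vinner r x x = 1})"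
    proof -
      have "norm (x i) \<le> 1" if "vinner r x x = 1" "i < r" for i and x :: "nat \<Rightarrow> 'f"
      proof -
        have "(norm (x i))\<^sup>2 \<le> (\<Sum>i<r. (norm (x i))\<^sup>2)"
          by (rule member_le_sum) (use that in auto)
        then show ?thesis
          using that(1) unfolding vinner_self by (simp add: power2_le_iff_abs_le[of 1, simplified])
      qed
      then show ?thesis
        by (auto simp: S_def W_def split: if_splits)
    qed
    ultimately show ?thesis
      by (simp only:) (intro compact_Int_closed compact_bounded_support closed_Int)
  qed
  moreover have "continuous_on S (qform r A)"
    unfolding qform_eq
    by (intro continuous_intros continuous_on_subset[OF continuous_on_product_coordinates]) auto
  ultimately obtain u where u: "u \<in> S" and max: "\<And>x. x \<in> S \<Longrightarrow> qform r A x \<le> qform r A u"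
    using continuous_attains_sup[of S "qform r A"] by blast
  define c where "c = qform r A u"
  have uW: "u \<in> W" and u1: "vinner r u u = 1"
    using u by (auto simp: S_def)
  have bound: "qform r A x \<le> c * vinner r x x" if "x \<in> W" for x
  proof (cases "vinner r x x = 0")
    case True
    then have "x i = 0" if "i < r" for i
      using that by (simp add: vinner_self sum_nonneg_eq_0_iff)
    then show ?thesis
      using True by (simp add: qform_eq)
  next
    case False
    then have pos: "vinner r x x > 0"
      by (simp add: vinner_self sum_nonneg order_less_le)
    have "qform r A (\<lambda>i. (1 / sqrt (vinner r x x)) *\<^sub>R x i) \<le> c"
      using max[OF normalized[OF that False]] unfolding c_def
      by (subst qform_cong[where y = "\<lambda>i. if i < r then x i /\<^sub>R sqrt (vinner r x x) else 0"])
         (auto simp: divide_inverse)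
    then show ?thesis
      using pos unfolding qform_scale by (simp add: power_divide divide_simps)
  qed
  define w where "w i = c *\<^sub>R u i - mat_apply r A u i" for i
  have "w \<in> W"
  proof -
    have "(\<Sum>i<r. conjugate (U i m) * mat_apply r A u i) = 0" if m: "m < k" for m
    proof -
      have "(\<Sum>i<r. conjugate (U i m) * mat_apply r A u i) = (\<Sum>j<r. (\<Sum>i<r. conjugate (U i m) * A i j) * u j)"
        unfolding sum_distrib_right by (subst sum.swap) (simp add: mat_apply_def sum_distrib_left mult.assoc)
      also have "\<dots> = (\<Sum>j<r. of_real (l m) * (conjugate (U j m) * u j))"
      proof (intro sum.cong refl)
        fix j assume "j \<in> {..<r}"
        then have j: "j < r" by simp
        have "(\<Sum>i<r. conjugate (U i m) * A i j) = conjugate (\<Sum>i<r. A j i * U i m)"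
          unfolding conjugate_sum conjugate_times
        proof (intro sum.cong refl)
          fix i assume "i \<in> {..<r}"
          then have "A i j = conjugate (A j i)"
            using A j unfolding hermitian_def by blast
          then show "conjugate (U i m) * A i j = conjugate (U i m) * conjugate (A j i)"
            by simp
        qed
        also have "(\<Sum>i<r. A j i * U i m) = of_real (l m) * U j m"
          using l m j by (simp add: eigenpairs_def)
        finally show "(\<Sum>i<r. conjugate (U i m) * A i j) * u j = of_real (l m) * (conjugate (U j m) * u j)"
          by (simp add: conjugate_times mult.assoc of_real_mult_commute)
      qed
      also have "\<dots> = of_real (l m) * (\<Sum>j<r. conjugate (U j m) * u j)"
        by (simp add: sum_distrib_left)
      also have "\<dots> = 0"
        using uW m by (simp add: W_def)
      finally show ?thesis .
    qed
    moreover have "(\<Sum>i<r. conjugate (U i m) * (c *\<^sub>R u i)) = 0" if "m < k" for m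
      using W_scale[OF uW, of c] that by (simp add: W_def)
    ultimately show ?thesis
      by (simp add: W_def w_def right_diff_distrib sum_subtractf)
  qed
  define n where "n = vinner r w w"
  define G where "G = c * n - qform r A w"
  have "G \<ge> 0"
    using bound[OF \<open>w \<in> W\<close>] by (simp add: G_def n_def)
  have "vinner r w w = vinner r (\<lambda>i. c *\<^sub>R u i) w - vinner r (mat_apply r A u) w"
    unfolding vinner_def sum_subtractf[symmetric] inner_diff_left[symmetric] by (simp add: w_def)
  then have n: "n = c * vinner r u w - vinner r (mat_apply r A u) w"
    by (simp add: n_def vinner_def sum_distrib_left)
  have "0 \<le> 2 * t * n + t\<^sup>2 * G" for t
  proof -
    have "vinner r (\<lambda>i. u i + t *\<^sub>R w i) (\<lambda>i. u i + t *\<^sub>R w i) = 1 + 2 * t * vinner r u w + t\<^sup>2 * n"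
      using u1 by (simp add: n_def vinner_def inner_add sum.distrib sum_distrib_left inner_commute
          power2_eq_square algebra_simps)
    moreover have "qform r A (\<lambda>i. u i + t *\<^sub>R w i) \<le> c * vinner r (\<lambda>i. u i + t *\<^sub>R w i) (\<lambda>i. u i + t *\<^sub>R w i)"
      by (intro bound W_add uW W_scale \<open>w \<in> W\<close>)
    ultimately have "c + 2 * t * vinner r (mat_apply r A u) w + t\<^sup>2 * qform r A w
        \<le> c * (1 + 2 * t * vinner r u w + t\<^sup>2 * n)"
      unfolding hermitian_qform_add[OF A] c_def[symmetric] by simp
    then have "0 \<le> 2 * t * (c * vinner r u w - vinner r (mat_apply r A u) w) + t\<^sup>2 * (c * n - qform r A w)"
      by (simp add: algebra_simps)
    then show ?thesis
      by (simp only: n[symmetric] G_def)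
  qed
  \<comment> \<open>This value of \<open>t\<close> is small enough that the linear term dominates the quadratic one.\<close>
  from this[of "- n / (G + 1)"] have "2 * n * n / (G + 1) \<le> (n * n) * G / (G + 1)\<^sup>2"
    by (simp add: power2_eq_square)
  then have "2 * (n * n) * (G + 1) \<le> (n * n) * G"
    using \<open>G \<ge> 0\<close> by (simp add: divide_simps power2_eq_square split: if_splits)
  then have "(n * n) * (G + 2) \<le> 0"
    by (simp add: algebra_simps)
  then have "n = 0"
    using \<open>G \<ge> 0\<close> by (metis add_nonneg_pos mult_nonneg_nonneg mult_pos_pos not_less not_real_square_gt_zero zero_less_numeral)
  then have Au: "mat_apply r A u i = c *\<^sub>R u i" if "i < r" for i
    using that by (simp add: n_def vinner_self sum_nonneg_eq_0_iff w_def)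
  have uU: "(\<Sum>i<r. conjugate (U i m) * u i) = 0" "(\<Sum>i<r. conjugate (u i) * U i m) = 0" if "m < k" for m
  proof -
    show *: "(\<Sum>i<r. conjugate (U i m) * u i) = 0"
      using uW that by (simp add: W_def)
    show "(\<Sum>i<r. conjugate (u i) * U i m) = 0"
      using arg_cong[OF *, of conjugate] by (simp add: conjugate_sum conjugate_times)
  qed
  have uu: "(\<Sum>i<r. conjugate (u i) * u i) = 1"
    using u1 unfolding conjugate_times_self vinner_self by (simp only: of_real_sum[symmetric] of_real_1)
  show thesis
  proof (rule that[of "\<lambda>i j. if j = k then u i else U i j" "l(k := c)"])
    show "orthonormal_cols r (Suc k) (\<lambda>i j. if j = k then u i else U i j)"
      using U uU uu by (auto simp: orthonormal_cols_def less_Suc_eq)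
    show "eigenpairs r (Suc k) A (\<lambda>i j. if j = k then u i else U i j) (l(k := c))"
      using l Au by (auto simp: eigenpairs_def less_Suc_eq mat_apply_def scaleR_conv_of_real)
  qed
qed

theorem spectral_theorem:
  assumes "hermitian r A"
  obtains U l where "orthonormal_cols r r U" "eigenpairs r r A U l"
proof -
  have "\<exists>U l. orthonormal_cols r k U \<and> eigenpairs r k A U l" if "k \<le> r" for k
    using that
  proof (induction k)
    case 0
    then show ?case
      by (auto simp: orthonormal_cols_def eigenpairs_def)
  next
    case (Suc k)
    then show ?case
      using eigenpairs_extend[OF assms] by (metis Suc_le_eq less_imp_le)
  qed
  then show ?thesis
    using that by blast
qed

section \<open>Lebesgue measure on tuples of scalars\<close>

abbreviation vec_lborel :: "nat \<Rightarrow> (nat \<Rightarrow> 'f::euclidean_space) measure" where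
  "vec_lborel r \<equiv> \<Pi>\<^sub>M i\<in>{..<r}. lborel"

interpretation lborel_PiM: product_sigma_finite "\<lambda>_ :: 'i. lborel :: 'f::euclidean_space measure"
  by standard

lemma sigma_finite_vec_lborel: "sigma_finite_measure (vec_lborel r :: (nat \<Rightarrow> 'f::euclidean_space) measure)"
  by (rule lborel_PiM.sigma_finite) simp

text \<open>
  A product measure is determined by its values on boxes, and there the factors \<open>k i\<close> of the
  coordinates multiply.
\<close>

lemma nn_integral_PiM_coordwise:
  fixes T :: "'i \<Rightarrow> 'f::euclidean_space \<Rightarrow> 'f" and k :: "'i \<Rightarrow> ennreal"
  assumes I: "finite I" and T [measurable]: "\<And>i. i \<in> I \<Longrightarrow> T i \<in> borel_measurable borel"
    and k: "\<And>i A. i \<in> I \<Longrightarrow> A \<in> sets borel \<Longrightarrow> k i * emeasure lborel (T i -` A) = emeasure lborel A"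
    and f [measurable]: "f \<in> borel_measurable (\<Pi>\<^sub>M i\<in>I. lborel)"
  shows "(\<Prod>i\<in>I. k i) * (\<integral>\<^sup>+x. f (\<lambda>i\<in>I. T i (x i)) \<partial>(\<Pi>\<^sub>M i\<in>I. lborel)) = (\<integral>\<^sup>+x. f x \<partial>(\<Pi>\<^sub>M i\<in>I. lborel))"
proof -
  let ?M = "\<Pi>\<^sub>M i\<in>I. (lborel :: 'f measure)"
  let ?T = "\<lambda>x. \<lambda>i\<in>I. T i (x i)"
  have [measurable]: "?T \<in> measurable ?M ?M"
    by (intro measurable_restrict) (use T in measurable)
  have "density (distr ?M ?M ?T) (\<lambda>_. \<Prod>i\<in>I. k i) = ?M"
  proof (rule lborel_PiM.PiM_eqI[OF I])
    show "sets (density (distr ?M ?M ?T) (\<lambda>_. \<Prod>i\<in>I. k i)) = sets ?M"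
      by simp
    fix A :: "'i \<Rightarrow> 'f set" assume A: "\<And>i. i \<in> I \<Longrightarrow> A i \<in> sets lborel"
    have [measurable]: "Pi\<^sub>E I A \<in> sets ?M"
      using I A by (intro sets_PiM_I_finite) auto
    have TA: "T i -` A i \<in> sets lborel" if "i \<in> I" for i
      using measurable_sets[OF T[OF that], of "A i"] A[OF that] by simp
    have "?T -` Pi\<^sub>E I A \<inter> space ?M = Pi\<^sub>E I (\<lambda>i. T i -` A i)"
      by (auto simp: space_PiM PiE_iff)
    then have "emeasure (density (distr ?M ?M ?T) (\<lambda>_. \<Prod>i\<in>I. k i)) (Pi\<^sub>E I A)
        = (\<Prod>i\<in>I. k i) * (\<Prod>i\<in>I. emeasure lborel (T i -` A i))"
      using TA by (simp add: emeasure_density nn_integral_cmult emeasure_distr lborel_PiM.emeasure_PiM I)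
    also have "\<dots> = (\<Prod>i\<in>I. emeasure lborel (A i))"
      using k A by (simp flip: prod.distrib)
    finally show "emeasure (density (distr ?M ?M ?T) (\<lambda>_. \<Prod>i\<in>I. k i)) (Pi\<^sub>E I A)
        = (\<Prod>i\<in>I. emeasure lborel (A i))" .
  qed
  then have "(\<integral>\<^sup>+x. f x \<partial>?M) = (\<integral>\<^sup>+x. f x \<partial>density (distr ?M ?M ?T) (\<lambda>_. \<Prod>i\<in>I. k i))"
    by simp
  also have "\<dots> = (\<Prod>i\<in>I. k i) * (\<integral>\<^sup>+x. f (?T x) \<partial>?M)"
    by (simp add: nn_integral_density nn_integral_distr nn_integral_cmult)
  finally show ?thesis
    by simp
qed

lemma emeasure_lborel_vimage_affine:
  fixes a :: "'f::euclidean_space"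
  assumes "c \<noteq> 0" "A \<in> sets borel"
  shows "ennreal (\<bar>c\<bar> ^ DIM('f)) * emeasure lborel ((\<lambda>x. a + c *\<^sub>R x) -` A) = emeasure lborel A"
  using assms by (subst (2) lborel_affine[OF assms(1), of a])
    (simp add: emeasure_density nn_integral_cmult emeasure_distr)

lemma nn_integral_PiM_translate:
  fixes f :: "('i \<Rightarrow> 'f::euclidean_space) \<Rightarrow> ennreal"
  assumes "finite I" and "f \<in> borel_measurable (\<Pi>\<^sub>M i\<in>I. lborel)"
  shows "(\<integral>\<^sup>+x. f (\<lambda>i\<in>I. x i + a i) \<partial>(\<Pi>\<^sub>M i\<in>I. lborel)) = (\<integral>\<^sup>+x. f x \<partial>(\<Pi>\<^sub>M i\<in>I. lborel))"
  using nn_integral_PiM_coordwise[OF assms(1) _ _ assms(2), of "\<lambda>i x. a i + x" "\<lambda>_. 1"]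
    emeasure_lborel_vimage_affine[where 'f='f, of 1] by (simp add: add.commute[of _ "a _"])

lemma nn_integral_PiM_scale:
  fixes f :: "('i \<Rightarrow> 'f::euclidean_space) \<Rightarrow> ennreal"
  assumes "finite I" and "f \<in> borel_measurable (\<Pi>\<^sub>M i\<in>I. lborel)" and c: "\<And>i. i \<in> I \<Longrightarrow> c i > 0"
  shows "ennreal ((\<Prod>i\<in>I. c i) ^ DIM('f)) * (\<integral>\<^sup>+x. f (\<lambda>i\<in>I. c i *\<^sub>R x i) \<partial>(\<Pi>\<^sub>M i\<in>I. lborel))
    = (\<integral>\<^sup>+x. f x \<partial>(\<Pi>\<^sub>M i\<in>I. lborel))"
proof -
  have "(\<Prod>i\<in>I. ennreal (c i ^ DIM('f))) = ennreal ((\<Prod>i\<in>I. c i) ^ DIM('f))"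
    using c by (subst prod_ennreal) (auto simp: prod_power_distrib less_imp_le)
  moreover have "ennreal (c i ^ DIM('f)) * emeasure lborel ((\<lambda>x. c i *\<^sub>R x) -` A) = emeasure lborel A"
    if "i \<in> I" "A \<in> sets borel" for i and A :: "'f set"
    using emeasure_lborel_vimage_affine[of "c i" A 0] c[OF that(1)] that by simp
  ultimately show ?thesis
    using nn_integral_PiM_coordwise[OF assms(1) _ _ assms(2), of "\<lambda>i x. c i *\<^sub>R x" "\<lambda>i. ennreal (c i ^ DIM('f))"]
    by simp
qed

lemma measurable_vec_component:
  assumes "f \<in> measurable N (vec_lborel r)" "i < r"
  shows "(\<lambda>x. f x i) \<in> measurable N (lborel :: 'f::euclidean_space measure)"
  by (rule measurable_compose[OF assms(1) measurable_component_singleton]) (simp add: assms(2))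

lemma measurable_mat_apply [measurable (raw)]:
  assumes "f \<in> measurable N (vec_lborel r)" 
  shows "(\<lambda>x. mat_apply r A (f x)) \<in> measurable N (vec_lborel r :: (nat \<Rightarrow> 'f::herm_scalar) measure)"
proof -
  have [measurable]: "(\<lambda>x. f x i) \<in> borel_measurable N" if "i < r" for i
    using measurable_vec_component[OF assms that] by simp
  show ?thesis
    unfolding mat_apply_def by (intro measurable_restrict) (auto intro!: borel_measurable_sum borel_measurable_times)
qed

lemma borel_measurable_vinner [measurable (raw)]:
  fixes f g :: "'a \<Rightarrow> nat \<Rightarrow> 'f::herm_scalar"
  assumes "f \<in> measurable N (vec_lborel r)" "g \<in> measurable N (vec_lborel r)"
  shows "(\<lambda>x. vinner r (f x) (g x)) \<in> borel_measurable N"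
proof -
  have [measurable]: "(\<lambda>x. f x i) \<in> borel_measurable N" "(\<lambda>x. g x i) \<in> borel_measurable N" if "i < r" for i
    using measurable_vec_component[OF assms(1) that] measurable_vec_component[OF assms(2) that] by simp_all
  show ?thesis
    unfolding vinner_def by (auto intro!: borel_measurable_sum borel_measurable_inner)
qed

lemma borel_measurable_qform [measurable (raw)]:
  assumes "f \<in> measurable N (vec_lborel r)" 
  shows "(\<lambda>x. qform r A (f x)) \<in> borel_measurable N"
  unfolding qform_def using assms by measurable

definition unit_vball :: "nat \<Rightarrow> (nat \<Rightarrow> 'f::herm_scalar) set" where
  "unit_vball r = {x \<in> space (vec_lborel r). vinner r x x \<le> 1}"

lemma sets_unit_vball [measurable]: "unit_vball r \<in> sets (vec_lborel r)"
  unfolding unit_vball_def by measurable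

lemma unit_vball_pos: "emeasure (vec_lborel r) (unit_vball r :: (nat \<Rightarrow> 'f::herm_scalar) set) > 0"
proof -
  have "(\<Pi>\<^sub>E i\<in>{..<r}. cball (0 :: 'f) (1 / (real r + 1))) \<subseteq> unit_vball r"
  proof
    fix x :: "nat \<Rightarrow> 'f" assume x: "x \<in> (\<Pi>\<^sub>E i\<in>{..<r}. cball 0 (1 / (real r + 1)))"
    have "(norm (x i))\<^sup>2 \<le> 1 / (real r + 1)" if "i < r" for i
    proof -
      have "norm (x i) \<le> 1 / (real r + 1)"
        using x that by (auto simp: PiE_iff)
      moreover from this have "norm (x i) \<le> 1"
        by (rule order_trans) simp
      ultimately have "norm (x i) * norm (x i) \<le> 1 / (real r + 1) * 1"
        by (intro mult_mono) auto
      then show ?thesis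
        by (simp add: power2_eq_square)
    qed
    then have "(\<Sum>i<r. (norm (x i))\<^sup>2) \<le> (\<Sum>i<r. 1 / (real r + 1))"
      by (intro sum_mono) auto
    also have "\<dots> \<le> 1"
      by simp
    finally show "x \<in> unit_vball r"
      using x by (auto simp: unit_vball_def vinner_self space_PiM PiE_iff)
  qed
  then have "emeasure (vec_lborel r) (\<Pi>\<^sub>E i\<in>{..<r}. cball (0 :: 'f) (1 / (real r + 1))) \<le> emeasure (vec_lborel r) (unit_vball r :: (nat \<Rightarrow> 'f) set)"
    by (rule emeasure_mono) measurable
  moreover have "emeasure (vec_lborel r) (\<Pi>\<^sub>E i\<in>{..<r}. cball (0 :: 'f) (1 / (real r + 1))) > 0"
  proof -
    define c where "c = unit_ball_vol (real DIM('f)) * (1 / (real r + 1)) ^ DIM('f)"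
    have "c > 0"
      unfolding c_def by (intro mult_pos_pos zero_less_power) simp_all
    have "emeasure (vec_lborel r) (\<Pi>\<^sub>E i\<in>{..<r}. cball (0 :: 'f) (1 / (real r + 1))) = ennreal c ^ r"
      by (subst lborel_PiM.emeasure_PiM) (simp_all add: emeasure_cball c_def)
    also have "\<dots> > 0"
      using \<open>c > 0\<close> by (simp add: ennreal_power)
    finally show ?thesis .
  qed
  ultimately show ?thesis
    by (rule less_le_trans[rotated])
qed

lemma unit_vball_finite: "emeasure (vec_lborel r) (unit_vball r :: (nat \<Rightarrow> 'f::herm_scalar) set) < \<infinity>"
proof -
  have "unit_vball r \<subseteq> (\<Pi>\<^sub>E i\<in>{..<r}. cball (0 :: 'f) 1)"
  proof
    fix x :: "nat \<Rightarrow> 'f" assume x: "x \<in> unit_vball r"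
    have "norm (x i) \<le> 1" if "i < r" for i
    proof -
      have "(norm (x i))\<^sup>2 \<le> (\<Sum>i<r. (norm (x i))\<^sup>2)"
        by (rule member_le_sum) (use that in auto)
      also have "\<dots> \<le> 1"
        using x by (simp add: unit_vball_def vinner_self)
      finally show ?thesis
        by (simp add: power2_le_iff_abs_le[of 1, simplified])
    qed
    then show "x \<in> (\<Pi>\<^sub>E i\<in>{..<r}. cball (0 :: 'f) 1)"
      using x by (auto simp: unit_vball_def space_PiM PiE_iff)
  qed
  then have "emeasure (vec_lborel r) (unit_vball r :: (nat \<Rightarrow> 'f) set) \<le> emeasure (vec_lborel r) (\<Pi>\<^sub>E i\<in>{..<r}. cball (0 :: 'f) 1)"
    by (rule emeasure_mono) (auto intro!: sets_PiM_I_finite)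
  also have "\<dots> < \<infinity>"
    by (subst lborel_PiM.emeasure_PiM) (auto simp: emeasure_cball ennreal_power)
  finally show ?thesis .
qed

lemma mat_apply_in_space [simp]: "mat_apply r A x \<in> space (vec_lborel r)"
  by (auto simp: mat_apply_def space_PiM)

text \<open>
  Unitary maps preserve Lebesgue measure, by the argument for the uniqueness of Haar measure:
  for the indicator \<open>g\<close> of the unit ball, both sides of the equation times the volume of the ball
  equal the integral of \<open>f (U x) g (y - U x)\<close> over all \<open>x\<close> and \<open>y\<close>, up to translations, because
  \<open>g \<circ> U = g\<close>.
\<close>

lemma nn_integral_unitary:
  fixes U :: "nat \<Rightarrow> nat \<Rightarrow> 'f::herm_scalar"
  assumes U: "orthonormal_cols r r U" and f [measurable]: "f \<in> borel_measurable (vec_lborel r)"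
  shows "(\<integral>\<^sup>+x. f (mat_apply r U x) \<partial>vec_lborel r) = (\<integral>\<^sup>+x. f x \<partial>vec_lborel r)"
proof -
  let ?V = "vec_lborel r :: (nat \<Rightarrow> 'f) measure"
  let ?U = "mat_apply r U"
  interpret V: sigma_finite_measure ?V
    by (rule sigma_finite_vec_lborel)
  interpret VV: pair_sigma_finite ?V ?V ..
  define g where "g x = (indicator {..1} (vinner r x x) :: ennreal)" for x :: "nat \<Rightarrow> 'f"
  have g [measurable]: "(\<lambda>x. g (h x)) \<in> borel_measurable N" if [measurable]: "h \<in> measurable N ?V" for h and N :: "'x measure"
    unfolding g_def by measurable
  have g_int: "(\<integral>\<^sup>+x. g x \<partial>?V) = emeasure ?V (unit_vball r)"
  proof -
    have "(\<integral>\<^sup>+x. g x \<partial>?V) = (\<integral>\<^sup>+x. indicator (unit_vball r) x \<partial>?V)"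
      by (intro nn_integral_cong) (auto simp: g_def unit_vball_def split: split_indicator)
    then show ?thesis
      by (simp add: sets_unit_vball)
  qed
  have g_U: "g (?U x) = g x" for x
    by (simp add: g_def vinner_unitary[OF U])
  define sub :: "(nat \<Rightarrow> 'f) \<Rightarrow> (nat \<Rightarrow> 'f) \<Rightarrow> nat \<Rightarrow> 'f" where "sub y x = (\<lambda>i\<in>{..<r}. y i - x i)" for y x
  define add :: "(nat \<Rightarrow> 'f) \<Rightarrow> (nat \<Rightarrow> 'f) \<Rightarrow> nat \<Rightarrow> 'f" where "add y x = (\<lambda>i\<in>{..<r}. y i + x i)" for y x
  have [measurable]: "(\<lambda>z. sub (h z) (k z)) \<in> measurable N ?V" "(\<lambda>z. add (h z) (k z)) \<in> measurable N ?V"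
    if h: "h \<in> measurable N ?V" and k: "k \<in> measurable N ?V" for h k and N :: "'x measure"
  proof -
    have [measurable]: "(\<lambda>z. h z i) \<in> borel_measurable N" "(\<lambda>z. k z i) \<in> borel_measurable N" if "i < r" for i
      using measurable_vec_component[OF h that] measurable_vec_component[OF k that] by simp_all
    show "(\<lambda>z. sub (h z) (k z)) \<in> measurable N ?V" "(\<lambda>z. add (h z) (k z)) \<in> measurable N ?V"
      unfolding sub_def add_def by (intro measurable_restrict; simp)+
  qed
  have f' [measurable]: "(\<lambda>x. f (h x)) \<in> borel_measurable N" if "h \<in> measurable N ?V" for h and N :: "'x measure"
    using measurable_compose[OF that f] .
  have transl: "(\<integral>\<^sup>+x. h (add x a) \<partial>?V) = (\<integral>\<^sup>+x. h x \<partial>?V)" if "h \<in> borel_measurable ?V" for h a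
    unfolding add_def by (rule nn_integral_PiM_translate[OF _ that]) simp
  have "emeasure ?V (unit_vball r) * (\<integral>\<^sup>+x. f (?U x) \<partial>?V) = (\<integral>\<^sup>+x. f (?U x) * (\<integral>\<^sup>+y. g y \<partial>?V) \<partial>?V)"
    by (simp add: g_int nn_integral_multc mult.commute)
  also have "\<dots> = (\<integral>\<^sup>+x. \<integral>\<^sup>+y. f (?U x) * g (sub y (?U x)) \<partial>?V \<partial>?V)"
  proof (rule nn_integral_cong)
    fix x assume "x \<in> space ?V"
    have "(\<integral>\<^sup>+y. g y \<partial>?V) = (\<integral>\<^sup>+y. g (add y (\<lambda>i. - ?U x i)) \<partial>?V)"
      by (rule transl[symmetric]) measurable
    also have "(\<lambda>y. add y (\<lambda>i. - ?U x i)) = (\<lambda>y. sub y (?U x))"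
      by (simp add: add_def sub_def)
    finally show "f (?U x) * (\<integral>\<^sup>+y. g y \<partial>?V) = (\<integral>\<^sup>+y. f (?U x) * g (sub y (?U x)) \<partial>?V)"
      by (subst nn_integral_cmult) (simp_all add: fun_eq_iff, measurable)
  qed
  also have "\<dots> = (\<integral>\<^sup>+y. \<integral>\<^sup>+x. f (?U x) * g (sub y (?U x)) \<partial>?V \<partial>?V)"
    by (rule VV.Fubini'[symmetric]) measurable
  also have "\<dots> = (\<integral>\<^sup>+y. \<integral>\<^sup>+x. f (add (?U x) y) * g x \<partial>?V \<partial>?V)"
  proof (rule nn_integral_cong)
    fix y assume y: "y \<in> space ?V"
    let ?a = "mat_apply r (adjoint_mat U) y"
    have "(\<integral>\<^sup>+x. f (?U x) * g (sub y (?U x)) \<partial>?V) = (\<integral>\<^sup>+x. f (?U (add x ?a)) * g (sub y (?U (add x ?a))) \<partial>?V)"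
      by (rule transl[symmetric]) (use y in measurable)
    also have "\<dots> = (\<integral>\<^sup>+x. f (add (?U x) y) * g x \<partial>?V)"
    proof (rule nn_integral_cong)
      fix x
      have "?U (add x ?a) i = ?U x i + y i" if "i < r" for i
      proof -
        have "?U (add x ?a) i = ?U x i + ?U ?a i"
          using that by (simp add: mat_apply_def add_def distrib_left sum.distrib)
        then show ?thesis
          using mat_apply_unitary(1)[OF U that] by simp
      qed
      then have *: "?U (add x ?a) = add (?U x) y"
        by (auto simp: add_def mat_apply_def fun_eq_iff)
      have "g (sub y (add (?U x) y)) = g (?U x)"
        unfolding g_def by (simp add: vinner_def sub_def add_def)
      then show "f (?U (add x ?a)) * g (sub y (?U (add x ?a))) = f (add (?U x) y) * g x"
        by (simp add: * g_U)
    qed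
    finally show "(\<integral>\<^sup>+x. f (?U x) * g (sub y (?U x)) \<partial>?V) = (\<integral>\<^sup>+x. f (add (?U x) y) * g x \<partial>?V)" .
  qed
  also have "\<dots> = (\<integral>\<^sup>+x. \<integral>\<^sup>+y. f (add (?U x) y) * g x \<partial>?V \<partial>?V)"
    by (rule VV.Fubini') measurable
  also have "\<dots> = (\<integral>\<^sup>+x. (\<integral>\<^sup>+y. f y \<partial>?V) * g x \<partial>?V)"
  proof (rule nn_integral_cong)
    fix x
    have "add (?U x) y = add y (?U x)" for y
      by (simp add: add_def add.commute)
    then show "(\<integral>\<^sup>+y. f (add (?U x) y) * g x \<partial>?V) = (\<integral>\<^sup>+y. f y \<partial>?V) * g x"
      by (simp add: nn_integral_multc transl)
  qed
  also have "\<dots> = emeasure ?V (unit_vball r) * (\<integral>\<^sup>+y. f y \<partial>?V)"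
    by (subst nn_integral_cmult) (simp_all add: g_int mult.commute)
  finally show ?thesis
    using unit_vball_pos[where 'f='f, of r] unit_vball_finite[where 'f='f, of r]
    by (auto simp: ennreal_mult_cancel_left)
qed

section \<open>Positive definite forms and their determinants\<close>

definition pos_def :: "nat \<Rightarrow> (nat \<Rightarrow> nat \<Rightarrow> 'f::herm_scalar) \<Rightarrow> bool" where
  "pos_def r A \<longleftrightarrow> hermitian r A \<and> (\<forall>x. (\<exists>i<r. x i \<noteq> 0) \<longrightarrow> qform r A x > 0)"

definition pos_semidef :: "nat \<Rightarrow> (nat \<Rightarrow> nat \<Rightarrow> 'f::herm_scalar) \<Rightarrow> bool" where
  "pos_semidef r A \<longleftrightarrow> hermitian r A \<and> (\<forall>x. qform r A x \<ge> 0)"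

definition eigenbasis :: "nat \<Rightarrow> (nat \<Rightarrow> nat \<Rightarrow> 'f::herm_scalar) \<Rightarrow> (nat \<Rightarrow> nat \<Rightarrow> 'f) \<Rightarrow> (nat \<Rightarrow> real) \<Rightarrow> bool" where
  "eigenbasis r A U l \<longleftrightarrow> orthonormal_cols r r U \<and> eigenpairs r r A U l"

lemma pos_defD: "pos_def r A \<Longrightarrow> i < r \<Longrightarrow> x i \<noteq> 0 \<Longrightarrow> qform r A x > 0"
  unfolding pos_def_def by blast

lemma qform_eq_eigenvalues:
  assumes "eigenbasis r A U l"
  shows "qform r A x = (\<Sum>i<r. l i * (norm (mat_apply r (adjoint_mat U) x i))\<^sup>2)"
proof -
  have U: "orthonormal_cols r r U" "eigenpairs r r A U l"
    using assms by (auto simp: eigenbasis_def)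
  have "qform r A x = qform r A (mat_apply r U (mat_apply r (adjoint_mat U) x))"
    by (rule qform_cong) (simp add: mat_apply_unitary(1)[OF U(1)])
  then show ?thesis
    by (simp add: qform_eigenbasis[OF U])
qed

lemma qform_eigenvector:
  assumes "eigenbasis r A U l" and "i < r"
  shows "qform r A (mat_apply r U (\<lambda>j. if j = i then 1 else 0)) = l i"
proof -
  have "(\<Sum>j<r. l j * (norm (if j = i then 1 else 0 :: 'a))\<^sup>2) = (\<Sum>j<r. if j = i then l i else 0)"
    by (intro sum.cong) auto
  then show ?thesis
    using assms unfolding eigenbasis_def by (subst qform_eigenbasis[of r U A l]) auto
qed

lemma pos_semidef_iff_eigenvalues:
  assumes "hermitian r A" "eigenbasis r A U l"
  shows "pos_semidef r A \<longleftrightarrow> (\<forall>i<r. l i \<ge> 0)"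
proof
  show "pos_semidef r A" if "\<forall>i<r. l i \<ge> 0"
    using that assms(1) unfolding pos_semidef_def qform_eq_eigenvalues[OF assms(2)]
    by (auto intro!: sum_nonneg)
  show "\<forall>i<r. l i \<ge> 0" if "pos_semidef r A"
    using that qform_eigenvector[OF assms(2)] unfolding pos_semidef_def by metis
qed

lemma pos_def_iff_eigenvalues:
  assumes A: "hermitian r A" and U: "eigenbasis r A U l"
  shows "pos_def r A \<longleftrightarrow> (\<forall>i<r. l i > 0)"
proof
  have orth: "orthonormal_cols r r U"
    using U by (simp add: eigenbasis_def)
  show "pos_def r A" if l: "\<forall>i<r. l i > 0"
    unfolding pos_def_def
  proof (intro conjI allI impI A)
    fix x :: "nat \<Rightarrow> 'a" assume "\<exists>i<r. x i \<noteq> 0"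
    then obtain i where "i < r" "x i \<noteq> 0"
      by blast
    then have "mat_apply r U (mat_apply r (adjoint_mat U) x) i \<noteq> 0"
      by (simp add: mat_apply_unitary(1)[OF orth])
    moreover have "mat_apply r U y i = 0" if "\<forall>j<r. y j = 0" for y
      using that \<open>i < r\<close> by (simp add: mat_apply_nth)
    ultimately obtain j where "j < r" "mat_apply r (adjoint_mat U) x j \<noteq> 0"
      by blast
    then have "0 < l j * (norm (mat_apply r (adjoint_mat U) x j))\<^sup>2"
      using l by simp
    also have "\<dots> \<le> (\<Sum>i<r. l i * (norm (mat_apply r (adjoint_mat U) x i))\<^sup>2)"
      by (rule member_le_sum) (use l \<open>j < r\<close> in \<open>auto simp: less_imp_le\<close>)
    finally show "qform r A x > 0"
      unfolding qform_eq_eigenvalues[OF U] .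
  qed
  show "\<forall>i<r. l i > 0" if pd: "pos_def r A"
  proof (intro allI impI)
    fix i assume i: "i < r"
    let ?e = "\<lambda>j. if j = i then 1 else (0 :: 'a)"
    have "\<exists>j<r. mat_apply r U ?e j \<noteq> 0"
    proof (rule ccontr)
      assume "\<not> ?thesis"
      moreover have "mat_apply r (adjoint_mat U) y i = 0" if "\<forall>j<r. y j = 0" for y
        using that i by (simp add: mat_apply_nth)
      ultimately have "mat_apply r (adjoint_mat U) (mat_apply r U ?e) i = 0"
        by blast
      then show False
        using mat_apply_unitary(2)[OF orth i, of ?e] by simp
    qed
    then show "l i > 0"
      using pd qform_eigenvector[OF U i] unfolding pos_def_def by metis
  qed
qed

lemma pos_def_imp_semidef: "pos_def r A \<Longrightarrow> pos_semidef r A"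
  unfolding pos_def_def pos_semidef_def
proof (safe, goal_cases)
  case (1 x)
  show ?case
  proof (cases "\<exists>i<r. x i \<noteq> 0")
    case False
    then show ?thesis by (simp add: qform_eq)
  qed (use 1 in \<open>auto simp: less_imp_le\<close>)
qed

lemma eigenbasis_exists:
  assumes "hermitian r A"
  obtains U l where "eigenbasis r A U l"
  using spectral_theorem[OF assms] unfolding eigenbasis_def by blast

lemma nn_integral_eigenbasis:
  fixes A :: "nat \<Rightarrow> nat \<Rightarrow> 'f::herm_scalar"
  assumes U: "eigenbasis r A U l" and g [measurable]: "g \<in> borel_measurable borel"
  shows "(\<integral>\<^sup>+x. g (qform r A x) \<partial>vec_lborel r) = (\<integral>\<^sup>+x. g (\<Sum>i<r. l i * (norm (x i))\<^sup>2) \<partial>(vec_lborel r :: (nat \<Rightarrow> 'f) measure))"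
proof -
  have U': "orthonormal_cols r r U" "eigenpairs r r A U l"
    using U by (auto simp: eigenbasis_def)
  have "(\<integral>\<^sup>+x. g (qform r A x) \<partial>vec_lborel r) = (\<integral>\<^sup>+x. g (qform r A (mat_apply r U x)) \<partial>vec_lborel r)"
    by (rule nn_integral_unitary[OF U'(1), symmetric]) measurable
  then show ?thesis
    by (simp add: qform_eigenbasis[OF U'])
qed

lemma powr_cancel_right:
  fixes x y s :: real
  assumes "s > 0" "x > 0" "y > 0" "x powr s = y powr s"
  shows "x = y"
  using assms powr_less_mono2[of s x y] powr_less_mono2[of s y x]
  by (cases x y rule: linorder_cases) auto

lemma prod_sqrt_power:
  assumes "finite I" "\<And>i. i \<in> I \<Longrightarrow> l i > 0"
  shows "(\<Prod>i\<in>I. sqrt (l i)) ^ n = (\<Prod>i\<in>I. l i) powr (real n / 2)"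
proof -
  have pos: "(\<Prod>i\<in>I. l i) > 0"
    using assms by (intro prod_pos) auto
  have "(\<Prod>i\<in>I. sqrt (l i)) = sqrt (\<Prod>i\<in>I. l i)"
    using assms by (induction I rule: finite_induct) (auto simp: real_sqrt_mult)
  also have "\<dots> ^ n = ((\<Prod>i\<in>I. l i) powr (1 / 2)) powr real n"
    using pos by (simp add: powr_half_sqrt powr_realpow)
  finally show ?thesis
    by (simp add: powr_powr)
qed

lemma nn_integral_scaled_norms:
  fixes g :: "real \<Rightarrow> ennreal"
  assumes l: "\<And>i. i < r \<Longrightarrow> l i > 0" and g [measurable]: "g \<in> borel_measurable borel"
  shows "ennreal ((\<Prod>i<r. l i) powr (real DIM('f) / 2)) *
      (\<integral>\<^sup>+x. g (\<Sum>i<r. l i * (norm (x i))\<^sup>2) \<partial>(vec_lborel r :: (nat \<Rightarrow> 'f::herm_scalar) measure))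
    = (\<integral>\<^sup>+x. g (vinner r x x) \<partial>(vec_lborel r :: (nat \<Rightarrow> 'f) measure))"
proof -
  have "vinner r (\<lambda>i\<in>{..<r}. sqrt (l i) *\<^sub>R x i) (\<lambda>i\<in>{..<r}. sqrt (l i) *\<^sub>R x i) = (\<Sum>i<r. l i * (norm (x i))\<^sup>2)"
    for x :: "nat \<Rightarrow> 'f"
    using l by (auto simp: vinner_self power_mult_distrib less_imp_le intro!: sum.cong)
  moreover have "(\<Prod>i<r. sqrt (l i)) ^ DIM('f) = (\<Prod>i<r. l i) powr (real DIM('f) / 2)"
    using l by (intro prod_sqrt_power) auto
  ultimately show ?thesis
    using nn_integral_PiM_scale[of "{..<r}" "\<lambda>x :: nat \<Rightarrow> 'f. g (vinner r x x)" "\<lambda>i. sqrt (l i)"] l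
    by simp
qed

definition ellipsoid_volume :: "nat \<Rightarrow> (nat \<Rightarrow> nat \<Rightarrow> 'f::herm_scalar) \<Rightarrow> ennreal" where
  "ellipsoid_volume r A = (\<integral>\<^sup>+x. indicator {..1} (qform r A x) \<partial>vec_lborel r)"

definition unit_volume :: "'f::herm_scalar itself \<Rightarrow> nat \<Rightarrow> ennreal" where
  "unit_volume _ r = emeasure (vec_lborel r) (unit_vball r :: (nat \<Rightarrow> 'f) set)"

lemma unit_volume_eq:
  "(\<integral>\<^sup>+x. indicator {..1} (vinner r x x) \<partial>(vec_lborel r :: (nat \<Rightarrow> 'f::herm_scalar) measure)) = unit_volume TYPE('f) r"
proof -
  have "(\<integral>\<^sup>+x. indicator {..1} (vinner r x x) \<partial>(vec_lborel r :: (nat \<Rightarrow> 'f) measure))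
      = (\<integral>\<^sup>+x. indicator (unit_vball r) x \<partial>(vec_lborel r :: (nat \<Rightarrow> 'f) measure))"
    by (intro nn_integral_cong) (auto simp: unit_vball_def split: split_indicator)
  then show ?thesis
    by (simp add: sets_unit_vball unit_volume_def)
qed

lemma unit_volume_bounds: "unit_volume TYPE('f::herm_scalar) r \<noteq> 0" "unit_volume TYPE('f) r \<noteq> \<infinity>"
  using unit_vball_pos[where 'f='f, of r] unit_vball_finite[where 'f='f, of r]
  by (auto simp: unit_volume_def)

lemma ellipsoid_volume_eigenvalues:
  fixes A :: "nat \<Rightarrow> nat \<Rightarrow> 'f::herm_scalar"
  assumes "eigenbasis r A U l" "\<And>i. i < r \<Longrightarrow> l i > 0"
  shows "ennreal ((\<Prod>i<r. l i) powr (real DIM('f) / 2)) * ellipsoid_volume r A = unit_volume TYPE('f) r"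
  unfolding ellipsoid_volume_def
  using nn_integral_eigenbasis[OF assms(1), of "indicator {..1}"]
    nn_integral_scaled_norms[OF assms(2), where g = "indicator {..1}" and 'f='f]
  by (simp add: unit_volume_eq)

lemma ellipsoid_volume_bounds:
  fixes A :: "nat \<Rightarrow> nat \<Rightarrow> 'f::herm_scalar"
  assumes "eigenbasis r A U l" "\<And>i. i < r \<Longrightarrow> l i > 0"
  shows "ellipsoid_volume r A \<noteq> 0" "ellipsoid_volume r A \<noteq> \<infinity>"
proof -
  define c where "c = (\<Prod>i<r. l i) powr (real DIM('f) / 2)"
  have "(\<Prod>i<r. l i) > 0"
    using assms(2) by (intro prod_pos) auto
  then have "c > 0"
    by (simp only: c_def powr_gt_zero)
  moreover have "ennreal c * ellipsoid_volume r A = unit_volume TYPE('f) r"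
    unfolding c_def by (rule ellipsoid_volume_eigenvalues[OF assms])
  ultimately show "ellipsoid_volume r A \<noteq> 0" "ellipsoid_volume r A \<noteq> \<infinity>"
    using unit_volume_bounds[where 'f='f, of r] by (auto simp: ennreal_mult_top)
qed

text \<open>
  The volume of the ellipsoid \<open>x\<^sup>* A x \<le> 1\<close> does not refer to an eigenbasis, so it shows that the
  product of the eigenvalues is well-defined.
\<close>

lemma prod_eigenvalues_unique:
  fixes A :: "nat \<Rightarrow> nat \<Rightarrow> 'f::herm_scalar"
  assumes A: "pos_semidef r A" and U: "eigenbasis r A U l" and V: "eigenbasis r A V k"
  shows "(\<Prod>i<r. l i) = (\<Prod>i<r. k i)"
proof -
  have herm: "hermitian r A"
    using A by (simp add: pos_semidef_def)
  show ?thesis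
  proof (cases "pos_def r A")
    case True
    then have l: "\<And>i. i < r \<Longrightarrow> l i > 0" and k: "\<And>i. i < r \<Longrightarrow> k i > 0"
      using pos_def_iff_eigenvalues[OF herm] U V by blast+
    let ?s = "real DIM('f) / 2"
    have "ennreal ((\<Prod>i<r. l i) powr ?s) * ellipsoid_volume r A = ennreal ((\<Prod>i<r. k i) powr ?s) * ellipsoid_volume r A"
      using ellipsoid_volume_eigenvalues[OF U l] ellipsoid_volume_eigenvalues[OF V k] by simp
    moreover have "ellipsoid_volume r A \<noteq> 0" "ellipsoid_volume r A \<noteq> \<infinity>"
      using ellipsoid_volume_bounds[OF U l] by auto
    ultimately have eq: "(\<Prod>i<r. l i) powr ?s = (\<Prod>i<r. k i) powr ?s"
      by (auto simp: ennreal_mult_cancel_left mult.commute[of _ "ellipsoid_volume r A"])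
    have pos: "(\<Prod>i<r. l i) > 0" "(\<Prod>i<r. k i) > 0"
      using l k by (auto intro!: prod_pos)
    show ?thesis
      by (rule powr_cancel_right[OF _ pos eq]) simp
  next
    case False
    then have "\<exists>i<r. l i = 0" "\<exists>i<r. k i = 0"
      using pos_def_iff_eigenvalues[OF herm U] pos_def_iff_eigenvalues[OF herm V]
        pos_semidef_iff_eigenvalues[OF herm U] pos_semidef_iff_eigenvalues[OF herm V] A
      by (metis order_less_le)+
    then show ?thesis
      by (metis finite_lessThan lessThan_iff prod_zero)
  qed
qed

text \<open>
  If an eigenvalue is not positive, then the set \<open>x\<^sup>* A x \<le> 1\<close> contains a box that is unbounded in the
  direction of its eigenvector. Hence positive definiteness is the finiteness of a volume, a form in
  which its measurability in \<open>A\<close> is a consequence of Fubini's theorem.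
\<close>

lemma pos_def_iff_ellipsoid_volume:
  fixes A :: "nat \<Rightarrow> nat \<Rightarrow> 'f::herm_scalar"
  assumes A: "hermitian r A"
  shows "pos_def r A \<longleftrightarrow> ellipsoid_volume r A < \<infinity>"
proof -
  obtain U l where U: "eigenbasis r A U l"
    using eigenbasis_exists[OF A] .
  show ?thesis
  proof (cases "pos_def r A")
    case True
    then have l: "\<And>i. i < r \<Longrightarrow> l i > 0"
      using pos_def_iff_eigenvalues[OF A U] by blast
    have "ellipsoid_volume r A \<noteq> \<infinity>"
      using ellipsoid_volume_bounds[OF U l] by auto
    with True show ?thesis
      by (simp add: less_top)
  next
    case False
    then obtain k where k: "k < r" "l k \<le> 0"
      using pos_def_iff_eigenvalues[OF A U] by (auto simp: not_less)
    \<comment> \<open>The widths make each of the \<open>r\<close> terms of the form at most \<open>1 / (r + 1)\<close>.\<close>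
    define \<epsilon> where "\<epsilon> i = 1 / ((real r + 1) * (1 + \<bar>l i\<bar>))" for i
    have \<epsilon>: "\<epsilon> i > 0" "\<epsilon> i \<le> 1" "\<bar>l i\<bar> * \<epsilon> i \<le> 1 / (real r + 1)" for i
    proof -
      have "1 * 1 \<le> (real r + 1) * (1 + \<bar>l i\<bar>)"
        by (intro mult_mono) auto
      then show \<epsilon>: "\<epsilon> i > 0" "\<epsilon> i \<le> 1"
        by (simp_all add: \<epsilon>_def)
      have "\<bar>l i\<bar> * \<epsilon> i \<le> (1 + \<bar>l i\<bar>) * \<epsilon> i"
        using \<epsilon> by (intro mult_right_mono) auto
      also have "\<dots> = 1 / (real r + 1)"
        by (simp add: \<epsilon>_def add_nonneg_eq_0_iff)
      finally show "\<bar>l i\<bar> * \<epsilon> i \<le> 1 / (real r + 1)" .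
    qed
    define B where "B i = (if i = k then UNIV else cball (0 :: 'f) (\<epsilon> i))" for i
    have box [measurable]: "Pi\<^sub>E {..<r} B \<in> sets (vec_lborel r)"
      by (intro sets_PiM_I_finite) (auto simp: B_def)
    have "(\<Prod>i<r. emeasure lborel (B i)) = emeasure lborel (B k) * (\<Prod>i\<in>{..<r} - {k}. emeasure lborel (B i))"
      using k by (subst prod.remove[of _ k]) auto
    also have "(\<Prod>i\<in>{..<r} - {k}. emeasure lborel (B i)) \<noteq> 0"
      using \<epsilon>(1) by (auto simp: B_def emeasure_cball less_imp_le ennreal_eq_0_iff not_le intro!: mult_pos_pos)
    then have "emeasure lborel (B k) * (\<Prod>i\<in>{..<r} - {k}. emeasure lborel (B i)) = \<infinity>"
      by (simp add: B_def ennreal_top_mult)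
    finally have "\<infinity> = emeasure (vec_lborel r) (Pi\<^sub>E {..<r} B)"
      by (subst lborel_PiM.emeasure_PiM) (auto simp: B_def)
    also have "\<dots> = (\<integral>\<^sup>+x. indicator (Pi\<^sub>E {..<r} B) x \<partial>vec_lborel r)"
      by simp
    also have "\<dots> \<le> (\<integral>\<^sup>+x. indicator {..1} (\<Sum>i<r. l i * (norm (x i))\<^sup>2) \<partial>(vec_lborel r :: (nat \<Rightarrow> 'f) measure))"
    proof (intro nn_integral_mono)
      fix x :: "nat \<Rightarrow> 'f"
      have "(\<Sum>i<r. l i * (norm (x i))\<^sup>2) \<le> 1" if x: "x \<in> Pi\<^sub>E {..<r} B"
      proof -
        have "l i * (norm (x i))\<^sup>2 \<le> 1 / (real r + 1)" if i: "i < r" for i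
        proof (cases "i = k")
          case True
          then have "l i * (norm (x i))\<^sup>2 \<le> 0"
            using k by (simp add: mult_nonpos_nonneg)
          also have "0 \<le> 1 / (real r + 1)"
            by simp
          finally show ?thesis .
        next
          case False
          then have n: "norm (x i) \<le> \<epsilon> i"
            using PiE_mem[OF x, of i] i False by (simp add: B_def)
          have "l i * (norm (x i))\<^sup>2 \<le> \<bar>l i\<bar> * (\<epsilon> i * 1)"
            unfolding power2_eq_square using n \<epsilon>(1,2)[of i] by (intro mult_mono) auto
          then show ?thesis
            using \<epsilon>(3)[of i] by simp
        qed
        then have "(\<Sum>i<r. l i * (norm (x i))\<^sup>2) \<le> (\<Sum>i<r. 1 / (real r + 1))"
          by (intro sum_mono) auto
        also have "\<dots> \<le> 1"
          by simp
        finally show ?thesis .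
      qed
      then show "indicator (Pi\<^sub>E {..<r} B) x \<le> (indicator {..1} (\<Sum>i<r. l i * (norm (x i))\<^sup>2) :: ennreal)"
        by (auto split: split_indicator)
    qed
    also have "\<dots> = ellipsoid_volume r A"
      unfolding ellipsoid_volume_def by (rule nn_integral_eigenbasis[OF U, symmetric]) measurable
    finally show ?thesis
      using False by (simp add: top_unique)
  qed
qed

section \<open>The determinant of a Hermitian matrix\<close>

abbreviation entries :: "'a mat \<Rightarrow> nat \<Rightarrow> nat \<Rightarrow> 'a" where
  "entries M \<equiv> \<lambda>i j. M $$ (i, j)"

definition complement_mat :: "(nat \<Rightarrow> nat \<Rightarrow> 'f::herm_scalar) \<Rightarrow> nat \<Rightarrow> nat \<Rightarrow> 'f" where
  "complement_mat A i j = (if i = j then 1 else 0) - A i j"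

lemma herm_mats_iff: "M \<in> herm_mats r \<longleftrightarrow> M \<in> carrier_mat r r \<and> hermitian r (entries M)"
proof (cases "M \<in> carrier_mat r r")
  case True
  then have "conj_transpose M = M \<longleftrightarrow> (\<forall>i<r. \<forall>j<r. conjugate (M $$ (j, i)) = M $$ (i, j))"
    by (auto simp: conj_transpose_def mat_eq_iff)
  also have "\<dots> \<longleftrightarrow> hermitian r (entries M)"
    unfolding hermitian_def by metis
  finally show ?thesis
    using True by (simp add: herm_mats_def)
qed (simp add: herm_mats_def)

text \<open>
  Conjugation transposes the double sum, so that its value is self-conjugate and hence real.
\<close>

lemma hermitian_scalar_prod:
  assumes A: "hermitian r A"
  shows "(\<Sum>i<r. conjugate (x i) * (\<Sum>j<r. A i j * x j)) = of_real (qform r A x)"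
proof -
  let ?s = "\<Sum>i<r. conjugate (x i) * (\<Sum>j<r. A i j * x j)"
  have "conjugate ?s = (\<Sum>i<r. \<Sum>j<r. conjugate (x j) * conjugate (A i j) * x i)"
    by (simp add: conjugate_sum conjugate_times sum_distrib_right)
  also have "\<dots> = (\<Sum>j<r. \<Sum>i<r. conjugate (x j) * conjugate (A i j) * x i)"
    by (rule sum.swap)
  also have "\<dots> = (\<Sum>j<r. \<Sum>i<r. conjugate (x j) * A j i * x i)"
  proof (intro sum.cong refl)
    fix i j assume "j \<in> {..<r}" "i \<in> {..<r}"
    then have "A j i = conjugate (A i j)"
      using A unfolding hermitian_def by blast
    then show "conjugate (x j) * conjugate (A i j) * x i = conjugate (x j) * A j i * x i"
      by simp
  qed
  also have "\<dots> = ?s"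
    by (simp add: sum_distrib_left mult.assoc)
  finally have "?s = of_real (inner ?s 1)"
    by (rule conjugate_eq_self_real)
  also have "inner ?s 1 = qform r A x"
  proof -
    have "inner (conjugate y * z) 1 = inner y z" for y z :: 'a
      by (simp add: inner_mult_left_adjoint inner_commute[of z])
    then show ?thesis
      by (simp add: inner_sum_left qform_def vinner_def mat_apply_def)
  qed
  finally show ?thesis .
qed

lemma psd_mats_iff: "M \<in> psd_mats r \<longleftrightarrow> M \<in> carrier_mat r r \<and> pos_semidef r (entries M)"
proof (cases "M \<in> herm_mats r")
  case True
  then have M: "M \<in> carrier_mat r r" "hermitian r (entries M)"
    by (auto simp: herm_mats_iff)
  have sp: "scalar_prod (conjugate v) (M *\<^sub>v v) = of_real (qform r (entries M) (vec_index v))"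
    if "v \<in> carrier_vec r" for v
    using that M by (simp add: scalar_prod_def lessThan_atLeast0[symmetric] flip: hermitian_scalar_prod)
  have "M \<in> psd_mats r \<longleftrightarrow> (\<forall>v\<in>carrier_vec r. qform r (entries M) (vec_index v) \<ge> 0)"
    using True sp by (auto simp: psd_mats_def)
  also have "\<dots> \<longleftrightarrow> (\<forall>x. qform r (entries M) x \<ge> 0)"
  proof (intro iffI allI)
    fix x assume "\<forall>v\<in>carrier_vec r. qform r (entries M) (vec_index v) \<ge> 0"
    then have "qform r (entries M) (vec_index (vec r x)) \<ge> 0"
      by simp
    also have "qform r (entries M) (vec_index (vec r x)) = qform r (entries M) x"
      by (rule qform_cong) simp
    finally show "qform r (entries M) x \<ge> 0" .
  qed simp
  finally show ?thesis
    using M by (simp add: pos_semidef_def)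
qed (auto simp: psd_mats_def herm_mats_iff pos_semidef_def)

lemma complement_entries:
  assumes "M \<in> carrier_mat r r"
  shows "1\<^sub>m r - M \<in> carrier_mat r r"
    and "i < r \<Longrightarrow> j < r \<Longrightarrow> entries (1\<^sub>m r - M) i j = complement_mat (entries M) i j"
  using assms by (auto simp: complement_mat_def)

lemma hermitian_cong: "(\<And>i j. i < r \<Longrightarrow> j < r \<Longrightarrow> A i j = B i j) \<Longrightarrow> hermitian r A \<longleftrightarrow> hermitian r B"
  by (simp add: hermitian_def)

lemma pos_def_cong:
  assumes "\<And>i j. i < r \<Longrightarrow> j < r \<Longrightarrow> A i j = B i j"
  shows "pos_def r A \<longleftrightarrow> pos_def r B" "pos_semidef r A \<longleftrightarrow> pos_semidef r B"
    "eigenbasis r A U l \<longleftrightarrow> eigenbasis r B U l"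
  using hermitian_cong[OF assms] qform_cong_mat[OF assms] assms
  by (simp_all add: pos_def_def pos_semidef_def eigenbasis_def eigenpairs_def)

lemma pos_def_complement_entries:
  assumes M: "M \<in> carrier_mat r r"
  shows "pos_def r (entries (1\<^sub>m r - M)) \<longleftrightarrow> pos_def r (complement_mat (entries M))"
    "pos_semidef r (entries (1\<^sub>m r - M)) \<longleftrightarrow> pos_semidef r (complement_mat (entries M))"
    "eigenbasis r (entries (1\<^sub>m r - M)) U l \<longleftrightarrow> eigenbasis r (complement_mat (entries M)) U l"
  using pos_def_cong[of r "entries (1\<^sub>m r - M)" "complement_mat (entries M)"] complement_entries(2)[OF M]
  by blast+

lemma psd_interval_iff:
  "M \<in> psd_interval r \<longleftrightarrow>
     M \<in> carrier_mat r r \<and> pos_semidef r (entries M) \<and> pos_semidef r (complement_mat (entries M))"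
  by (auto simp: psd_interval_def herm_le_def psd_mats_iff pos_def_complement_entries)

lemma eigenvalue_list_iff:
  assumes M: "M \<in> carrier_mat r r"
  shows "eigenvalue_list M l \<longleftrightarrow> (\<exists>U. eigenbasis r (entries M) U l)"
proof -
  have *: "conj_transpose U * U = 1\<^sub>m r \<and> (\<forall>i<r. M *\<^sub>v col U i = of_real (l i) \<cdot>\<^sub>v col U i)
      \<longleftrightarrow> eigenbasis r (entries M) (entries U) l" if U: "U \<in> carrier_mat r r" for U
  proof -
    have "conj_transpose U * U = 1\<^sub>m r \<longleftrightarrow> orthonormal_cols r r (entries U)"
      using U by (auto simp: mat_eq_iff conj_transpose_def scalar_prod_def orthonormal_cols_def lessThan_atLeast0)
    moreover have "(\<forall>i<r. M *\<^sub>v col U i = of_real (l i) \<cdot>\<^sub>v col U i) \<longleftrightarrow> eigenpairs r r (entries M) (entries U) l"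
      using U M by (auto simp: vec_eq_iff scalar_prod_def eigenpairs_def lessThan_atLeast0)
    ultimately show ?thesis
      by (simp add: eigenbasis_def)
  qed
  have "eigenvalue_list M l \<longleftrightarrow> (\<exists>U\<in>carrier_mat r r. eigenbasis r (entries M) (entries U) l)"
    unfolding eigenvalue_list_def using M * by auto
  also have "\<dots> \<longleftrightarrow> (\<exists>U. eigenbasis r (entries M) U l)"
  proof
    assume "\<exists>U. eigenbasis r (entries M) U l"
    then obtain U where "eigenbasis r (entries M) U l"
      by blast
    then have "eigenbasis r (entries M) (entries (mat r r (\<lambda>(i, j). U i j))) l"
      by (simp add: eigenbasis_def orthonormal_cols_def eigenpairs_def)
    moreover have "mat r r (\<lambda>(i, j). U i j) \<in> carrier_mat r r"
      by simp
    ultimately show "\<exists>U\<in>carrier_mat r r. eigenbasis r (entries M) (entries U) l"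
      by blast
  qed blast
  finally show ?thesis .
qed

lemma herm_det_eq:
  assumes M: "M \<in> carrier_mat r r" "pos_semidef r (entries M)" and U: "eigenbasis r (entries M) U l"
  shows "herm_det M = (\<Prod>i<r. l i)"
  unfolding herm_det_def
proof (rule the_equality)
  show "\<exists>l'. eigenvalue_list M l' \<and> (\<Prod>i<r. l i) = (\<Prod>i<dim_row M. l' i)"
    using M U eigenvalue_list_iff[OF M(1)] by auto
  show "c = (\<Prod>i<r. l i)" if "\<exists>l'. eigenvalue_list M l' \<and> c = (\<Prod>i<dim_row M. l' i)" for c
    using that M prod_eigenvalues_unique[OF M(2) U] eigenvalue_list_iff[OF M(1)] by auto
qed

lemma pos_def_eigenbasis:
  assumes "pos_def r A"
  obtains U l where "eigenbasis r A U l" "\<And>i. i < r \<Longrightarrow> l i > 0"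
proof -
  have herm: "hermitian r A"
    using assms by (simp add: pos_def_def)
  obtain U l where U: "eigenbasis r A U l"
    using eigenbasis_exists[OF herm] .
  with assms that show ?thesis
    using pos_def_iff_eigenvalues[OF herm U] by blast
qed

lemma herm_det_pos:
  assumes M: "M \<in> carrier_mat r r" "pos_def r (entries M)"
  shows "herm_det M > 0"
proof -
  obtain U l where U: "eigenbasis r (entries M) U l" and "\<And>i. i < r \<Longrightarrow> l i > 0"
    using pos_def_eigenbasis[OF M(2)] by blast
  then show ?thesis
    using herm_det_eq[OF M(1) pos_def_imp_semidef[OF M(2)] U] by (auto intro!: prod_pos)
qed

lemma herm_det_singular:
  assumes M: "M \<in> carrier_mat r r" "pos_semidef r (entries M)" "\<not> pos_def r (entries M)"
  shows "herm_det M = 0"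
proof -
  have herm: "hermitian r (entries M)"
    using M by (simp add: pos_semidef_def)
  obtain U l where U: "eigenbasis r (entries M) U l"
    using eigenbasis_exists[OF herm] .
  have "\<exists>i<r. l i = 0"
    using pos_semidef_iff_eigenvalues[OF herm U] pos_def_iff_eigenvalues[OF herm U] M
    by (metis order_less_le)
  then show ?thesis
    using herm_det_eq[OF M(1,2) U] by auto
qed

text \<open>
  A unitary substitution diagonalizes the form, and scaling the coordinates by the square roots of the
  eigenvalues turns it into \<open>|x|\<^sup>2\<close>.
\<close>

lemma nn_integral_qform:
  fixes M :: "'f::herm_scalar mat"
  assumes M: "M \<in> carrier_mat r r" "pos_def r (entries M)" and g [measurable]: "g \<in> borel_measurable borel"
  shows "ennreal (herm_det M powr (real DIM('f) / 2)) * (\<integral>\<^sup>+x. g (qform r (entries M) x) \<partial>vec_lborel r)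
    = (\<integral>\<^sup>+x. g (vinner r x x) \<partial>(vec_lborel r :: (nat \<Rightarrow> 'f) measure))"
proof -
  obtain U l where U: "eigenbasis r (entries M) U l" and l: "\<And>i. i < r \<Longrightarrow> l i > 0"
    using pos_def_eigenbasis[OF M(2)] by blast
  show ?thesis
    using nn_integral_scaled_norms[OF l g, where 'f='f] 
    by (simp add: nn_integral_eigenbasis[OF U g] herm_det_eq[OF M(1) pos_def_imp_semidef[OF M(2)] U])
qed

lemma eigenbasis_complement:
  assumes "eigenbasis r A U l"
  shows "eigenbasis r (complement_mat A) U (\<lambda>i. 1 - l i)"
proof -
  have "(\<Sum>j<r. complement_mat A m j * U j i) = U m i - (\<Sum>j<r. A m j * U j i)" if "m < r" for m i
    using that by (simp add: complement_mat_def left_diff_distrib sum_subtractf if_distrib[where f="\<lambda>x. x * _"] cong: if_cong)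
  then show ?thesis
    using assms by (simp add: eigenbasis_def eigenpairs_def left_diff_distrib)
qed

lemma hermitian_complement: "hermitian r A \<Longrightarrow> hermitian r (complement_mat A)"
  unfolding hermitian_def
proof (intro allI impI)
  fix i j assume "\<forall>i<r. \<forall>j<r. A j i = conjugate (A i j)" "i < r" "j < r"
  then have *: "A j i = conjugate (A i j)"
    by blast
  show "complement_mat A j i = conjugate (complement_mat A i j)"
    unfolding complement_mat_def conjugate_diff * by simp
qed

lemma hermitian_add_scalar:
  assumes "hermitian r A"
  shows "hermitian r (\<lambda>i j. A i j + (if i = j then of_real c else 0))"
  unfolding hermitian_def
proof (intro allI impI)
  fix i j assume "i < r" "j < r"
  then have *: "A j i = conjugate (A i j)"
    using assms unfolding hermitian_def by blast
  show "A j i + (if j = i then of_real c else 0) = conjugate (A i j + (if i = j then of_real c else 0))"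
    unfolding conjugate_plus * by simp
qed

definition pd_interval :: "nat \<Rightarrow> 'f::herm_scalar mat set" where
  "pd_interval r = {M \<in> carrier_mat r r. pos_def r (entries M) \<and> pos_def r (complement_mat (entries M))}"

definition pd_weight :: "nat \<Rightarrow> real \<Rightarrow> real \<Rightarrow> 'f::herm_scalar mat \<Rightarrow> real" where
  "pd_weight r a b M =
     (if M \<in> pd_interval r then herm_det M powr a * herm_det (1\<^sub>m r - M) powr b else 0)"

text \<open>
  A singular positive semidefinite matrix has determinant 0, and \<open>0 powr a = 0\<close>. Hence the density
  vanishes on the boundary of the interval and may be restricted to its interior.
\<close>

lemma beta_weight_eq_pd_weight:
  fixes M :: "'f::herm_scalar mat"
  shows "indicator (psd_interval r) M * beta_weight r \<mu> \<nu> M =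
    pd_weight r (\<mu> - herm_dim TYPE('f) r / real r) (\<nu> - herm_dim TYPE('f) r / real r) M"
proof (cases "M \<in> psd_interval r")
  case True
  then have M: "M \<in> carrier_mat r r" "pos_semidef r (entries M)" "pos_semidef r (complement_mat (entries M))"
    by (auto simp: psd_interval_iff)
  show ?thesis
  proof (cases "M \<in> pd_interval r")
    case False
    then consider "\<not> pos_def r (entries M)" | "\<not> pos_def r (complement_mat (entries M))"
      using M by (auto simp: pd_interval_def)
    then have "herm_det M = 0 \<or> herm_det (1\<^sub>m r - M) = 0"
      using herm_det_singular[OF M(1,2)] herm_det_singular[OF complement_entries(1)[OF M(1)]] M(3)
        pos_def_complement_entries[OF M(1)] by metis
    then show ?thesis
      using False by (auto simp: pd_weight_def beta_weight_def)
  qed (use True in \<open>simp add: pd_weight_def beta_weight_def\<close>)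
next
  case False
  then have "M \<notin> pd_interval r"
    by (auto simp: psd_interval_iff pd_interval_def pos_def_imp_semidef)
  then show ?thesis
    using False by (simp add: pd_weight_def)
qed

section \<open>Measurability in the coordinates\<close>

text \<open>
  Solving \<open>ellipsoid_volume_eigenvalues\<close> for the product of the eigenvalues gives an expression that
  depends measurably on the entries.
\<close>

definition volume_det :: "nat \<Rightarrow> (nat \<Rightarrow> nat \<Rightarrow> 'f::herm_scalar) \<Rightarrow> real" where
  "volume_det r A = enn2real (unit_volume TYPE('f) r / ellipsoid_volume r A) powr (2 / real DIM('f))"

lemma herm_det_eq_volume_det:
  fixes M :: "'f::herm_scalar mat"
  assumes M: "M \<in> carrier_mat r r" "pos_def r (entries M)"
  shows "herm_det M = volume_det r (entries M)"
proof -
  define v where "v = ellipsoid_volume r (entries M)"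
  define c where "c = herm_det M powr (real DIM('f) / 2)"
  obtain U l where U: "eigenbasis r (entries M) U l" and l: "\<And>i. i < r \<Longrightarrow> l i > 0"
    using pos_def_eigenbasis[OF M(2)] by blast
  note v = ellipsoid_volume_bounds[OF U l, folded v_def]
  have "ennreal c * v = unit_volume TYPE('f) r"
    using nn_integral_qform[OF M, of "indicator {..1}"]
    by (simp add: c_def v_def ellipsoid_volume_def unit_volume_eq)
  then have "unit_volume TYPE('f) r / v = ennreal c"
    using v by (metis ennreal_mult_divide_eq infinity_ennreal_def)
  then show ?thesis
    using herm_det_pos[OF M] by (simp add: volume_det_def v_def[symmetric] c_def powr_powr)
qed

lemma borel_measurable_ellipsoid_volume:
  fixes A :: "'a \<Rightarrow> nat \<Rightarrow> nat \<Rightarrow> 'f::herm_scalar"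
  assumes A: "\<And>i j. i < r \<Longrightarrow> j < r \<Longrightarrow> (\<lambda>c. A c i j) \<in> borel_measurable N"
  shows "(\<lambda>c. ellipsoid_volume r (A c)) \<in> borel_measurable N"
proof -
  interpret V: sigma_finite_measure "vec_lborel r :: (nat \<Rightarrow> 'f) measure"
    by (rule sigma_finite_vec_lborel)
  have [measurable]: "(\<lambda>p. snd p i) \<in> borel_measurable (N \<Otimes>\<^sub>M (vec_lborel r :: (nat \<Rightarrow> 'f) measure))" if "i < r" for i
    using measurable_vec_component[OF measurable_snd that] by simp
  have [measurable]: "(\<lambda>p. A (fst p) i j) \<in> borel_measurable (N \<Otimes>\<^sub>M (vec_lborel r :: (nat \<Rightarrow> 'f) measure))"
    if "i < r" "j < r" for i j
    using measurable_compose[OF measurable_fst A[OF that]] .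
  have "(\<lambda>p. qform r (A (fst p)) (snd p)) \<in> borel_measurable (N \<Otimes>\<^sub>M (vec_lborel r :: (nat \<Rightarrow> 'f) measure))"
    unfolding qform_eq by (auto intro!: borel_measurable_sum borel_measurable_inner borel_measurable_times)
  then have "(\<lambda>(c, x). indicator {..1} (qform r (A c) x) :: ennreal) \<in> borel_measurable (N \<Otimes>\<^sub>M (vec_lborel r :: (nat \<Rightarrow> 'f) measure))"
    unfolding case_prod_beta by measurable
  then show ?thesis
    unfolding ellipsoid_volume_def by (rule V.borel_measurable_nn_integral)
qed

lemma measurable_pos_def:
  fixes A :: "'a \<Rightarrow> nat \<Rightarrow> nat \<Rightarrow> 'f::herm_scalar"
  assumes A: "\<And>i j. i < r \<Longrightarrow> j < r \<Longrightarrow> (\<lambda>c. A c i j) \<in> borel_measurable N"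
    and herm: "\<And>c. c \<in> space N \<Longrightarrow> hermitian r (A c)"
  shows "Measurable.pred N (\<lambda>c. pos_def r (A c))"
proof -
  have [measurable]: "(\<lambda>c. ellipsoid_volume r (A c)) \<in> borel_measurable N"
    by (rule borel_measurable_ellipsoid_volume[OF A])
  have "Measurable.pred N (\<lambda>c. ellipsoid_volume r (A c) < \<infinity>)"
    by measurable
  then show ?thesis
    by (rule measurable_cong[THEN iffD1, rotated]) (simp add: herm pos_def_iff_ellipsoid_volume)
qed

text \<open>This reduces the measurability of semidefiniteness to that of definiteness.\<close>

lemma pos_semidef_iff_pos_def:
  assumes herm: "hermitian r A"
  shows "pos_semidef r A \<longleftrightarrow> (\<forall>n. pos_def r (\<lambda>i j. A i j + (if i = j then of_real (1 / real (Suc n)) else 0)))"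
proof -
  define B where "B n i j = A i j + (if i = j then of_real (1 / real (Suc n)) else 0)" for n i j
  have B_herm: "hermitian r (B n)" for n
    unfolding B_def[abs_def] by (rule hermitian_add_scalar[OF herm])
  have B_form: "qform r (B n) x = qform r A x + 1 / real (Suc n) * vinner r x x" for n x
  proof -
    have "qform r (B n) x = qform r A x + (\<Sum>i<r. \<Sum>j<r. if i = j then 1 / real (Suc n) * inner (x i) (x j) else 0)"
      unfolding qform_eq B_def sum.distrib[symmetric]
      by (intro sum.cong refl) (auto simp: distrib_right inner_add_right simp del: of_real_divide)
    also have "(\<Sum>i<r. \<Sum>j<r. if i = j then 1 / real (Suc n) * inner (x i) (x j) else 0) = 1 / real (Suc n) * vinner r x x"
      by (simp add: vinner_def sum_distrib_left)
    finally show ?thesis .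
  qed
  have pos: "vinner r x x > 0" if "\<exists>i<r. x i \<noteq> 0" for x :: "nat \<Rightarrow> 'a"
    using that by (auto simp: vinner_self intro!: sum_pos2)
  have "(\<forall>n. pos_def r (B n)) \<longleftrightarrow> pos_semidef r A"
  proof
    assume psd: "pos_semidef r A"
    have "qform r (B n) x > 0" if "\<exists>i<r. x i \<noteq> 0" for n x
      unfolding B_form using pos[OF that] psd by (intro add_nonneg_pos mult_pos_pos) (auto simp: pos_semidef_def)
    then show "\<forall>n. pos_def r (B n)"
      using B_herm by (simp add: pos_def_def)
  next
    assume pd: "\<forall>n. pos_def r (B n)"
    have "qform r A x \<ge> 0" for x
    proof (rule LIMSEQ_le_const)
      show "(\<lambda>n. qform r A x + 1 / real (Suc n) * vinner r x x) \<longlonglongrightarrow> qform r A x"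
        using tendsto_add[OF tendsto_const tendsto_mult_left_zero[OF LIMSEQ_Suc[OF lim_1_over_n]]] by simp
      have "0 \<le> qform r (B n) x" for n
        using pd pos_def_imp_semidef by (auto simp: pos_semidef_def)
      then show "\<exists>N. \<forall>n\<ge>N. 0 \<le> qform r A x + 1 / real (Suc n) * vinner r x x"
        by (simp add: B_form)
    qed
    then show "pos_semidef r A"
      using herm by (simp add: pos_semidef_def)
  qed
  then show ?thesis
    by (simp only: B_def[abs_def])
qed

lemma measurable_pos_semidef:
  fixes A :: "'a \<Rightarrow> nat \<Rightarrow> nat \<Rightarrow> 'f::herm_scalar"
  assumes A: "\<And>i j. i < r \<Longrightarrow> j < r \<Longrightarrow> (\<lambda>c. A c i j) \<in> borel_measurable N"
    and herm: "\<And>c. c \<in> space N \<Longrightarrow> hermitian r (A c)"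
  shows "Measurable.pred N (\<lambda>c. pos_semidef r (A c))"
proof -
  have [measurable]: "Measurable.pred N (\<lambda>c. pos_def r (\<lambda>i j. A c i j + (if i = j then of_real (1 / real (Suc n)) else 0)))" for n
  proof (rule measurable_pos_def)
    show "(\<lambda>c. A c i j + (if i = j then of_real (1 / real (Suc n)) else 0)) \<in> borel_measurable N" if "i < r" "j < r" for i j
      using A[OF that] by measurable
    show "hermitian r (\<lambda>i j. A c i j + (if i = j then of_real (1 / real (Suc n)) else 0))" if "c \<in> space N" for c
      by (rule hermitian_add_scalar[OF herm[OF that]])
  qed
  have "Measurable.pred N (\<lambda>c. \<forall>n. pos_def r (\<lambda>i j. A c i j + (if i = j then of_real (1 / real (Suc n)) else 0)))"
    by measurable
  then show ?thesis
    by (rule measurable_cong[THEN iffD1, rotated]) (simp only: herm pos_semidef_iff_pos_def[symmetric])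
qed

abbreviation upper_index :: "nat \<Rightarrow> (nat \<times> nat) set" where
  "upper_index r \<equiv> {(i, j). i < j \<and> j < r}"

abbreviation coord_lborel :: "nat \<Rightarrow> ((nat \<Rightarrow> real) \<times> (nat \<times> nat \<Rightarrow> 'f::euclidean_space)) measure" where
  "coord_lborel r \<equiv> (\<Pi>\<^sub>M i\<in>{..<r}. lborel) \<Otimes>\<^sub>M (\<Pi>\<^sub>M ij\<in>upper_index r. lborel)"

lemma finite_upper_index [simp]: "finite (upper_index r)"
  by (rule finite_subset[of _ "{..<r} \<times> {..<r}"]) auto

lemma herm_of_coords_carrier [simp]: "herm_of_coords r c \<in> carrier_mat r r"
  by (simp add: herm_of_coords_def case_prod_beta)

lemma herm_of_coords_nth:
  "i < r \<Longrightarrow> j < r \<Longrightarrow> herm_of_coords r (a, z) $$ (i, j) =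
    (if i = j then of_real (a i) else if i < j then z (i, j) else conjugate (z (j, i)))"
  by (simp add: herm_of_coords_def)

lemma hermitian_herm_of_coords: "hermitian r (entries (herm_of_coords r c))"
  by (cases c) (auto simp: hermitian_def herm_of_coords_nth)

lemma inj_on_herm_of_coords:
  "inj_on (herm_of_coords r :: _ \<Rightarrow> 'f::herm_scalar mat) (space (coord_lborel r))"
proof (rule inj_onI, safe)
  fix a a' :: "nat \<Rightarrow> real" and z z' :: "nat \<times> nat \<Rightarrow> 'f"
  assume sp: "(a, z) \<in> space (coord_lborel r)" "(a', z') \<in> space (coord_lborel r)"
    and eq: "herm_of_coords r (a, z) = herm_of_coords r (a', z')"
  have entry: "herm_of_coords r (a, z) $$ (i, j) = herm_of_coords r (a', z') $$ (i, j)" for i j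
    by (simp add: eq)
  show "a = a'"
  proof (rule PiE_ext)
    show "a \<in> (\<Pi>\<^sub>E i\<in>{..<r}. UNIV)" "a' \<in> (\<Pi>\<^sub>E i\<in>{..<r}. UNIV)"
      using sp by (auto simp: space_pair_measure space_PiM)
    show "a i = a' i" if "i \<in> {..<r}" for i
      using entry[of i i] that by (simp add: herm_of_coords_nth)
  qed
  show "z = z'"
  proof (rule PiE_ext)
    show "z \<in> (\<Pi>\<^sub>E i\<in>upper_index r. UNIV)" "z' \<in> (\<Pi>\<^sub>E i\<in>upper_index r. UNIV)"
      using sp by (auto simp: space_pair_measure space_PiM)
    show "z ij = z' ij" if "ij \<in> upper_index r" for ij
      using entry[of "fst ij" "snd ij"] that by (auto simp: herm_of_coords_nth)
  qed
qed

text \<open>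
  The diagonal entries of a Hermitian matrix are self-conjugate and therefore real.
\<close>

lemma herm_of_coords_image:
  "herm_of_coords r ` space (coord_lborel r) = (herm_mats r :: 'f::herm_scalar mat set)"
proof safe
  show "herm_of_coords r c \<in> herm_mats r" for c :: "(nat \<Rightarrow> real) \<times> (nat \<times> nat \<Rightarrow> 'f)"
    by (simp add: herm_mats_iff hermitian_herm_of_coords)
  fix M :: "'f mat" assume "M \<in> herm_mats r"
  then have M: "M \<in> carrier_mat r r" "hermitian r (entries M)"
    by (auto simp: herm_mats_iff)
  define a where "a = (\<lambda>i\<in>{..<r}. inner (M $$ (i, i)) 1)"
  define z where "z = (\<lambda>ij\<in>upper_index r. M $$ ij)"
  have lower: "conjugate (M $$ (j, i)) = M $$ (i, j)" if "i < r" "j < r" for i j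
    using M(2) that unfolding hermitian_def by metis
  have diag: "of_real (a i) = M $$ (i, i)" if "i < r" for i
    using conjugate_eq_self_real[OF lower[OF that that]] that by (simp add: a_def)
  have "herm_of_coords r (a, z) = M"
  proof (rule eq_matI)
    show "herm_of_coords r (a, z) $$ (i, j) = M $$ (i, j)" if "i < dim_row M" "j < dim_col M" for i j
      using that M(1) by (auto simp: herm_of_coords_nth diag lower z_def)
  qed (use M(1) in \<open>simp_all add: herm_of_coords_def\<close>)
  moreover have "(a, z) \<in> space (coord_lborel r)"
    by (simp add: space_pair_measure space_PiM a_def z_def)
  ultimately show "M \<in> herm_of_coords r ` space (coord_lborel r)"
    by blast
qed

lemma space_herm_lborel: "space (herm_lborel r :: 'f::herm_scalar mat measure) = herm_mats r"
  by (simp add: herm_lborel_def space_embed_measure herm_of_coords_image)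

lemma measurable_herm_of_coords:
  "herm_of_coords r \<in> measurable (coord_lborel r) (herm_lborel r :: 'f::herm_scalar mat measure)"
  unfolding herm_lborel_def by (rule measurable_embed_measure2'[OF inj_on_herm_of_coords])

lemma nn_integral_herm_lborel:
  fixes f :: "'f::herm_scalar mat \<Rightarrow> ennreal"
  assumes "f \<in> borel_measurable (herm_lborel r)"
  shows "(\<integral>\<^sup>+M. f M \<partial>herm_lborel r) = (\<integral>\<^sup>+c. f (herm_of_coords r c) \<partial>coord_lborel r)"
  using assms unfolding herm_lborel_def by (intro nn_integral_embed_measure' inj_on_herm_of_coords)

lemma measurable_coord_diag:
  "i < r \<Longrightarrow> (\<lambda>c. fst c i) \<in> borel_measurable (coord_lborel r :: ((nat \<Rightarrow> real) \<times> (nat \<times> nat \<Rightarrow> 'f::euclidean_space)) measure)"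
  using measurable_compose[OF measurable_fst measurable_component_singleton[of i "{..<r}" "\<lambda>_. lborel"]] by simp

lemma measurable_coord_upper:
  "ij \<in> upper_index r \<Longrightarrow> (\<lambda>c. snd c ij) \<in> borel_measurable (coord_lborel r :: ((nat \<Rightarrow> real) \<times> (nat \<times> nat \<Rightarrow> 'f::euclidean_space)) measure)"
  using measurable_compose[OF measurable_snd measurable_component_singleton[of ij "upper_index r" "\<lambda>_. lborel"]] by simp

lemma borel_measurable_entries:
  assumes "i < r" "j < r"
  shows "(\<lambda>c. entries (herm_of_coords r c) i j) \<in> borel_measurable (coord_lborel r :: ((nat \<Rightarrow> real) \<times> (nat \<times> nat \<Rightarrow> 'f::herm_scalar)) measure)"
proof -
  have eq: "entries (herm_of_coords r c) i j =
      (if i = j then of_real (fst c i) else if i < j then snd c (i, j) else conjugate (snd c (j, i)))"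
    for c :: "(nat \<Rightarrow> real) \<times> (nat \<times> nat \<Rightarrow> 'f)"
    using assms by (cases c) (simp add: herm_of_coords_nth)
  consider "i = j" | "i < j" | "j < i"
    by linarith
  then show ?thesis
  proof cases
    case 1
    have "(of_real :: real \<Rightarrow> 'f) \<in> borel_measurable borel"
      by measurable
    from measurable_compose[OF measurable_coord_diag[OF assms(1)] this] show ?thesis
      unfolding eq using 1 by simp
  next
    case 2
    then show ?thesis
      unfolding eq using assms by (simp add: measurable_coord_upper)
  next
    case 3
    then have "(\<lambda>c. snd c (j, i)) \<in> borel_measurable (coord_lborel r :: ((nat \<Rightarrow> real) \<times> (nat \<times> nat \<Rightarrow> 'f)) measure)"
      using assms by (intro measurable_coord_upper) simp
    from measurable_compose[OF this borel_measurable_conjugate] show ?thesis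
      unfolding eq using 3 by simp
  qed
qed

lemma borel_measurable_complement_entries:
  assumes "i < r" "j < r"
  shows "(\<lambda>c. complement_mat (entries (herm_of_coords r c)) i j) \<in> borel_measurable (coord_lborel r :: ((nat \<Rightarrow> real) \<times> (nat \<times> nat \<Rightarrow> 'f::herm_scalar)) measure)"
  unfolding complement_mat_def using borel_measurable_entries[OF assms] by measurable

lemma borel_measurable_pd_weight [measurable]:
  "pd_weight r a b \<in> borel_measurable (herm_lborel r :: 'f::herm_scalar mat measure)"
  unfolding herm_lborel_def
proof (rule measurable_embed_measure1)
  let ?N = "coord_lborel r :: ((nat \<Rightarrow> real) \<times> (nat \<times> nat \<Rightarrow> 'f)) measure"
  define A where "A c = entries (herm_of_coords r c)" for c :: "(nat \<Rightarrow> real) \<times> (nat \<times> nat \<Rightarrow> 'f)"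
  have A: "(\<lambda>c. A c i j) \<in> borel_measurable ?N" "(\<lambda>c. complement_mat (A c) i j) \<in> borel_measurable ?N"
    if "i < r" "j < r" for i j
    unfolding A_def using borel_measurable_entries[OF that] borel_measurable_complement_entries[OF that] .
  have herm: "hermitian r (A c)" "hermitian r (complement_mat (A c))" for c
    unfolding A_def by (intro hermitian_complement hermitian_herm_of_coords)+
  have [measurable]: "Measurable.pred ?N (\<lambda>c. pos_def r (A c))" "Measurable.pred ?N (\<lambda>c. pos_def r (complement_mat (A c)))"
    using A herm by (auto intro!: measurable_pos_def)
  have [measurable]: "(\<lambda>c. ellipsoid_volume r (A c)) \<in> borel_measurable ?N"
    "(\<lambda>c. ellipsoid_volume r (complement_mat (A c))) \<in> borel_measurable ?N"
    using A by (auto intro!: borel_measurable_ellipsoid_volume)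
  have "pd_weight r a b (herm_of_coords r c) =
      (if pos_def r (A c) \<and> pos_def r (complement_mat (A c))
       then volume_det r (A c) powr a * volume_det r (complement_mat (A c)) powr b else 0)" for c
  proof -
    have "volume_det r (entries (1\<^sub>m r - herm_of_coords r c)) = volume_det r (complement_mat (A c))"
      using complement_entries(2)[of "herm_of_coords r c" r]
      unfolding volume_det_def ellipsoid_volume_def A_def by (simp cong: qform_cong_mat)
    then show ?thesis
      using herm_det_eq_volume_det[of "herm_of_coords r c" r]
        herm_det_eq_volume_det[OF complement_entries(1), of "herm_of_coords r c" r]
      by (auto simp: pd_weight_def pd_interval_def A_def pos_def_complement_entries)
  qed
  then show "(\<lambda>c. pd_weight r a b (herm_of_coords r c)) \<in> borel_measurable ?N"
    by (simp only:) (unfold volume_det_def, measurable)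
qed

lemma sets_psd_interval: "psd_interval r \<in> sets (herm_lborel r :: 'f::herm_scalar mat measure)"
proof -
  let ?N = "coord_lborel r :: ((nat \<Rightarrow> real) \<times> (nat \<times> nat \<Rightarrow> 'f)) measure"
  have "Measurable.pred ?N (\<lambda>c. pos_semidef r (entries (herm_of_coords r c)))"
    by (rule measurable_pos_semidef) (auto intro: borel_measurable_entries hermitian_herm_of_coords)
  moreover have "Measurable.pred ?N (\<lambda>c. pos_semidef r (complement_mat (entries (herm_of_coords r c))))"
    by (rule measurable_pos_semidef) (auto intro: borel_measurable_complement_entries hermitian_herm_of_coords hermitian_complement)
  ultimately have "Measurable.pred ?N (\<lambda>c. herm_of_coords r c \<in> psd_interval r)"
    unfolding psd_interval_iff by (simp only: herm_of_coords_carrier simp_thms) (rule pred_intros_logic)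
  then have "Measurable.pred (herm_lborel r) (\<lambda>M :: 'f mat. M \<in> psd_interval r)"
    unfolding herm_lborel_def by (rule measurable_embed_measure1)
  then have "{M \<in> space (herm_lborel r). M \<in> psd_interval r} \<in> sets (herm_lborel r :: 'f mat measure)"
    by measurable
  also have "{M \<in> space (herm_lborel r). M \<in> psd_interval r} = (psd_interval r :: 'f mat set)"
    by (auto simp: space_herm_lborel psd_interval_def psd_mats_def)
  finally show ?thesis .
qed

lemma upper_left_block_herm_of_coords:
  assumes "q \<le> p"
  shows "upper_left_block q (herm_of_coords p (a, z)) = herm_of_coords q (restrict a {..<q}, restrict z (upper_index q))"
  using assms by (auto simp: upper_left_block_def mat_eq_iff herm_of_coords_nth) (auto simp: herm_of_coords_def)

lemma measurable_upper_left_block: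
  assumes "q \<le> p"
  shows "upper_left_block q \<in> measurable (herm_lborel p) (herm_lborel q :: 'f::herm_scalar mat measure)"
proof -
  have "{..<q} \<subseteq> {..<p}" "upper_index q \<subseteq> upper_index p"
    using assms by auto
  then have "(\<lambda>c. (restrict (fst c) {..<q}, restrict (snd c) (upper_index q))) \<in> measurable (coord_lborel p) (coord_lborel q)"
    by (intro measurable_Pair measurable_compose[OF measurable_fst measurable_restrict_subset]
        measurable_compose[OF measurable_snd measurable_restrict_subset])
  from measurable_compose[OF this measurable_herm_of_coords]
  have "(\<lambda>c. upper_left_block q (herm_of_coords p c :: 'f mat)) \<in> measurable (coord_lborel p) (herm_lborel q)"
    by (simp add: upper_left_block_herm_of_coords[OF assms] case_prod_beta flip: upper_left_block_herm_of_coords[OF assms])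
  then show ?thesis
    unfolding herm_lborel_def[of p] by (rule measurable_embed_measure1)
qed

lemma upper_left_block_psd_interval:
  assumes "q \<le> p" "M \<in> psd_interval p"
  shows "upper_left_block q M \<in> psd_interval q"
proof -
  have restrict: "pos_semidef q A" if "pos_semidef p A" for A :: "nat \<Rightarrow> nat \<Rightarrow> 'a"
  proof -
    have "qform q A x = qform p A (\<lambda>i. if i < q then x i else 0)" for x
    proof -
      have "qform p A (\<lambda>i. if i < q then x i else 0) =
          (\<Sum>i<p. if i < q then \<Sum>j<p. if j < q then inner (x i) (A i j * x j) else 0 else 0)"
        unfolding qform_eq by (intro sum.cong refl) (auto intro!: sum.cong)
      also have "\<dots> = qform q A x"
      proof -
        have "{i. i < p \<and> i < q} = {..<q}"
          using assms(1) by auto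
        then show ?thesis
          by (simp add: qform_eq flip: sum.inter_filter)
      qed
      finally show ?thesis ..
    qed
    moreover have "hermitian q A"
      using that assms(1) unfolding pos_semidef_def hermitian_def by (meson less_le_trans)
    ultimately show ?thesis
      using that by (simp add: pos_semidef_def)
  qed
  have M: "M \<in> carrier_mat p p" "pos_semidef p (entries M)" "pos_semidef p (complement_mat (entries M))"
    using assms(2) by (auto simp: psd_interval_iff)
  have "pos_semidef q (entries (upper_left_block q M)) \<longleftrightarrow> pos_semidef q (entries M)"
    "pos_semidef q (complement_mat (entries (upper_left_block q M))) \<longleftrightarrow> pos_semidef q (complement_mat (entries M))"
    by (intro pos_def_cong(2); simp add: upper_left_block_def complement_mat_def)+
  then show ?thesis
    using restrict[OF M(2)] restrict[OF M(3)] by (simp add: psd_interval_iff) (simp add: upper_left_block_def)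
qed

section \<open>Bordered matrices and Schur complements\<close>

definition bordered :: "nat \<Rightarrow> 'f::herm_scalar mat \<Rightarrow> (nat \<Rightarrow> 'f) \<Rightarrow> real \<Rightarrow> 'f mat" where
  "bordered q Y z t = mat (Suc q) (Suc q) (\<lambda>(i, j).
     if i < q \<and> j < q then Y $$ (i, j) else if i < q then z i else if j < q then conjugate (z j) else of_real t)"

lemma bordered_carrier [simp]: "bordered q Y z t \<in> carrier_mat (Suc q) (Suc q)"
  by (simp add: bordered_def)

lemma bordered_nth:
  "i < q \<Longrightarrow> j < q \<Longrightarrow> bordered q Y z t $$ (i, j) = Y $$ (i, j)"
  "i < q \<Longrightarrow> bordered q Y z t $$ (i, q) = z i"
  "j < q \<Longrightarrow> bordered q Y z t $$ (q, j) = conjugate (z j)"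
  "bordered q Y z t $$ (q, q) = of_real t"
  by (simp_all add: bordered_def)

lemma hermitian_bordered:
  assumes "hermitian q (entries Y)"
  shows "hermitian (Suc q) (entries (bordered q Y z t))"
  unfolding hermitian_def
proof (intro allI impI)
  fix i j assume ij: "i < Suc q" "j < Suc q"
  show "bordered q Y z t $$ (j, i) = conjugate (bordered q Y z t $$ (i, j))"
  proof (cases "i < q \<and> j < q")
    case True
    then have "Y $$ (j, i) = conjugate (Y $$ (i, j))"
      using assms unfolding hermitian_def by blast
    with True show ?thesis
      by (simp add: bordered_nth)
  next
    case False
    then show ?thesis
      using ij by (auto simp: bordered_nth less_Suc_eq)
  qed
qed

lemma qform_bordered:
  "qform (Suc q) (entries (bordered q Y z t)) x =
     qform q (entries Y) x + 2 * vinner q x (\<lambda>i. z i * x q) + t * (norm (x q))\<^sup>2"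
proof -
  have "inner (x q) (\<Sum>j<q. conjugate (z j) * x j) = vinner q x (\<lambda>i. z i * x q)"
    by (simp add: vinner_def inner_sum_right inner_mult_left_adjoint inner_commute[of "x _" "z _ * x q"])
  then show ?thesis
    by (simp add: qform_eq bordered_nth sum.distrib inner_sum_right vinner_def power2_norm_eq_inner
        inner_add_right)
qed

lemma vinner_mult_right: "vinner q (\<lambda>i. x i * s) (\<lambda>i. y i * s) = (norm s)\<^sup>2 * vinner q x y"
  by (simp add: vinner_def inner_mult_same_right sum_distrib_left)

lemma mat_apply_mult_right: "i < q \<Longrightarrow> mat_apply q A (\<lambda>i. w i * s) i = mat_apply q A w i * s"
  by (simp add: mat_apply_def sum_distrib_right mult.assoc)

text \<open>Completing the square. The vector \<open>w\<close> is \<open>Y\<^sup>-\<^sup>1 z\<close>.\<close>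

lemma qform_bordered_square:
  assumes Y: "hermitian q (entries Y)" and w: "\<And>i. i < q \<Longrightarrow> mat_apply q (entries Y) w i = z i"
  shows "qform (Suc q) (entries (bordered q Y z t)) x =
    qform q (entries Y) (\<lambda>i. x i + w i * x q) + (t - vinner q w z) * (norm (x q))\<^sup>2"
proof -
  let ?s = "x q"
  have Yws: "mat_apply q (entries Y) (\<lambda>i. w i * ?s) i = z i * ?s" if "i < q" for i
    using that w by (simp add: mat_apply_mult_right)
  have "qform q (entries Y) (\<lambda>i. x i + w i * ?s) =
      qform q (entries Y) x + 2 * vinner q (mat_apply q (entries Y) x) (\<lambda>i. w i * ?s) + qform q (entries Y) (\<lambda>i. w i * ?s)"
    using hermitian_qform_add[OF Y, of x 1 "\<lambda>i. w i * ?s"] by simp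
  also have "vinner q (mat_apply q (entries Y) x) (\<lambda>i. w i * ?s) = vinner q x (\<lambda>i. z i * ?s)"
    unfolding hermitian_vinner[OF Y] by (intro vinner_cong) (simp_all add: Yws)
  also have "qform q (entries Y) (\<lambda>i. w i * ?s) = vinner q (\<lambda>i. w i * ?s) (\<lambda>i. z i * ?s)"
    unfolding qform_def by (intro vinner_cong) (simp_all add: Yws)
  finally show ?thesis
    by (simp add: qform_bordered vinner_mult_right algebra_simps)
qed

lemma pos_def_bordered_block:
  assumes Y: "hermitian q (entries Y)" and pd: "pos_def (Suc q) (entries (bordered q Y z t))"
  shows "pos_def q (entries Y)"
  unfolding pos_def_def
proof (intro conjI allI impI Y)
  fix x :: "nat \<Rightarrow> 'a" assume "\<exists>i<q. x i \<noteq> 0"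
  then have "\<exists>i<Suc q. (x(q := 0)) i \<noteq> 0"
    by (auto simp: less_Suc_eq)
  then have "0 < qform (Suc q) (entries (bordered q Y z t)) (x(q := 0))"
    using pd unfolding pos_def_def by blast
  also have "\<dots> = qform q (entries Y) x"
    unfolding qform_bordered by (simp add: vinner_def) (rule qform_cong, simp)
  finally show "0 < qform q (entries Y) x" .
qed

text \<open>
  In the completed square, \<open>t - z\<^sup>* Y\<^sup>-\<^sup>1 z\<close> is the coefficient of \<open>|x q|\<^sup>2\<close>; it is the value of the form
  at the vector with entries \<open>- w\<close> and last entry 1.
\<close>

lemma pos_def_bordered_iff:
  assumes Y: "pos_def q (entries Y)" and w: "\<And>i. i < q \<Longrightarrow> mat_apply q (entries Y) w i = z i"
  shows "pos_def (Suc q) (entries (bordered q Y z t)) \<longleftrightarrow> vinner q w z < t"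
proof
  have herm: "hermitian q (entries Y)"
    using Y by (simp add: pos_def_def)
  have square: "qform (Suc q) (entries (bordered q Y z t)) x =
    qform q (entries Y) (\<lambda>i. x i + w i * x q) + (t - vinner q w z) * (norm (x q))\<^sup>2" for x
    by (rule qform_bordered_square[OF herm w])
  show "vinner q w z < t" if pd: "pos_def (Suc q) (entries (bordered q Y z t))"
  proof -
    let ?x = "\<lambda>i. if i = q then 1 else - w i"
    have "0 < qform (Suc q) (entries (bordered q Y z t)) ?x"
      by (rule pos_defD[OF pd, of q]) simp_all
    also have "\<dots> = qform q (entries Y) (\<lambda>i. 0) + (t - vinner q w z)"
      unfolding square[of ?x] by (simp add: qform_eq)
    finally show ?thesis
      by (simp add: qform_eq)
  qed
  show "pos_def (Suc q) (entries (bordered q Y z t))" if t: "vinner q w z < t"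
    unfolding pos_def_def
  proof (intro conjI allI impI hermitian_bordered herm)
    fix x :: "nat \<Rightarrow> 'a" assume x: "\<exists>i<Suc q. x i \<noteq> 0"
    have psd: "qform q (entries Y) y \<ge> 0" for y
      using pos_def_imp_semidef[OF Y] by (simp add: pos_semidef_def)
    show "0 < qform (Suc q) (entries (bordered q Y z t)) x"
    proof (cases "x q = 0")
      case True
      with x have "\<exists>i<q. x i \<noteq> 0"
        by (auto simp: less_Suc_eq)
      then have "0 < qform q (entries Y) x"
        using Y by (simp add: pos_def_def)
      with True show ?thesis
        unfolding square by simp
    next
      case False
      then have "0 < (t - vinner q w z) * (norm (x q))\<^sup>2"
        using t by simp
      then show ?thesis
        unfolding square using psd by (intro add_nonneg_pos) auto
    qed
  qed
qed

lemma borel_measurable_indicator_compose: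
  "A \<in> sets borel \<Longrightarrow> f \<in> borel_measurable N \<Longrightarrow> (\<lambda>x. indicator A (f x) :: ennreal) \<in> borel_measurable N"
  by (erule measurable_compose) (rule borel_measurable_indicator)

lemma nn_integral_vec_Suc:
  fixes f :: "(nat \<Rightarrow> 'f::euclidean_space) \<Rightarrow> ennreal"
  assumes "f \<in> borel_measurable (vec_lborel (Suc q))"
  shows "(\<integral>\<^sup>+x. f x \<partial>vec_lborel (Suc q)) = (\<integral>\<^sup>+s. \<integral>\<^sup>+x. f (x(q := s)) \<partial>vec_lborel q \<partial>lborel)"
  using assms lborel_PiM.product_nn_integral_insert_rev[of "{..<q}" q f] by (simp add: lessThan_Suc)

text \<open>
  In the volume of the ellipsoid of a bordered matrix, the completed square is undone by a
  translation, after which \<open>Y\<close> and the Schur complement \<open>t - z\<^sup>* Y\<^sup>-\<^sup>1 z\<close> scale the variables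
  separately.
\<close>

lemma herm_det_bordered:
  fixes Y :: "'f::herm_scalar mat"
  assumes Y: "Y \<in> carrier_mat q q" "pos_def q (entries Y)"
    and w: "\<And>i. i < q \<Longrightarrow> mat_apply q (entries Y) w i = z i" and t: "vinner q w z < t"
  shows "herm_det (bordered q Y z t) = herm_det Y * (t - vinner q w z)"
proof -
  let ?A = "entries (bordered q Y z t)"
  let ?d = "real DIM('f) / 2"
  define \<tau> where "\<tau> = t - vinner q w z"
  have \<tau>: "\<tau> > 0"
    using t by (simp add: \<tau>_def)
  have herm: "hermitian q (entries Y)"
    using Y by (simp add: pos_def_def)
  have pdA: "pos_def (Suc q) ?A"
    using pos_def_bordered_iff[OF Y(2) w] t by simp
  have meas: "(\<lambda>x. qform q (entries Y) x) \<in> borel_measurable (vec_lborel q)"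
    by measurable
  have "ellipsoid_volume (Suc q) ?A =
      (\<integral>\<^sup>+s. \<integral>\<^sup>+x. indicator {..1} (qform (Suc q) ?A (x(q := s))) \<partial>vec_lborel q \<partial>lborel)"
    unfolding ellipsoid_volume_def by (intro nn_integral_vec_Suc) measurable
  also have "\<dots> = (\<integral>\<^sup>+s. \<integral>\<^sup>+x. indicator {..1} (qform q (entries Y) x + \<tau> * (norm s)\<^sup>2) \<partial>vec_lborel q \<partial>(lborel :: 'f measure))"
  proof (rule nn_integral_cong)
    fix s :: 'f
    have "qform (Suc q) ?A (x(q := s)) = qform q (entries Y) (\<lambda>i\<in>{..<q}. x i + w i * s) + \<tau> * (norm s)\<^sup>2" for x
    proof -
      have "qform (Suc q) ?A (x(q := s)) =
          qform q (entries Y) (\<lambda>i. (x(q := s)) i + w i * (x(q := s)) q) + (t - vinner q w z) * (norm ((x(q := s)) q))\<^sup>2"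
        by (rule qform_bordered_square[OF herm w])
      then show ?thesis
        by (simp add: \<tau>_def cong: qform_cong)
    qed
    moreover have "(\<integral>\<^sup>+x. indicator {..1} (qform q (entries Y) (\<lambda>i\<in>{..<q}. x i + w i * s) + \<tau> * (norm s)\<^sup>2) \<partial>vec_lborel q)
        = (\<integral>\<^sup>+x. indicator {..1} (qform q (entries Y) x + \<tau> * (norm s)\<^sup>2) \<partial>(vec_lborel q :: (nat \<Rightarrow> 'f) measure))"
      by (rule nn_integral_PiM_translate[where f = "\<lambda>x. indicator {..1} (qform q (entries Y) x + \<tau> * (norm s)\<^sup>2)"])
        (auto intro!: borel_measurable_indicator_compose meas)
    ultimately show "(\<integral>\<^sup>+x. indicator {..1} (qform (Suc q) ?A (x(q := s))) \<partial>vec_lborel q) =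
        (\<integral>\<^sup>+x. indicator {..1} (qform q (entries Y) x + \<tau> * (norm s)\<^sup>2) \<partial>(vec_lborel q :: (nat \<Rightarrow> 'f) measure))"
      by simp
  qed
  finally have volA: "ellipsoid_volume (Suc q) ?A = \<dots>" .
  define h where "h s = (\<integral>\<^sup>+x. indicator {..1} (qform q (entries Y) x + \<tau> * (norm s)\<^sup>2) \<partial>vec_lborel q)" for s :: 'f
  define k where "k i = (if i = q then \<tau> else 1)" for i
  have kq: "(\<Sum>i<Suc q. k i * (norm ((x(q := s)) i))\<^sup>2) = vinner q x x + \<tau> * (norm s)\<^sup>2" for x and s :: 'f
    by (simp add: k_def vinner_self)
  have step: "ennreal (herm_det Y powr ?d) * h s = (\<integral>\<^sup>+x. indicator {..1} (vinner q x x + \<tau> * (norm s)\<^sup>2) \<partial>(vec_lborel q :: (nat \<Rightarrow> 'f) measure))" for s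
    unfolding h_def using nn_integral_qform[OF Y, of "\<lambda>u. indicator {..1} (u + \<tau> * (norm s)\<^sup>2)"] by simp
  have pos: "herm_det Y > 0" "herm_det (bordered q Y z t) > 0"
    using herm_det_pos[OF Y] herm_det_pos[OF _ pdA] by auto
  have h_meas: "h \<in> borel_measurable lborel"
  proof -
    interpret V: sigma_finite_measure "vec_lborel q :: (nat \<Rightarrow> 'f) measure"
      by (rule sigma_finite_vec_lborel)
    have "(\<lambda>(s :: 'f, x). indicator {..1} (qform q (entries Y) x + \<tau> * (norm s)\<^sup>2) :: ennreal)
        \<in> borel_measurable (lborel \<Otimes>\<^sub>M vec_lborel q)"
      by measurable
    then show ?thesis
      unfolding h_def by (rule V.borel_measurable_nn_integral)
  qed
  have "ennreal (herm_det Y powr ?d) * ellipsoid_volume (Suc q) ?A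
      = (\<integral>\<^sup>+s. \<integral>\<^sup>+x. indicator {..1} (\<Sum>i<Suc q. k i * (norm ((x(q := s)) i))\<^sup>2) \<partial>vec_lborel q \<partial>(lborel :: 'f measure))"
    unfolding volA h_def[symmetric] kq using h_meas by (simp add: step flip: nn_integral_cmult)
  also have "\<dots> = (\<integral>\<^sup>+x. indicator {..1} (\<Sum>i<Suc q. k i * (norm (x i))\<^sup>2) \<partial>(vec_lborel (Suc q) :: (nat \<Rightarrow> 'f) measure))"
    by (rule nn_integral_vec_Suc[symmetric]) (intro borel_measurable_indicator_compose borel_measurable_sum
        borel_measurable_times borel_measurable_power borel_measurable_norm; simp add: measurable_vec_component)
  finally have "ennreal ((\<Prod>i<Suc q. k i) powr ?d) * (ennreal (herm_det Y powr ?d) * ellipsoid_volume (Suc q) ?A)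
      = unit_volume TYPE('f) (Suc q)"
    using nn_integral_scaled_norms[of "Suc q" k "indicator {..1}", where 'f='f] \<tau>
    by (simp only:) (simp add: unit_volume_eq k_def)
  moreover have prod_k: "(\<Prod>i<Suc q. k i) = \<tau>"
    by (simp add: k_def)
  ultimately have "ennreal (\<tau> powr ?d) * (ennreal (herm_det Y powr ?d) * ellipsoid_volume (Suc q) ?A)
      = unit_volume TYPE('f) (Suc q)"
    by (simp only: prod_k)
  then have "ennreal ((herm_det Y * \<tau>) powr ?d) * ellipsoid_volume (Suc q) ?A = unit_volume TYPE('f) (Suc q)"
    using \<tau> pos by (simp add: powr_mult ennreal_mult mult_ac)
  moreover have "ennreal (herm_det (bordered q Y z t) powr ?d) * ellipsoid_volume (Suc q) ?A = unit_volume TYPE('f) (Suc q)"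
    using nn_integral_qform[OF bordered_carrier pdA, of "indicator {..1}"]
    by (simp add: ellipsoid_volume_def unit_volume_eq)
  ultimately have "ellipsoid_volume (Suc q) ?A * ennreal ((herm_det Y * \<tau>) powr ?d) =
      ellipsoid_volume (Suc q) ?A * ennreal (herm_det (bordered q Y z t) powr ?d)"
    by (simp add: mult.commute)
  moreover obtain U l where U: "eigenbasis (Suc q) ?A U l" and l: "\<And>i. i < Suc q \<Longrightarrow> l i > 0"
    using pos_def_eigenbasis[OF pdA] by blast
  ultimately have eq: "(herm_det Y * \<tau>) powr ?d = herm_det (bordered q Y z t) powr ?d"
    using ellipsoid_volume_bounds[OF U l] by (auto simp: ennreal_mult_cancel_left)
  have "herm_det Y * \<tau> = herm_det (bordered q Y z t)"
  proof (rule powr_cancel_right)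
    show "0 < ?d" "0 < herm_det Y * \<tau>" "0 < herm_det (bordered q Y z t)"
      using pos \<tau> by simp_all
  qed (fact eq)
  then show ?thesis
    by (simp add: \<tau>_def)
qed

section \<open>Integration over the border\<close>

text \<open>
  The truncation encodes the domain of integration: with it, all integrals extend over whole spaces.
\<close>

definition pospow :: "real \<Rightarrow> real \<Rightarrow> real" where
  "pospow a x = (if x > 0 then x powr a else 0)"

lemma pospow_nonneg [simp]: "pospow a x \<ge> 0"
  by (simp add: pospow_def)

lemma borel_measurable_pospow [measurable]: "pospow a \<in> borel_measurable borel"
  unfolding pospow_def[abs_def] by measurable

lemma pospow_mult: "c > 0 \<Longrightarrow> pospow a (c * x) = c powr a * pospow a x"
  by (simp add: pospow_def zero_less_mult_iff powr_mult)

lemma ennreal_mult_left_cancel_inverse: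
  assumes "c > 0" "ennreal c * x = y"
  shows "x = ennreal (1 / c) * y"
proof -
  have "ennreal (1 / c) * y = ennreal (1 / c * c) * x"
    using assms(1) unfolding assms(2)[symmetric] by (subst ennreal_mult) (auto simp: mult.assoc)
  then show ?thesis
    using assms(1) by simp
qed

definition beta_int :: "real \<Rightarrow> real \<Rightarrow> ennreal" where
  "beta_int a b = (\<integral>\<^sup>+t. ennreal (pospow a t * pospow b (1 - t)) \<partial>lborel)"

text \<open>
  The value is Euler's beta function at \<open>(a + 1, b + 1)\<close>.
\<close>

lemma beta_int_bounds:
  assumes "a > -1" "b > -1"
  shows "beta_int a b \<noteq> 0" "beta_int a b \<noteq> \<infinity>"
proof -
  have "((\<lambda>t. t powr ((a + 1) - 1) * (1 - t) powr ((b + 1) - 1)) has_integral Beta (a + 1) (b + 1)) {0..1}"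
    using assms by (intro has_integral_Beta_real) auto
  then have hi: "((\<lambda>t. t powr a * (1 - t) powr b) has_integral Beta (a + 1) (b + 1)) {0..1}"
    by simp
  have "((\<lambda>t. pospow a t * pospow b (1 - t)) has_integral Beta (a + 1) (b + 1)) {0..1}"
    by (rule has_integral_eq[OF _ hi]) (auto simp: pospow_def)
  then have "((\<lambda>t. if t \<in> {0..1} then pospow a t * pospow b (1 - t) else 0) has_integral Beta (a + 1) (b + 1)) UNIV"
    by (simp only: has_integral_restrict_UNIV)
  moreover have "(\<lambda>t. if t \<in> {0..1} then pospow a t * pospow b (1 - t) else 0) = (\<lambda>t. pospow a t * pospow b (1 - t))"
    by (auto simp: pospow_def)
  ultimately have "((\<lambda>t. pospow a t * pospow b (1 - t)) has_integral Beta (a + 1) (b + 1)) UNIV"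
    by simp
  then have "beta_int a b = ennreal (Beta (a + 1) (b + 1))"
    unfolding beta_int_def by (intro nn_integral_has_integral_lborel) auto
  moreover have "Beta (a + 1) (b + 1) > 0"
    unfolding Beta_def using assms by (intro divide_pos_pos mult_pos_pos Gamma_real_pos) auto
  ultimately show "beta_int a b \<noteq> 0" "beta_int a b \<noteq> \<infinity>"
    by auto
qed

text \<open>
  The substitution \<open>t = \<kappa> + (1 - \<kappa> - \<kappa>') u\<close> maps the unit interval onto the domain of integration.
\<close>

lemma nn_integral_beta_shift:
  "(\<integral>\<^sup>+t. ennreal (pospow a (t - \<kappa>) * pospow b (1 - t - \<kappa>')) \<partial>lborel)
    = ennreal (pospow (a + b + 1) (1 - \<kappa> - \<kappa>')) * beta_int a b"
proof (cases "1 - \<kappa> - \<kappa>' > 0")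
  case True
  define c where "c = 1 - \<kappa> - \<kappa>'"
  have c: "c > 0"
    using True by (simp add: c_def)
  have "(\<integral>\<^sup>+t. ennreal (pospow a (t - \<kappa>) * pospow b (1 - t - \<kappa>')) \<partial>lborel)
      = ennreal c * (\<integral>\<^sup>+u. ennreal (pospow a (\<kappa> + c * u - \<kappa>) * pospow b (1 - (\<kappa> + c * u) - \<kappa>')) \<partial>lborel)"
    using c by (subst nn_integral_real_affine[where c = c and t = \<kappa>]) auto
  also have "(\<lambda>u. ennreal (pospow a (\<kappa> + c * u - \<kappa>) * pospow b (1 - (\<kappa> + c * u) - \<kappa>')))
      = (\<lambda>u. ennreal (c powr a * c powr b) * ennreal (pospow a u * pospow b (1 - u)))"
  proof
    fix u
    have "1 - (\<kappa> + c * u) - \<kappa>' = c * (1 - u)"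
      by (simp add: c_def algebra_simps)
    then show "ennreal (pospow a (\<kappa> + c * u - \<kappa>) * pospow b (1 - (\<kappa> + c * u) - \<kappa>'))
        = ennreal (c powr a * c powr b) * ennreal (pospow a u * pospow b (1 - u))"
      using c by (simp add: pospow_mult mult_ac flip: ennreal_mult)
  qed
  also have "ennreal c * (\<integral>\<^sup>+u. ennreal (c powr a * c powr b) * ennreal (pospow a u * pospow b (1 - u)) \<partial>lborel)
      = ennreal (c * (c powr a * c powr b)) * beta_int a b"
    unfolding beta_int_def using c by (subst nn_integral_cmult) (auto simp: ennreal_mult mult.assoc)
  also have "c * (c powr a * c powr b) = pospow (a + b + 1) c"
    using c by (simp add: pospow_def powr_add)
  finally show ?thesis
    by (simp add: c_def)
next
  case False
  then have "pospow a (t - \<kappa>) * pospow b (1 - t - \<kappa>') = 0" for t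
    by (auto simp: pospow_def)
  moreover have "pospow (a + b + 1) (1 - \<kappa> - \<kappa>') = 0"
    using False by (simp add: pospow_def)
  ultimately show ?thesis
    by (simp only:) simp
qed

definition ball_int :: "'f::herm_scalar itself \<Rightarrow> nat \<Rightarrow> real \<Rightarrow> ennreal" where
  "ball_int _ r s = (\<integral>\<^sup>+x. ennreal (pospow s (1 - vinner r x x)) \<partial>(vec_lborel r :: (nat \<Rightarrow> 'f) measure))"

text \<open>
  The integrand is positive on the ball of radius 1/2, which is not a null set.
\<close>

lemma ball_int_nonzero: "ball_int TYPE('f::herm_scalar) r s \<noteq> 0"
proof
  let ?V = "vec_lborel r :: (nat \<Rightarrow> 'f) measure"
  assume "ball_int TYPE('f) r s = 0"
  then have "AE x in ?V. ennreal (pospow s (1 - vinner r x x)) = 0"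
    unfolding ball_int_def by (subst (asm) nn_integral_0_iff_AE) auto
  then have "AE x in ?V. (indicator {..1} (\<Sum>i<r. 4 * (norm (x i))\<^sup>2) :: ennreal) = 0"
  proof (rule AE_mp, intro AE_I2 impI)
    fix x :: "nat \<Rightarrow> 'f" assume "ennreal (pospow s (1 - vinner r x x)) = 0"
    then have "\<not> vinner r x x < 1"
      by (auto simp: pospow_def ennreal_eq_0_iff split: if_splits)
    then show "(indicator {..1} (\<Sum>i<r. 4 * (norm (x i))\<^sup>2) :: ennreal) = 0"
      by (auto simp: vinner_self simp flip: sum_distrib_left split: split_indicator)
  qed
  then have "(\<integral>\<^sup>+x. indicator {..1} (\<Sum>i<r. 4 * (norm (x i))\<^sup>2) \<partial>?V) = (\<integral>\<^sup>+x. 0 \<partial>?V)"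
    by (rule nn_integral_cong_AE)
  then have "unit_volume TYPE('f) r = 0"
    using nn_integral_scaled_norms[of r "\<lambda>_. 4" "indicator {..1}", where 'f='f] by (simp add: unit_volume_eq)
  then show False
    using unit_volume_bounds by blast
qed

text \<open>
  By scaling, the integral of \<open>(R - |x|\<^sup>2)\<^sup>s\<close> over the ball of radius \<open>sqrt R\<close> is a power of \<open>R\<close> times
  its value at \<open>R = 1\<close>. Integrating over \<open>R\<close> from 0 to 1 first instead replaces the possibly negative
  exponent \<open>s\<close> by \<open>s + 1 > 0\<close>, which leaves a bounded integrand.
\<close>

lemma ball_int_finite:
  assumes s: "s > -1"
  shows "ball_int TYPE('f::herm_scalar) r s \<noteq> \<infinity>"
proof
  let ?V = "vec_lborel r :: (nat \<Rightarrow> 'f) measure"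
  assume inf: "ball_int TYPE('f) r s = \<infinity>"
  define e where "e = s + real r * (real DIM('f) / 2)"
  have e: "e > -1"
  proof -
    have "0 \<le> real r * (real DIM('f) / 2)"
      by simp
    with s show ?thesis
      unfolding e_def by linarith
  qed
  interpret V: sigma_finite_measure ?V
    by (rule sigma_finite_vec_lborel)
  interpret LV: pair_sigma_finite "lborel :: real measure" ?V ..
  \<comment> \<open>The factor \<open>pospow 0 (1 - R)\<close> is the indicator of \<open>R < 1\<close>.\<close>
  have inner: "(\<integral>\<^sup>+x. ennreal (pospow s (R - vinner r x x) * pospow 0 (1 - R)) \<partial>?V)
      = ennreal (pospow e R * pospow 0 (1 - R)) * ball_int TYPE('f) r s" for R
  proof (cases "R > 0")
    case True
    have "pospow s (R - vinner r x x) = R powr s * pospow s (1 - (\<Sum>i<r. (1 / R) * (norm (x i))\<^sup>2))" for x :: "nat \<Rightarrow> 'f"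
    proof -
      have "R - vinner r x x = R * (1 - (\<Sum>i<r. (1 / R) * (norm (x i))\<^sup>2))"
        using True unfolding sum_distrib_left[symmetric] by (simp add: vinner_self right_diff_distrib)
      then show ?thesis
        using True by (simp only: pospow_mult)
    qed
    then have "(\<integral>\<^sup>+x. ennreal (pospow s (R - vinner r x x) * pospow 0 (1 - R)) \<partial>?V)
        = (\<integral>\<^sup>+x. ennreal (R powr s * pospow 0 (1 - R)) * ennreal (pospow s (1 - (\<Sum>i<r. (1 / R) * (norm (x i))\<^sup>2))) \<partial>?V)"
      by (simp add: mult_ac flip: ennreal_mult)
    also have "\<dots> = ennreal (R powr s * pospow 0 (1 - R)) * (\<integral>\<^sup>+x. ennreal (pospow s (1 - (\<Sum>i<r. (1 / R) * (norm (x i))\<^sup>2))) \<partial>?V)"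
    proof (rule nn_integral_cmult)
      have "(\<lambda>x. \<Sum>i<r. (1 / R) * (norm (x i))\<^sup>2) \<in> borel_measurable ?V"
        unfolding sum_distrib_left[symmetric] vinner_self[symmetric] by measurable
      then show "(\<lambda>x. ennreal (pospow s (1 - (\<Sum>i<r. (1 / R) * (norm (x i))\<^sup>2)))) \<in> borel_measurable ?V"
        by measurable
    qed
    also have "(\<integral>\<^sup>+x. ennreal (pospow s (1 - (\<Sum>i<r. (1 / R) * (norm (x i))\<^sup>2))) \<partial>?V)
        = ennreal (R powr (real r * (real DIM('f) / 2))) * ball_int TYPE('f) r s"
    proof -
      have "ennreal ((\<Prod>i<r. 1 / R) powr (real DIM('f) / 2)) *
          (\<integral>\<^sup>+x. ennreal (pospow s (1 - (\<Sum>i<r. (1 / R) * (norm (x i))\<^sup>2))) \<partial>?V) = ball_int TYPE('f) r s"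
        unfolding ball_int_def using True
        by (intro nn_integral_scaled_norms[where g = "\<lambda>u. ennreal (pospow s (1 - u))"]) auto
      moreover have "(\<Prod>i<r. 1 / R) powr (real DIM('f) / 2) = R powr - (real r * (real DIM('f) / 2))"
        using True by (simp add: powr_divide powr_minus_divide powr_powr power_divide flip: powr_realpow)
      ultimately have "ennreal (R powr - (real r * (real DIM('f) / 2))) *
          (\<integral>\<^sup>+x. ennreal (pospow s (1 - (\<Sum>i<r. (1 / R) * (norm (x i))\<^sup>2))) \<partial>?V) = ball_int TYPE('f) r s"
        by (simp only:)
      from ennreal_mult_left_cancel_inverse[OF _ this] show ?thesis
        using True by (simp add: powr_minus_divide)
    qed
    finally have "(\<integral>\<^sup>+x. ennreal (pospow s (R - vinner r x x) * pospow 0 (1 - R)) \<partial>?V) =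
      ennreal (R powr s * pospow 0 (1 - R)) * (ennreal (R powr (real r * (real DIM('f) / 2))) * ball_int TYPE('f) r s)" .
    moreover have "pospow e R = R powr s * R powr (real r * (real DIM('f) / 2))"
      using True by (simp add: pospow_def e_def powr_add)
    ultimately show ?thesis
      by (simp only:) (simp add: ennreal_mult mult_ac)
  next
    case False
    have "pospow s (R - vinner r x x) = 0" for x :: "nat \<Rightarrow> 'f"
      using False sum_nonneg[of "{..<r}" "\<lambda>i. (norm (x i))\<^sup>2"] by (simp add: pospow_def vinner_self)
    with False show ?thesis
      by (simp add: pospow_def)
  qed
  have "beta_int e 0 * ball_int TYPE('f) r s
      = (\<integral>\<^sup>+R. \<integral>\<^sup>+x. ennreal (pospow s (R - vinner r x x) * pospow 0 (1 - R)) \<partial>?V \<partial>lborel)"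
    unfolding inner beta_int_def by (simp add: nn_integral_multc)
  also have "\<dots> = (\<integral>\<^sup>+x. \<integral>\<^sup>+R. ennreal (pospow s (R - vinner r x x) * pospow 0 (1 - R)) \<partial>lborel \<partial>?V)"
    by (rule LV.Fubini'[symmetric]) measurable
  also have "\<dots> = (\<integral>\<^sup>+x. ennreal (pospow (s + 1) (1 - vinner r x x)) * beta_int s 0 \<partial>?V)"
    using nn_integral_beta_shift[of s _ 0 0] by simp
  also have "\<dots> \<le> (\<integral>\<^sup>+x. indicator {..1} (vinner r x x) * beta_int s 0 \<partial>?V)"
  proof (intro nn_integral_mono mult_right_mono)
    fix x :: "nat \<Rightarrow> 'f"
    have "pospow (s + 1) (1 - vinner r x x) \<le> 1"
      using s sum_nonneg[of "{..<r}" "\<lambda>i. (norm (x i))\<^sup>2"] by (auto simp: pospow_def vinner_self powr_le1)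
    moreover have "pospow (s + 1) (1 - vinner r x x) = 0" if "vinner r x x > 1"
      using that by (simp add: pospow_def)
    ultimately show "ennreal (pospow (s + 1) (1 - vinner r x x)) \<le> indicator {..1} (vinner r x x)"
      by (auto split: split_indicator)
  qed simp
  also have "\<dots> = unit_volume TYPE('f) r * beta_int s 0"
    by (subst nn_integral_multc) (auto simp: unit_volume_eq)
  also have "\<dots> < \<infinity>"
    using unit_volume_bounds[where 'f='f, of r] beta_int_bounds(2)[OF s, of 0]
    by (auto simp: ennreal_mult_less_top less_top)
  finally show False
    using inf beta_int_bounds(1)[OF e, of 0] by (simp add: ennreal_mult_top)
qed

text \<open>
  The vector \<open>w\<close> is \<open>A\<^sup>-\<^sup>1 z\<close>; in the eigenbasis, \<open>z\<^sup>* A\<^sup>-\<^sup>1 z\<close> becomes a sum of squares divided by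
  the eigenvalues.
\<close>

lemma eigenbasis_solve:
  assumes U: "eigenbasis r A U l" and l: "\<And>i. i < r \<Longrightarrow> l i \<noteq> 0"
  obtains w where "\<And>i. i < r \<Longrightarrow> mat_apply r A w i = z i"
    and "vinner r w z = (\<Sum>i<r. (1 / l i) * (norm (mat_apply r (adjoint_mat U) z i))\<^sup>2)"
proof -
  have U': "orthonormal_cols r r U" "eigenpairs r r A U l"
    using U by (auto simp: eigenbasis_def)
  let ?y = "mat_apply r (adjoint_mat U) z"
  let ?w = "mat_apply r U (\<lambda>i. of_real (1 / l i) * ?y i)"
  show thesis
  proof (rule that)
    show "mat_apply r A ?w i = z i" if "i < r" for i
    proof -
      have "mat_apply r A ?w = mat_apply r U ?y"
        unfolding mat_apply_eigenbasis[OF U'(2)]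
        by (rule mat_apply_cong) (use l in \<open>simp add: mult.assoc[symmetric] flip: of_real_mult\<close>)
      then show ?thesis
        by (simp add: mat_apply_unitary(1)[OF U'(1) that])
    qed
    show "vinner r ?w z = (\<Sum>i<r. (1 / l i) * (norm (?y i))\<^sup>2)"
      unfolding vinner_mat_apply_left by (simp only: vinner_def inner_of_real_mult power2_norm_eq_inner)
  qed
qed

lemma complement_bordered:
  assumes "Y \<in> carrier_mat q q"
  shows "1\<^sub>m (Suc q) - bordered q Y z t = bordered q (1\<^sub>m q - Y) (\<lambda>i. - z i) (1 - t)"
  using assms by (intro eq_matI) (auto simp: bordered_def)

lemma bordered_pd_interval_iff:
  assumes "Y \<in> carrier_mat q q"
  shows "bordered q Y z t \<in> pd_interval (Suc q) \<longleftrightarrow>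
    pos_def (Suc q) (entries (bordered q Y z t)) \<and>
    pos_def (Suc q) (entries (bordered q (1\<^sub>m q - Y) (\<lambda>i. - z i) (1 - t)))"
  using pos_def_complement_entries(1)[OF bordered_carrier, of q Y z t]
  by (simp add: pd_interval_def complement_bordered[OF assms])

lemma pd_weight_bordered_outside:
  assumes "Y \<in> carrier_mat q q" "hermitian q (entries Y)" "Y \<notin> pd_interval q"
  shows "pd_weight (Suc q) a b (bordered q Y z t) = 0"
proof -
  have herm: "hermitian q (entries (1\<^sub>m q - Y))"
    using hermitian_complement[OF assms(2)] complement_entries(2)[OF assms(1)] 
      hermitian_cong[of q "entries (1\<^sub>m q - Y)" "complement_mat (entries Y)"] by blast
  have "\<not> (pos_def q (entries Y) \<and> pos_def q (entries (1\<^sub>m q - Y)))"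
    using assms(1,3) by (simp add: pd_interval_def pos_def_complement_entries)
  then have "bordered q Y z t \<notin> pd_interval (Suc q)"
    unfolding bordered_pd_interval_iff[OF assms(1)]
    using pos_def_bordered_block[OF assms(2)] pos_def_bordered_block[OF herm] by blast
  then show ?thesis
    by (simp add: pd_weight_def)
qed

text \<open>
  Both \<open>Y\<close> and \<open>1 - Y\<close> are diagonal in the eigenbasis of \<open>Y\<close>, so that the two Schur complements are
  expressed by the same coordinates of \<open>z\<close>.
\<close>

lemma pd_weight_bordered:
  fixes Y :: "'f::herm_scalar mat"
  assumes Y: "Y \<in> pd_interval q" and U: "eigenbasis q (entries Y) U l"
    and l: "\<And>i. i < q \<Longrightarrow> 0 < l i" "\<And>i. i < q \<Longrightarrow> l i < 1"
  defines "y \<equiv> \<lambda>z i. (norm (mat_apply q (adjoint_mat U) z i))\<^sup>2"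
  shows "pd_weight (Suc q) a b (bordered q Y z t) =
    herm_det Y powr a * herm_det (1\<^sub>m q - Y) powr b *
    (pospow a (t - (\<Sum>i<q. (1 / l i) * y z i)) * pospow b (1 - t - (\<Sum>i<q. (1 / (1 - l i)) * y z i)))"
proof -
  have carrier: "Y \<in> carrier_mat q q" "1\<^sub>m q - Y \<in> carrier_mat q q"
    and pd: "pos_def q (entries Y)" "pos_def q (entries (1\<^sub>m q - Y))"
    using Y by (auto simp: pd_interval_def pos_def_complement_entries)
  have U': "eigenbasis q (entries (1\<^sub>m q - Y)) U (\<lambda>i. 1 - l i)"
    using eigenbasis_complement[OF U] pos_def_complement_entries(3)[OF carrier(1)] by blast
  have l0: "\<And>i. i < q \<Longrightarrow> l i \<noteq> 0" "\<And>i. i < q \<Longrightarrow> 1 - l i \<noteq> 0"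
    using l by force+
  obtain w where w: "\<And>i. i < q \<Longrightarrow> mat_apply q (entries Y) w i = z i"
    and wz: "vinner q w z = (\<Sum>i<q. (1 / l i) * y z i)"
    using eigenbasis_solve[OF U l0(1), of z] unfolding y_def by blast
  obtain w' where w': "\<And>i. i < q \<Longrightarrow> mat_apply q (entries (1\<^sub>m q - Y)) w' i = - z i"
    and wz': "vinner q w' (\<lambda>i. - z i) = (\<Sum>i<q. (1 / (1 - l i)) * y (\<lambda>i. - z i) i)"
    using eigenbasis_solve[OF U' l0(2), of "\<lambda>i. - z i"] unfolding y_def by blast
  have y_minus: "y (\<lambda>i. - z i) i = y z i" if "i < q" for i
    using that by (simp add: y_def mat_apply_def sum_negf)
  then have wz'': "vinner q w' (\<lambda>i. - z i) = (\<Sum>i<q. (1 / (1 - l i)) * y z i)"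
    unfolding wz' by (intro sum.cong) auto
  have iff: "bordered q Y z t \<in> pd_interval (Suc q) \<longleftrightarrow>
      (\<Sum>i<q. (1 / l i) * y z i) < t \<and> (\<Sum>i<q. (1 / (1 - l i)) * y z i) < 1 - t"
    unfolding bordered_pd_interval_iff[OF carrier(1)]
    using pos_def_bordered_iff[OF pd(1) w, of t] pos_def_bordered_iff[OF pd(2) w', of "1 - t"]
    by (simp only: wz wz'') 
  show ?thesis
  proof (cases "bordered q Y z t \<in> pd_interval (Suc q)")
    case True
    then have t: "vinner q w z < t" "vinner q w' (\<lambda>i. - z i) < 1 - t"
      unfolding iff wz wz'' by auto
    have "herm_det (bordered q Y z t) = herm_det Y * (t - vinner q w z)"
      by (rule herm_det_bordered[OF carrier(1) pd(1) w t(1)])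
    moreover have "herm_det (1\<^sub>m (Suc q) - bordered q Y z t) = herm_det (1\<^sub>m q - Y) * (1 - t - vinner q w' (\<lambda>i. - z i))"
      unfolding complement_bordered[OF carrier(1)]
      by (rule herm_det_bordered[OF carrier(2) pd(2) w' t(2)])
    moreover have "herm_det Y > 0" "herm_det (1\<^sub>m q - Y) > 0"
      using herm_det_pos carrier pd by blast+
    ultimately show ?thesis
      using True t unfolding pd_weight_def wz wz'' by (simp add: pospow_def powr_mult)
  next
    case False
    then show ?thesis
      using iff by (auto simp: pd_weight_def pospow_def)
  qed
qed

text \<open>
  The integral over \<open>t\<close> leaves a power of \<open>1 - z\<^sup>* (Y (1 - Y))\<^sup>-\<^sup>1 z\<close>, because
  \<open>1 / l + 1 / (1 - l) = 1 / (l (1 - l))\<close> for the eigenvalues \<open>l\<close>. A unitary substitution for \<open>z\<close> makes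
  this form diagonal and a scaling turns it into \<open>|z|\<^sup>2\<close>, at the cost of the power \<open>d / 2\<close> of
  \<open>det Y det (1 - Y)\<close>.
\<close>

lemma nn_integral_pd_weight_bordered:
  fixes Y :: "'f::herm_scalar mat"
  assumes Y: "Y \<in> herm_mats q"
  shows "(\<integral>\<^sup>+z. \<integral>\<^sup>+t. ennreal (pd_weight (Suc q) a b (bordered q Y z t)) \<partial>lborel \<partial>vec_lborel q)
    = beta_int a b * ball_int TYPE('f) q (a + b + 1) *
      ennreal (pd_weight q (a + real DIM('f) / 2) (b + real DIM('f) / 2) Y)"
proof (cases "Y \<in> pd_interval q")
  case False
  with Y show ?thesis
    by (simp add: herm_mats_iff pd_weight_bordered_outside) (simp add: pd_weight_def)
next
  case True
  let ?V = "vec_lborel q :: (nat \<Rightarrow> 'f) measure"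
  let ?d = "real DIM('f) / 2"
  have carrier: "Y \<in> carrier_mat q q" "1\<^sub>m q - Y \<in> carrier_mat q q"
    and pd: "pos_def q (entries Y)" "pos_def q (entries (1\<^sub>m q - Y))"
    using True by (auto simp: pd_interval_def pos_def_complement_entries)
  obtain U l where U: "eigenbasis q (entries Y) U l" and l: "\<And>i. i < q \<Longrightarrow> 0 < l i"
    using pos_def_eigenbasis[OF pd(1)] by blast
  have U': "eigenbasis q (entries (1\<^sub>m q - Y)) U (\<lambda>i. 1 - l i)"
    using eigenbasis_complement[OF U] pos_def_complement_entries(3)[OF carrier(1)] by blast
  have l': "l i < 1" if "i < q" for i
    using pos_def_iff_eigenvalues[OF _ U'] pd(2) that by (auto simp: pos_def_def)
  have orth: "orthonormal_cols q q U"
    using U by (simp add: eigenbasis_def)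
  have det: "herm_det Y = (\<Prod>i<q. l i)" "herm_det (1\<^sub>m q - Y) = (\<Prod>i<q. 1 - l i)"
    using herm_det_eq[OF carrier(1) pos_def_imp_semidef[OF pd(1)] U]
      herm_det_eq[OF carrier(2) pos_def_imp_semidef[OF pd(2)] U'] .
  define c where "c = herm_det Y powr a * herm_det (1\<^sub>m q - Y) powr b"
  have c: "c \<ge> 0"
    by (simp add: c_def)
  define k where "k i = 1 / (l i * (1 - l i))" for i
  have k: "k i > 0" if "i < q" for i
    using l[OF that] l'[OF that] by (simp add: k_def)
  define y where "y z i = (norm (mat_apply q (adjoint_mat U) z i))\<^sup>2" for z i
  define F where "F z = ennreal (pospow (a + b + 1) (1 - (\<Sum>i<q. k i * (norm (z i))\<^sup>2)))" for z :: "nat \<Rightarrow> 'f"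
  have F_meas: "F \<in> borel_measurable ?V"
  proof -
    have "(\<lambda>z. \<Sum>i<q. k i * (norm (z i))\<^sup>2) \<in> borel_measurable ?V"
      by (intro borel_measurable_sum borel_measurable_times borel_measurable_power borel_measurable_norm)
        (auto dest: measurable_vec_component[OF measurable_ident])
    then show ?thesis
      unfolding F_def[abs_def] by measurable
  qed
  have inner: "(\<integral>\<^sup>+t. ennreal (pd_weight (Suc q) a b (bordered q Y z t)) \<partial>lborel)
      = ennreal c * beta_int a b * F (mat_apply q (adjoint_mat U) z)" for z
  proof -
    let ?k1 = "\<Sum>i<q. (1 / l i) * y z i" and ?k2 = "\<Sum>i<q. (1 / (1 - l i)) * y z i"
    have "?k1 + ?k2 = (\<Sum>i<q. k i * y z i)"
      unfolding sum.distrib[symmetric]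
    proof (intro sum.cong refl)
      fix i assume "i \<in> {..<q}"
      then have "0 < l i" "0 < 1 - l i"
        using l l' by auto
      then show "1 / l i * y z i + 1 / (1 - l i) * y z i = k i * y z i"
        by (simp add: k_def field_simps)
    qed
    then have sum: "1 - ?k1 - ?k2 = 1 - (\<Sum>i<q. k i * y z i)"
      by simp
    have "(\<integral>\<^sup>+t. ennreal (pd_weight (Suc q) a b (bordered q Y z t)) \<partial>lborel)
        = (\<integral>\<^sup>+t. ennreal c * ennreal (pospow a (t - ?k1) * pospow b (1 - t - ?k2)) \<partial>lborel)"
      using pd_weight_bordered[OF True U l l', of a b z] c by (simp add: y_def c_def flip: ennreal_mult)
    also have "\<dots> = ennreal c * (ennreal (pospow (a + b + 1) (1 - ?k1 - ?k2)) * beta_int a b)"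
      by (subst nn_integral_cmult) (simp_all add: nn_integral_beta_shift)
    finally show ?thesis
      unfolding sum by (simp only: F_def y_def mult_ac)
  qed
  have "(\<integral>\<^sup>+z. F (mat_apply q (adjoint_mat U) z) \<partial>?V) = (\<integral>\<^sup>+z. F (mat_apply q (adjoint_mat U) (mat_apply q U z)) \<partial>?V)"
    by (rule nn_integral_unitary[OF orth, symmetric])
      (intro measurable_compose[OF measurable_mat_apply F_meas] measurable_ident_sets refl)
  also have "\<dots> = (\<integral>\<^sup>+z. F z \<partial>?V)"
    by (intro nn_integral_cong) (simp add: F_def mat_apply_unitary(2)[OF orth])
  also have "\<dots> = ennreal ((herm_det Y * herm_det (1\<^sub>m q - Y)) powr ?d) * ball_int TYPE('f) q (a + b + 1)"
  proof -
    have "ennreal ((\<Prod>i<q. k i) powr ?d) * (\<integral>\<^sup>+z. F z \<partial>?V) = ball_int TYPE('f) q (a + b + 1)"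
      unfolding F_def ball_int_def
      by (rule nn_integral_scaled_norms[where g = "\<lambda>u. ennreal (pospow (a + b + 1) (1 - u))"]) (use k in auto)
    moreover have "(\<Prod>i<q. k i) = 1 / (herm_det Y * herm_det (1\<^sub>m q - Y))"
      by (simp add: k_def det prod_dividef prod.distrib)
    moreover have "herm_det Y * herm_det (1\<^sub>m q - Y) > 0"
      using herm_det_pos carrier pd by (intro mult_pos_pos) blast+
    ultimately have "0 < (1 / (herm_det Y * herm_det (1\<^sub>m q - Y))) powr ?d"
      "ennreal ((1 / (herm_det Y * herm_det (1\<^sub>m q - Y))) powr ?d) * (\<integral>\<^sup>+z. F z \<partial>?V) = ball_int TYPE('f) q (a + b + 1)"
      by auto
    from ennreal_mult_left_cancel_inverse[OF this] show ?thesis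
      using \<open>herm_det Y * herm_det (1\<^sub>m q - Y) > 0\<close> by (simp add: powr_divide)
  qed
  finally have F_int: "(\<integral>\<^sup>+z. F (mat_apply q (adjoint_mat U) z) \<partial>?V) = \<dots>" .
  have "(\<integral>\<^sup>+z. \<integral>\<^sup>+t. ennreal (pd_weight (Suc q) a b (bordered q Y z t)) \<partial>lborel \<partial>?V)
      = ennreal c * beta_int a b * (\<integral>\<^sup>+z. F (mat_apply q (adjoint_mat U) z) \<partial>?V)"
    unfolding inner by (rule nn_integral_cmult) (intro measurable_compose[OF measurable_mat_apply F_meas] measurable_ident_sets refl)
  also have "\<dots> = beta_int a b * ball_int TYPE('f) q (a + b + 1) * ennreal (c * (herm_det Y * herm_det (1\<^sub>m q - Y)) powr ?d)"
    using c by (simp add: F_int ennreal_mult mult_ac)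
  also have "c * (herm_det Y * herm_det (1\<^sub>m q - Y)) powr ?d = pd_weight q (a + ?d) (b + ?d) Y"
    using herm_det_pos[OF carrier(1) pd(1)] herm_det_pos[OF carrier(2) pd(2)] True
    by (simp add: c_def pd_weight_def powr_mult powr_add)
  finally show ?thesis .
qed

section \<open>Splitting off the last row and column\<close>

abbreviation border_index :: "nat \<Rightarrow> (nat \<times> nat) set" where
  "border_index q \<equiv> (\<lambda>i. (i, q)) ` {..<q}"

lemma upper_index_Suc: "upper_index (Suc q) = upper_index q \<union> border_index q"
  by (auto simp: less_Suc_eq)

lemma measurable_border:
  "(\<lambda>z. \<lambda>ij\<in>border_index q. z (fst ij)) \<in> measurable (vec_lborel q)
    (\<Pi>\<^sub>M ij\<in>border_index q. lborel :: 'f::euclidean_space measure)"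
  by (rule measurable_restrict) (auto intro!: measurable_vec_component[OF measurable_ident_sets])

text \<open>
  The entries of the last column are indexed by pairs in the coordinates of a Hermitian matrix and
  by single numbers in \<open>vec_lborel\<close>; relabelling preserves the measure.
\<close>

lemma distr_border:
  "distr (vec_lborel q) (\<Pi>\<^sub>M ij\<in>border_index q. lborel) (\<lambda>z. \<lambda>ij\<in>border_index q. z (fst ij))
    = (\<Pi>\<^sub>M ij\<in>border_index q. lborel :: 'f::euclidean_space measure)"
proof (rule lborel_PiM.PiM_eqI)
  fix A :: "nat \<times> nat \<Rightarrow> 'f set" assume A: "\<And>ij. ij \<in> border_index q \<Longrightarrow> A ij \<in> sets lborel"
  have "(\<lambda>z. \<lambda>ij\<in>border_index q. z (fst ij)) -` Pi\<^sub>E (border_index q) A \<inter> space (vec_lborel q)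
      = Pi\<^sub>E {..<q} (\<lambda>i. A (i, q))"
    by (auto simp: space_PiM PiE_iff)
  moreover have "Pi\<^sub>E (border_index q) A \<in> sets (\<Pi>\<^sub>M ij\<in>border_index q. lborel :: 'f measure)"
    using A by (intro sets_PiM_I_finite) auto
  moreover have "emeasure (vec_lborel q) (\<Pi>\<^sub>E i\<in>{..<q}. A (i, q)) = (\<Prod>i<q. emeasure lborel (A (i, q)))"
    using A by (intro lborel_PiM.emeasure_PiM) auto
  ultimately show "emeasure (distr (vec_lborel q) (\<Pi>\<^sub>M ij\<in>border_index q. lborel) (\<lambda>z. \<lambda>ij\<in>border_index q. z (fst ij)))
      (Pi\<^sub>E (border_index q) A) = (\<Prod>ij\<in>border_index q. emeasure lborel (A ij))"
    by (simp add: emeasure_distr measurable_border prod.reindex inj_on_def)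
qed simp_all

definition border_coords ::
  "nat \<Rightarrow> (nat \<Rightarrow> real) \<times> (nat \<times> nat \<Rightarrow> 'f) \<Rightarrow> (nat \<Rightarrow> 'f) \<Rightarrow> real \<Rightarrow> (nat \<Rightarrow> real) \<times> (nat \<times> nat \<Rightarrow> 'f)" where
  "border_coords q c z t =
     ((fst c)(q := t), merge (upper_index q) (border_index q) (snd c, \<lambda>ij\<in>border_index q. z (fst ij)))"

lemma herm_of_coords_border:
  "herm_of_coords (Suc q) (border_coords q c z t) = bordered q (herm_of_coords q c) z t"
  by (cases c, intro eq_matI) (auto simp: border_coords_def bordered_def herm_of_coords_def merge_def less_Suc_eq)

lemma measurable_border_coords [measurable (raw)]:
  assumes g: "g \<in> measurable N (coord_lborel q)" and h: "h \<in> measurable N (vec_lborel q)"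
    and k: "k \<in> borel_measurable N"
  shows "(\<lambda>x. border_coords q (g x) (h x) (k x)) \<in> measurable N
    (coord_lborel (Suc q) :: ((nat \<Rightarrow> real) \<times> (nat \<times> nat \<Rightarrow> 'f::euclidean_space)) measure)"
  unfolding border_coords_def
proof (rule measurable_Pair)
  show "(\<lambda>x. (fst (g x))(q := k x)) \<in> measurable N (vec_lborel (Suc q))"
    by (rule measurable_fun_upd[where J = "{..<q}"]) (use g k in \<open>auto simp: lessThan_Suc\<close>)
  show "(\<lambda>x. merge (upper_index q) (border_index q) (snd (g x), \<lambda>ij\<in>border_index q. h x (fst ij)))
      \<in> measurable N (\<Pi>\<^sub>M ij\<in>upper_index (Suc q). lborel)"
    unfolding upper_index_Suc
    by (intro measurable_compose[OF _ measurable_merge] measurable_Pair measurable_compose[OF g measurable_snd]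
        measurable_compose[OF h measurable_border])
qed

lemma measurable_bordered [measurable (raw)]:
  assumes "g \<in> measurable N (coord_lborel q)" "h \<in> measurable N (vec_lborel q)" "k \<in> borel_measurable N"
  shows "(\<lambda>x. bordered q (herm_of_coords q (g x)) (h x) (k x)) \<in> measurable N (herm_lborel (Suc q) :: 'f::herm_scalar mat measure)"
  using measurable_compose[OF measurable_border_coords[OF assms] measurable_herm_of_coords]
  by (simp add: herm_of_coords_border)

lemma sigma_finite_upper:
  "sigma_finite_measure (\<Pi>\<^sub>M ij\<in>upper_index q. lborel :: 'f::euclidean_space measure)"
  by (rule lborel_PiM.sigma_finite) simp

lemma sigma_finite_coord_lborel:
  "sigma_finite_measure (coord_lborel q :: ((nat \<Rightarrow> real) \<times> (nat \<times> nat \<Rightarrow> 'f::euclidean_space)) measure)"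
  by (intro sigma_finite_pair_measure sigma_finite_vec_lborel sigma_finite_upper)

text \<open>
  Fubini's theorem, with the corner entry as the innermost variable, since its integral is computed
  for fixed \<open>Y\<close> and \<open>z\<close>.
\<close>

lemma nn_integral_herm_lborel_Suc:
  fixes g :: "'f::herm_scalar mat \<Rightarrow> ennreal"
  assumes g: "g \<in> borel_measurable (herm_lborel (Suc q))"
  shows "(\<integral>\<^sup>+M. g M \<partial>herm_lborel (Suc q))
    = (\<integral>\<^sup>+c. \<integral>\<^sup>+z. \<integral>\<^sup>+t. g (bordered q (herm_of_coords q c) z t) \<partial>lborel \<partial>vec_lborel q \<partial>coord_lborel q)"
proof -
  let ?Z = "\<lambda>r. \<Pi>\<^sub>M ij\<in>upper_index r. (lborel :: 'f measure)"
  let ?C = "coord_lborel q :: ((nat \<Rightarrow> real) \<times> (nat \<times> nat \<Rightarrow> 'f)) measure"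
  let ?V = "vec_lborel q :: (nat \<Rightarrow> 'f) measure"
  interpret Z': sigma_finite_measure "?Z (Suc q)"
    by (rule sigma_finite_upper)
  interpret Z: sigma_finite_measure "?Z q"
    by (rule sigma_finite_upper)
  interpret V: sigma_finite_measure ?V
    by (rule sigma_finite_vec_lborel)
  interpret C: sigma_finite_measure ?C
    by (rule sigma_finite_coord_lborel)
  interpret LC: pair_sigma_finite "lborel :: real measure" ?C ..
  interpret LV: pair_sigma_finite "lborel :: real measure" ?V ..
  define G where "G c = g (herm_of_coords (Suc q) c)" for c
  have G [measurable]: "G \<in> borel_measurable (coord_lborel (Suc q))"
    unfolding G_def using measurable_compose[OF measurable_herm_of_coords g] .
  have K [measurable]: "(\<lambda>x. G (border_coords q (f x) (h x) (k x))) \<in> borel_measurable N"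
    if "f \<in> measurable N ?C" "h \<in> measurable N ?V" "k \<in> borel_measurable N" for f h k and N :: "'x measure"
    by (rule measurable_compose[OF measurable_border_coords[OF that] G])
  have "(\<integral>\<^sup>+M. g M \<partial>herm_lborel (Suc q)) = (\<integral>\<^sup>+a. \<integral>\<^sup>+\<zeta>. G (a, \<zeta>) \<partial>?Z (Suc q) \<partial>vec_lborel (Suc q))"
    unfolding nn_integral_herm_lborel[OF g] G_def[symmetric] by (rule Z'.nn_integral_fst[symmetric]) (rule G)
  also have "\<dots> = (\<integral>\<^sup>+t. \<integral>\<^sup>+a. \<integral>\<^sup>+\<zeta>. G (a(q := t), \<zeta>) \<partial>?Z (Suc q) \<partial>vec_lborel q \<partial>lborel)"
    by (rule nn_integral_vec_Suc) measurable
  also have "\<dots> = (\<integral>\<^sup>+t. \<integral>\<^sup>+a. \<integral>\<^sup>+\<zeta>. \<integral>\<^sup>+z. G (border_coords q (a, \<zeta>) z t) \<partial>?V \<partial>?Z q \<partial>vec_lborel q \<partial>lborel)"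
  proof (intro nn_integral_cong)
    fix t :: real and a :: "nat \<Rightarrow> real" assume a: "a \<in> space (vec_lborel q)"
    then have a': "a(q := t) \<in> space (vec_lborel (Suc q))"
      by (auto simp: space_PiM lessThan_Suc PiE_iff extensional_def)
    have Ga: "(\<lambda>\<zeta>. G (a(q := t), \<zeta>)) \<in> borel_measurable (?Z (Suc q))"
      by (rule measurable_compose[OF measurable_Pair1'[OF a'] G])
    have "(\<integral>\<^sup>+\<zeta>. G (a(q := t), \<zeta>) \<partial>?Z (Suc q)) =
        (\<integral>\<^sup>+\<zeta>. \<integral>\<^sup>+\<eta>. G (a(q := t), merge (upper_index q) (border_index q) (\<zeta>, \<eta>)) \<partial>(\<Pi>\<^sub>M ij\<in>border_index q. lborel) \<partial>?Z q)"
      unfolding upper_index_Suc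
      by (rule lborel_PiM.product_nn_integral_fold) (use Ga in \<open>auto simp: upper_index_Suc\<close>)
    also have "\<dots> = (\<integral>\<^sup>+\<zeta>. \<integral>\<^sup>+z. G (border_coords q (a, \<zeta>) z t) \<partial>?V \<partial>?Z q)"
    proof (rule nn_integral_cong)
      fix \<zeta> assume \<zeta>: "\<zeta> \<in> space (?Z q)"
      have "(\<lambda>\<eta>. merge (upper_index q) (border_index q) (\<zeta>, \<eta>)) \<in> measurable (\<Pi>\<^sub>M ij\<in>border_index q. lborel) (?Z (Suc q))"
        unfolding upper_index_Suc by (rule measurable_compose[OF measurable_Pair1'[OF \<zeta>] measurable_merge])
      then have meas: "(\<lambda>\<eta>. G (a(q := t), merge (upper_index q) (border_index q) (\<zeta>, \<eta>)))
          \<in> borel_measurable (\<Pi>\<^sub>M ij\<in>border_index q. lborel)"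
        by (rule measurable_compose[OF _ Ga])
      show "(\<integral>\<^sup>+\<eta>. G (a(q := t), merge (upper_index q) (border_index q) (\<zeta>, \<eta>)) \<partial>(\<Pi>\<^sub>M ij\<in>border_index q. lborel))
          = (\<integral>\<^sup>+z. G (border_coords q (a, \<zeta>) z t) \<partial>?V)"
        by (subst distr_border[symmetric], subst nn_integral_distr[OF measurable_border])
          (use meas in \<open>simp_all add: border_coords_def\<close>)
    qed
    finally show "(\<integral>\<^sup>+\<zeta>. G (a(q := t), \<zeta>) \<partial>?Z (Suc q)) = (\<integral>\<^sup>+\<zeta>. \<integral>\<^sup>+z. G (border_coords q (a, \<zeta>) z t) \<partial>?V \<partial>?Z q)" .
  qed
  also have "\<dots> = (\<integral>\<^sup>+t. \<integral>\<^sup>+c. \<integral>\<^sup>+z. G (border_coords q c z t) \<partial>?V \<partial>?C \<partial>lborel)"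
    by (intro nn_integral_cong Z.nn_integral_fst) measurable
  also have "\<dots> = (\<integral>\<^sup>+c. \<integral>\<^sup>+t. \<integral>\<^sup>+z. G (border_coords q c z t) \<partial>?V \<partial>lborel \<partial>?C)"
    by (rule LC.Fubini'[symmetric]) measurable
  also have "\<dots> = (\<integral>\<^sup>+c. \<integral>\<^sup>+z. \<integral>\<^sup>+t. G (border_coords q c z t) \<partial>lborel \<partial>?V \<partial>?C)"
    by (intro nn_integral_cong LV.Fubini'[symmetric]) measurable
  finally show ?thesis
    by (simp add: G_def herm_of_coords_border)
qed

lemma upper_left_block_bordered:
  "Y \<in> carrier_mat q q \<Longrightarrow> upper_left_block q (bordered q Y z t) = Y"
  by (intro eq_matI) (auto simp: upper_left_block_def bordered_def)

lemma nn_integral_projection_step: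
  fixes f :: "'f::herm_scalar mat \<Rightarrow> ennreal"
  assumes f [measurable]: "f \<in> borel_measurable (herm_lborel q)"
  shows "(\<integral>\<^sup>+M. f (upper_left_block q M) * ennreal (pd_weight (Suc q) a b M) \<partial>herm_lborel (Suc q))
    = beta_int a b * ball_int TYPE('f) q (a + b + 1) *
      (\<integral>\<^sup>+Y. f Y * ennreal (pd_weight q (a + real DIM('f) / 2) (b + real DIM('f) / 2) Y) \<partial>herm_lborel q)"
    (is "_ = ?C * (\<integral>\<^sup>+Y. f Y * ?w Y \<partial>_)")
proof -
  have [measurable]: "upper_left_block q \<in> measurable (herm_lborel (Suc q)) (herm_lborel q :: 'f mat measure)"
    by (rule measurable_upper_left_block) simp
  have "(\<integral>\<^sup>+M. f (upper_left_block q M) * ennreal (pd_weight (Suc q) a b M) \<partial>herm_lborel (Suc q))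
    = (\<integral>\<^sup>+c. \<integral>\<^sup>+z. \<integral>\<^sup>+t. f (herm_of_coords q c) * ennreal (pd_weight (Suc q) a b (bordered q (herm_of_coords q c) z t))
        \<partial>lborel \<partial>vec_lborel q \<partial>coord_lborel q)"
    by (subst nn_integral_herm_lborel_Suc) (simp_all add: upper_left_block_bordered)
  also have "\<dots> = (\<integral>\<^sup>+c. ?C * (f (herm_of_coords q c) * ?w (herm_of_coords q c)) \<partial>coord_lborel q)"
  proof (rule nn_integral_cong)
    fix c :: "(nat \<Rightarrow> real) \<times> (nat \<times> nat \<Rightarrow> 'f)" assume c [measurable]: "c \<in> space (coord_lborel q)"
    have w [measurable]: "(\<lambda>x. pd_weight (Suc q) a b (bordered q (herm_of_coords q c) (h x) (k x))) \<in> borel_measurable N"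
      if "h \<in> measurable N (vec_lborel q)" "k \<in> borel_measurable N" for h k and N :: "'x measure"
      by (rule measurable_compose[OF measurable_bordered borel_measurable_pd_weight]) (use c that in simp_all)
    have "(\<integral>\<^sup>+z. \<integral>\<^sup>+t. f (herm_of_coords q c) * ennreal (pd_weight (Suc q) a b (bordered q (herm_of_coords q c) z t)) \<partial>lborel \<partial>vec_lborel q)
        = (\<integral>\<^sup>+z. f (herm_of_coords q c) * (\<integral>\<^sup>+t. ennreal (pd_weight (Suc q) a b (bordered q (herm_of_coords q c) z t)) \<partial>lborel) \<partial>vec_lborel q)"
      by (intro nn_integral_cong nn_integral_cmult) measurable
    also have "\<dots> = f (herm_of_coords q c) * (\<integral>\<^sup>+z. \<integral>\<^sup>+t. ennreal (pd_weight (Suc q) a b (bordered q (herm_of_coords q c) z t)) \<partial>lborel \<partial>vec_lborel q)"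
      by (rule nn_integral_cmult) measurable
    also have "\<dots> = f (herm_of_coords q c) * (?C * ?w (herm_of_coords q c))"
      by (subst nn_integral_pd_weight_bordered) (simp_all add: herm_mats_iff hermitian_herm_of_coords)
    finally show "(\<integral>\<^sup>+z. \<integral>\<^sup>+t. f (herm_of_coords q c) * ennreal (pd_weight (Suc q) a b (bordered q (herm_of_coords q c) z t)) \<partial>lborel \<partial>vec_lborel q)
        = ?C * (f (herm_of_coords q c) * ?w (herm_of_coords q c))"
      by (simp add: mult_ac)
  qed
  also have "\<dots> = (\<integral>\<^sup>+Y. ?C * (f Y * ?w Y) \<partial>herm_lborel q)"
    by (rule nn_integral_herm_lborel[symmetric]) measurable
  also have "\<dots> = ?C * (\<integral>\<^sup>+Y. f Y * ?w Y \<partial>herm_lborel q)"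
    by (rule nn_integral_cmult) measurable
  finally show ?thesis .
qed

section \<open>Projections of beta distributions\<close>

text \<open>
  For \<open>r \<ge> 1\<close> this is \<open>\<mu> - n(r) / r\<close>, and it grows by \<open>d / 2\<close> whenever \<open>r\<close> drops by 1. This form
  extends the recursion to \<open>r = 0\<close>, where the determinant is 1.
\<close>

definition beta_exponent :: "'f::herm_scalar itself \<Rightarrow> nat \<Rightarrow> real \<Rightarrow> real" where
  "beta_exponent _ r \<mu> = \<mu> - 1 - real DIM('f) / 2 * (real r - 1)"

abbreviation beta_pd_weight :: "nat \<Rightarrow> real \<Rightarrow> real \<Rightarrow> 'f::herm_scalar mat \<Rightarrow> real" where
  "beta_pd_weight r \<mu> \<nu> \<equiv> pd_weight r (beta_exponent TYPE('f) r \<mu>) (beta_exponent TYPE('f) r \<nu>)"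

text \<open>
  Removing one row and column at a time contributes a positive and finite factor as long as both
  exponents exceed -1. This is the condition on \<open>\<mu>\<close> and \<open>\<nu>\<close> at size \<open>p\<close>, and it persists at smaller sizes.
\<close>

lemma nn_integral_projection:
  assumes "q \<le> p" "\<mu> > real DIM('f::herm_scalar) * (real p - 1) / 2" "\<nu> > real DIM('f) * (real p - 1) / 2"
  obtains C where "C \<noteq> 0" "C \<noteq> \<infinity>"
    "\<And>f :: 'f mat \<Rightarrow> ennreal. f \<in> borel_measurable (herm_lborel q) \<Longrightarrow>
      (\<integral>\<^sup>+M. f (upper_left_block q M) * ennreal (beta_pd_weight p \<mu> \<nu> M) \<partial>herm_lborel p)
        = C * (\<integral>\<^sup>+Y. f Y * ennreal (beta_pd_weight q \<mu> \<nu> Y) \<partial>herm_lborel q)"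
proof -
  have "\<exists>C. C \<noteq> 0 \<and> C \<noteq> \<infinity> \<and> (\<forall>f :: 'f mat \<Rightarrow> ennreal. f \<in> borel_measurable (herm_lborel q) \<longrightarrow>
      (\<integral>\<^sup>+M. f (upper_left_block q M) * ennreal (beta_pd_weight p \<mu> \<nu> M) \<partial>herm_lborel p)
        = C * (\<integral>\<^sup>+Y. f Y * ennreal (beta_pd_weight q \<mu> \<nu> Y) \<partial>herm_lborel q))"
    using assms
  proof (induction p rule: dec_induct)
    case base
    have "upper_left_block q M = M" if "M \<in> space (herm_lborel q)" for M :: "'f mat"
      using that by (intro eq_matI) (auto simp: upper_left_block_def space_herm_lborel herm_mats_iff)
    then have "(\<integral>\<^sup>+M. f (upper_left_block q M) * ennreal (beta_pd_weight q \<mu> \<nu> M) \<partial>herm_lborel q)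
        = 1 * (\<integral>\<^sup>+Y. f Y * ennreal (beta_pd_weight q \<mu> \<nu> Y) \<partial>herm_lborel q)" for f :: "'f mat \<Rightarrow> ennreal"
      by (simp cong: nn_integral_cong)
    then show ?case
      by (intro exI[of _ 1]) auto
  next
    case (step p)
    let ?a = "beta_exponent TYPE('f) (Suc p) \<mu>" and ?b = "beta_exponent TYPE('f) (Suc p) \<nu>"
    have "real DIM('f) * (real p - 1) / 2 \<le> real DIM('f) * (real (Suc p) - 1) / 2"
      by (intro divide_right_mono mult_left_mono) auto
    then have "\<mu> > real DIM('f) * (real p - 1) / 2" "\<nu> > real DIM('f) * (real p - 1) / 2"
      using step.prems by linarith+
    from step.IH[OF this] obtain C where C: "C \<noteq> 0" "C \<noteq> \<infinity>"
      "\<And>f :: 'f mat \<Rightarrow> ennreal. f \<in> borel_measurable (herm_lborel q) \<Longrightarrow>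
      (\<integral>\<^sup>+M. f (upper_left_block q M) * ennreal (beta_pd_weight p \<mu> \<nu> M) \<partial>herm_lborel p)
        = C * (\<integral>\<^sup>+Y. f Y * ennreal (beta_pd_weight q \<mu> \<nu> Y) \<partial>herm_lborel q)"
      by blast
    have ab: "?a > -1" "?b > -1"
      using step.prems by (auto simp: beta_exponent_def)
    then have "?a + ?b + 1 > -1"
      by simp
    define D where "D = beta_int ?a ?b * ball_int TYPE('f) p (?a + ?b + 1)"
    have D: "D \<noteq> 0" "D \<noteq> \<infinity>"
      using beta_int_bounds[OF ab] ball_int_nonzero ball_int_finite[OF \<open>?a + ?b + 1 > -1\<close>]
      by (auto simp: D_def ennreal_mult_eq_top_iff)
    have exponent: "beta_exponent TYPE('f) (Suc p) \<kappa> + real DIM('f) / 2 = beta_exponent TYPE('f) p \<kappa>" for \<kappa>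
      by (simp add: beta_exponent_def field_simps)
    have block: "upper_left_block q (upper_left_block p M) = upper_left_block q M" for M :: "'f mat"
      using step.hyps by (intro eq_matI) (auto simp: upper_left_block_def)
    have "(\<integral>\<^sup>+M. f (upper_left_block q M) * ennreal (beta_pd_weight (Suc p) \<mu> \<nu> M) \<partial>herm_lborel (Suc p))
        = D * C * (\<integral>\<^sup>+Y. f Y * ennreal (beta_pd_weight q \<mu> \<nu> Y) \<partial>herm_lborel q)"
      if f: "f \<in> borel_measurable (herm_lborel q)" for f :: "'f mat \<Rightarrow> ennreal"
    proof -
      have "(\<lambda>M. f (upper_left_block q M)) \<in> borel_measurable (herm_lborel p)"
        by (rule measurable_compose[OF measurable_upper_left_block[OF step.hyps(1)] f])
      from nn_integral_projection_step[OF this, of ?a ?b] show ?thesis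
        by (simp add: block exponent C(3)[OF f] D_def mult.assoc)
    qed
    then show ?case
      using C D by (intro exI[of _ "D * C"]) (auto simp: ennreal_mult_eq_top_iff)
  qed
  then show ?thesis
    using that by blast
qed

definition beta_mass :: "'f::herm_scalar itself \<Rightarrow> nat \<Rightarrow> real \<Rightarrow> real \<Rightarrow> ennreal" where
  "beta_mass _ r \<mu> \<nu> = (\<integral>\<^sup>+M. ennreal (beta_pd_weight r \<mu> \<nu> M) \<partial>(herm_lborel r :: 'f mat measure))"

lemma beta_mass_0: "beta_mass TYPE('f::herm_scalar) 0 \<mu> \<nu> = 1"
proof -
  interpret Z: sigma_finite_measure "\<Pi>\<^sub>M ij\<in>{} :: (nat \<times> nat) set. (lborel :: 'f measure)"
    by (rule lborel_PiM.sigma_finite) simp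
  have one: "beta_pd_weight 0 \<mu> \<nu> (herm_of_coords 0 c) = 1" for c :: "(nat \<Rightarrow> real) \<times> (nat \<times> nat \<Rightarrow> 'f)"
  proof -
    have pd: "pos_def 0 A" for A :: "nat \<Rightarrow> nat \<Rightarrow> 'f"
      by (simp add: pos_def_def hermitian_def)
    have "eigenbasis 0 A U l" for A U :: "nat \<Rightarrow> nat \<Rightarrow> 'f" and l
      by (simp add: eigenbasis_def orthonormal_cols_def eigenpairs_def)
    then have "herm_det M = 1" if "M \<in> carrier_mat 0 0" for M :: "'f mat"
      using herm_det_eq[OF that pos_def_imp_semidef[OF pd]] by simp
    then show ?thesis
      using pd complement_entries(1)[OF herm_of_coords_carrier, of 0 c] by (simp add: pd_weight_def pd_interval_def)
  qed
  have "beta_mass TYPE('f) 0 \<mu> \<nu> = (\<integral>\<^sup>+c. 1 \<partial>(coord_lborel 0 :: ((nat \<Rightarrow> real) \<times> (nat \<times> nat \<Rightarrow> 'f)) measure))"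
    unfolding beta_mass_def by (subst nn_integral_herm_lborel) (simp_all add: one)
  also have "\<dots> = 1"
    using Z.nn_integral_fst[of "\<lambda>_. 1" "vec_lborel 0 :: (nat \<Rightarrow> real) measure"]
    by (simp add: PiM_empty emeasure_count_space)
  finally show ?thesis .
qed

text \<open>
  The total mass is a positive and finite multiple of the mass at size 0, which is 1.
\<close>

lemma beta_mass_bounds:
  assumes "\<mu> > real DIM('f::herm_scalar) * (real r - 1) / 2" "\<nu> > real DIM('f) * (real r - 1) / 2"
  shows "beta_mass TYPE('f) r \<mu> \<nu> \<noteq> 0" "beta_mass TYPE('f) r \<mu> \<nu> \<noteq> \<infinity>"
proof -
  obtain C where "C \<noteq> 0" "C \<noteq> \<infinity>"
    "\<And>f :: 'f mat \<Rightarrow> ennreal. f \<in> borel_measurable (herm_lborel 0) \<Longrightarrow>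
      (\<integral>\<^sup>+M. f (upper_left_block 0 M) * ennreal (beta_pd_weight r \<mu> \<nu> M) \<partial>herm_lborel r)
        = C * (\<integral>\<^sup>+Y. f Y * ennreal (beta_pd_weight 0 \<mu> \<nu> Y) \<partial>herm_lborel 0)"
    using nn_integral_projection[OF le0 assms] by blast
  from this(1,2) this(3)[of "\<lambda>_. 1"]
  show "beta_mass TYPE('f) r \<mu> \<nu> \<noteq> 0" "beta_mass TYPE('f) r \<mu> \<nu> \<noteq> \<infinity>"
    using beta_mass_0[where 'f='f, of \<mu> \<nu>] by (simp_all add: beta_mass_def)
qed

lemma beta_weight_eq:
  fixes M :: "'f::herm_scalar mat"
  assumes "r \<ge> 1"
  shows "indicator (psd_interval r) M * beta_weight r \<mu> \<nu> M = beta_pd_weight r \<mu> \<nu> M"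
proof -
  have "\<kappa> - herm_dim TYPE('f) r / real r = beta_exponent TYPE('f) r \<kappa>" for \<kappa>
    using assms by (simp add: herm_dim_def beta_exponent_def field_simps)
  then show ?thesis
    by (simp add: beta_weight_eq_pd_weight)
qed

lemma pd_weight_nonneg: "pd_weight r a b M \<ge> 0"
  by (simp add: pd_weight_def)

lemma beta_const_eq:
  assumes "r \<ge> 1"
  shows "beta_const TYPE('f::herm_scalar) r \<mu> \<nu> = enn2real (beta_mass TYPE('f) r \<mu> \<nu>)"
proof -
  have "beta_const TYPE('f) r \<mu> \<nu> = (\<integral>M. beta_pd_weight r \<mu> \<nu> M \<partial>(herm_lborel r :: 'f mat measure))"
    by (simp add: beta_const_def set_lebesgue_integral_def beta_weight_eq[OF assms])
  also have "\<dots> = enn2real (beta_mass TYPE('f) r \<mu> \<nu>)"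
    unfolding beta_mass_def by (rule integral_eq_nn_integral) (auto simp: pd_weight_nonneg)
  finally show ?thesis .
qed

lemma space_matrix_beta: "space (matrix_beta r \<mu> \<nu> :: 'f::herm_scalar mat measure) = psd_interval r"
  using sets.sets_into_space[OF sets_psd_interval] by (auto simp: matrix_beta_def space_restrict_space)

lemma sets_matrix_beta:
  "sets (matrix_beta r \<mu> \<nu> :: 'f::herm_scalar mat measure) = sets (restrict_space (herm_lborel r) (psd_interval r))"
  by (simp add: matrix_beta_def)

lemma emeasure_matrix_beta:
  fixes X :: "'f::herm_scalar mat set"
  assumes r: "r \<ge> 1" and X: "X \<in> sets (matrix_beta r \<mu> \<nu>)"
    and mass: "beta_mass TYPE('f) r \<mu> \<nu> \<noteq> 0" "beta_mass TYPE('f) r \<mu> \<nu> \<noteq> \<infinity>"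
  shows "emeasure (matrix_beta r \<mu> \<nu>) X =
    (\<integral>\<^sup>+M. indicator X M * ennreal (beta_pd_weight r \<mu> \<nu> M) \<partial>herm_lborel r) / beta_mass TYPE('f) r \<mu> \<nu>"
proof -
  let ?S = "psd_interval r :: 'f mat set"
  let ?N = "herm_lborel r :: 'f mat measure"
  define K where "K = beta_const TYPE('f) r \<mu> \<nu>"
  have K: "K > 0" "ennreal K = beta_mass TYPE('f) r \<mu> \<nu>"
    using mass by (auto simp: K_def beta_const_eq[OF r] enn2real_positive_iff less_top zero_less_iff_neq_zero)
  have S: "?S \<inter> space ?N \<in> sets ?N"
    using sets_psd_interval by auto
  have X': "X \<in> sets ?N" "X \<subseteq> ?S"
    using X by (auto simp: sets_matrix_beta sets_restrict_space_iff[OF S])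
  note X'(1) [measurable]
  have "(\<lambda>M. indicator ?S M *\<^sub>R beta_weight r \<mu> \<nu> M) \<in> borel_measurable ?N"
    by (simp add: beta_weight_eq[OF r])
  then have [measurable]: "beta_weight r \<mu> \<nu> \<in> borel_measurable (restrict_space ?N ?S)"
    by (simp add: borel_measurable_restrict_space_iff[OF S])
  have "emeasure (matrix_beta r \<mu> \<nu>) X =
      (\<integral>\<^sup>+M. ennreal (1 / K * beta_weight r \<mu> \<nu> M) * indicator X M \<partial>restrict_space ?N ?S)"
    unfolding matrix_beta_def K_def using X by (intro emeasure_density) (auto simp: sets_matrix_beta)
  also have "\<dots> = (\<integral>\<^sup>+M. ennreal (1 / K * beta_weight r \<mu> \<nu> M) * indicator X M * indicator ?S M \<partial>?N)"
    by (rule nn_integral_restrict_space[OF S])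
  also have "\<dots> = (\<integral>\<^sup>+M. ennreal (1 / K) * (indicator X M * ennreal (beta_pd_weight r \<mu> \<nu> M)) \<partial>?N)"
  proof (rule nn_integral_cong)
    fix M
    show "ennreal (1 / K * beta_weight r \<mu> \<nu> M) * indicator X M * indicator ?S M
        = ennreal (1 / K) * (indicator X M * ennreal (beta_pd_weight r \<mu> \<nu> M))"
      using K(1) X'(2) by (auto simp: beta_weight_eq[OF r, symmetric] split: split_indicator simp flip: ennreal_mult')
  qed
  also have "\<dots> = ennreal (1 / K) * (\<integral>\<^sup>+M. indicator X M * ennreal (beta_pd_weight r \<mu> \<nu> M) \<partial>?N)"
    by (rule nn_integral_cmult) measurable
  also have "\<dots> = (\<integral>\<^sup>+M. indicator X M * ennreal (beta_pd_weight r \<mu> \<nu> M) \<partial>?N) / ennreal K"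
    using K(1) by (simp add: divide_ennreal_def inverse_ennreal inverse_eq_divide mult.commute)
  finally show ?thesis
    by (simp add: K(2))
qed

lemma ennreal_mult_divide_cancel_left:
  assumes "c \<noteq> 0" "c \<noteq> \<infinity>" "y \<noteq> \<infinity>"
  shows "(c * x) / (c * y) = x / (y :: ennreal)"
proof -
  have "(c * x) / (c * y) = (c / c) * (x / y)"
    using assms by (simp add: divide_ennreal_def ennreal_inverse_mult less_top mult_ac)
  then show ?thesis
    using assms by (simp add: less_top)
qed

text \<open>
  The unnormalized measures correspond up to the constant \<open>C\<close>, and their total masses have the
  same ratio.
\<close>

theorem matrix_beta_projection:
  assumes q: "1 \<le> q" "q \<le> p"
    and \<mu>: "\<mu> > real DIM('f::herm_scalar) * (real p - 1) / 2" and \<nu>: "\<nu> > real DIM('f) * (real p - 1) / 2"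
  shows "upper_left_block q \<in> measurable (matrix_beta p \<mu> \<nu> :: 'f mat measure) (matrix_beta q \<mu> \<nu>)"
    and "distr (matrix_beta p \<mu> \<nu> :: 'f mat measure) (matrix_beta q \<mu> \<nu>) (upper_left_block q) = matrix_beta q \<mu> \<nu>"
proof -
  show meas: "upper_left_block q \<in> measurable (matrix_beta p \<mu> \<nu> :: 'f mat measure) (matrix_beta q \<mu> \<nu>)"
  proof -
    have "upper_left_block q \<in> measurable (restrict_space (herm_lborel p) (psd_interval p))
        (restrict_space (herm_lborel q) (psd_interval q) :: 'f mat measure)"
      using upper_left_block_psd_interval[OF q(2)]
      by (intro measurable_restrict_space3 measurable_upper_left_block q) auto
    then show ?thesis
      by (simp add: matrix_beta_def cong: measurable_cong_sets)
  qed
  have p: "1 \<le> p"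
    using q by simp
  obtain C where C: "C \<noteq> 0" "C \<noteq> \<infinity>"
    and proj: "\<And>f :: 'f mat \<Rightarrow> ennreal. f \<in> borel_measurable (herm_lborel q) \<Longrightarrow>
      (\<integral>\<^sup>+M. f (upper_left_block q M) * ennreal (beta_pd_weight p \<mu> \<nu> M) \<partial>herm_lborel p)
        = C * (\<integral>\<^sup>+Y. f Y * ennreal (beta_pd_weight q \<mu> \<nu> Y) \<partial>herm_lborel q)"
    using nn_integral_projection[OF q(2) \<mu> \<nu>] by blast
  have mass: "beta_mass TYPE('f) p \<mu> \<nu> = C * beta_mass TYPE('f) q \<mu> \<nu>"
    using proj[of "\<lambda>_. 1"] by (simp add: beta_mass_def)
  have mass_p: "beta_mass TYPE('f) p \<mu> \<nu> \<noteq> 0" "beta_mass TYPE('f) p \<mu> \<nu> \<noteq> \<infinity>"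
    using beta_mass_bounds[OF \<mu> \<nu>] by auto
  then have mass_q: "beta_mass TYPE('f) q \<mu> \<nu> \<noteq> 0" "beta_mass TYPE('f) q \<mu> \<nu> \<noteq> \<infinity>"
    using mass C by (auto simp: ennreal_mult_top)
  show "distr (matrix_beta p \<mu> \<nu> :: 'f mat measure) (matrix_beta q \<mu> \<nu>) (upper_left_block q) = matrix_beta q \<mu> \<nu>"
  proof (rule measure_eqI)
    fix X :: "'f mat set"
    assume "X \<in> sets (distr (matrix_beta p \<mu> \<nu> :: 'f mat measure) (matrix_beta q \<mu> \<nu>) (upper_left_block q))"
    then have X: "X \<in> sets (matrix_beta q \<mu> \<nu>)"
      by simp
    then have X_borel: "(indicator X :: 'f mat \<Rightarrow> ennreal) \<in> borel_measurable (herm_lborel q)"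
      using sets_psd_interval[of q, where 'f='f] by (auto simp: sets_matrix_beta sets_restrict_space_iff)
    let ?X' = "upper_left_block q -` X \<inter> space (matrix_beta p \<mu> \<nu> :: 'f mat measure)"
    have "indicator ?X' M * ennreal (beta_pd_weight p \<mu> \<nu> M) = indicator X (upper_left_block q M) * ennreal (beta_pd_weight p \<mu> \<nu> M)"
      for M :: "'f mat"
      by (auto simp: space_matrix_beta beta_weight_eq[OF p, symmetric] split: split_indicator)
    then have "emeasure (distr (matrix_beta p \<mu> \<nu>) (matrix_beta q \<mu> \<nu>) (upper_left_block q)) X
        = (\<integral>\<^sup>+M. indicator X (upper_left_block q M) * ennreal (beta_pd_weight p \<mu> \<nu> M) \<partial>herm_lborel p) / beta_mass TYPE('f) p \<mu> \<nu>"
      using emeasure_matrix_beta[OF p measurable_sets[OF meas X] mass_p] by (simp add: emeasure_distr[OF meas X])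
    also have "\<dots> = (C * (\<integral>\<^sup>+Y. indicator X Y * ennreal (beta_pd_weight q \<mu> \<nu> Y) \<partial>herm_lborel q)) / (C * beta_mass TYPE('f) q \<mu> \<nu>)"
      by (simp add: proj[OF X_borel] mass)
    also have "\<dots> = (\<integral>\<^sup>+Y. indicator X Y * ennreal (beta_pd_weight q \<mu> \<nu> Y) \<partial>herm_lborel q) / beta_mass TYPE('f) q \<mu> \<nu>"
      by (rule ennreal_mult_divide_cancel_left[OF C mass_q(2)])
    also have "\<dots> = emeasure (matrix_beta q \<mu> \<nu>) X"
      by (rule emeasure_matrix_beta[OF q(1) X mass_q, symmetric])
    finally show "emeasure (distr (matrix_beta p \<mu> \<nu>) (matrix_beta q \<mu> \<nu>) (upper_left_block q)) X = emeasure (matrix_beta q \<mu> \<nu>) X" .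
  qed simp
qed

theorem proposition6p5:
  fixes p q :: nat and \<mu> \<nu> :: real
  assumes "1 \<le> q" and "q \<le> p"
  shows
    "(\<mu> > real DIM(real) * (real p - 1) / 2 \<and> \<nu> > real DIM(real) * (real p - 1) / 2 \<longrightarrow>
        upper_left_block q \<in> measurable (matrix_beta p \<mu> \<nu> :: real mat measure) (matrix_beta q \<mu> \<nu>) \<and>
        distr (matrix_beta p \<mu> \<nu> :: real mat measure) (matrix_beta q \<mu> \<nu>) (upper_left_block q)
          = matrix_beta q \<mu> \<nu>) \<and>
     (\<mu> > real DIM(complex) * (real p - 1) / 2 \<and> \<nu> > real DIM(complex) * (real p - 1) / 2 \<longrightarrow>
        upper_left_block q \<in> measurable (matrix_beta p \<mu> \<nu> :: complex mat measure) (matrix_beta q \<mu> \<nu>) \<and>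
        distr (matrix_beta p \<mu> \<nu> :: complex mat measure) (matrix_beta q \<mu> \<nu>) (upper_left_block q)
          = matrix_beta q \<mu> \<nu>) \<and>
     (\<mu> > real DIM(quat) * (real p - 1) / 2 \<and> \<nu> > real DIM(quat) * (real p - 1) / 2 \<longrightarrow>
        upper_left_block q \<in> measurable (matrix_beta p \<mu> \<nu> :: quat mat measure) (matrix_beta q \<mu> \<nu>) \<and>
        distr (matrix_beta p \<mu> \<nu> :: quat mat measure) (matrix_beta q \<mu> \<nu>) (upper_left_block q)
          = matrix_beta q \<mu> \<nu>)"
  by (intro conjI impI matrix_beta_projection assms; elim conjE; assumption)

end
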